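(* The following are equivalent for a cardinal $\delta$: (a) $\delta$ is a strong compactness cardinal for $\mathcal L(I)$. (b) For every $\gamma>\delta$ there are $\alpha>\gamma$, a transitive set $M$ and an elementary embedding $j:V_\alpha\to M$ such that $M$ is cardinal correct, the critical point of $j$ is at most $\delta$, and there exists $d\in M$ with $j[\gamma]=\{j(\xi):\xi<\gamma\}\subseteq d$ and $M\models |d|<j(\delta)$.
   Context: $\mathcal L(I)$ is first-order logic augmented with the Härtig (equicardinality) quantifier: $Ixy\,\varphi(x)\psi(y)$ holds iff the sets defined by $\varphi$ and $\psi$ have the same cardinality (in $V$). A theory is ${<}\delta$-satisfiable if each of its subsets of size $<\delta$ has a model; $\delta$ is a strong compactness cardinal for a logic if every ${<}\delta$-satisfiable theory of that logic has a model. A transitive model $M$ of set theory is cardinal correct if every $\gamma$ that $M$ believes to be a cardinal is a cardinal in $V$. *)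

theory Defs
  imports "HOL-Library.Equipollence"
begin

section \<open>The universe of sets\<close>

text \<open>
  The type plays the role of the class \<open>V\<close>, and \<open>elts x\<close> is the extension of the set \<open>x\<close>.
  Separation and replacement are stated for arbitrary predicates and functions of the
  metalogic, so that a collection of sets is the extension of a set iff it is no larger than
  some set, and functions and bijections between sets may be taken in the metalogic. The axiom
  of choice comes from the metalogic, pairing from infinity and replacement.
\<close>

class zfc_universe =
  fixes elts :: "'a \<Rightarrow> 'a set"
  assumes extensionality: "elts x = elts y \<Longrightarrow> x = y"
    and separation: "Y \<subseteq> elts x \<Longrightarrow> \<exists>y. elts y = Y"
    and union: "\<exists>u. elts u = \<Union> (elts ` elts x)"
    and power_set: "\<exists>p. elts p = {y. elts y \<subseteq> elts x}"
    and replacement: "\<exists>y. elts y = f ` elts x"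
    and infinity: "\<exists>x. infinite (elts x)"
    and foundation: "wf {(x, y). x \<in> elts y}"

definition set_of :: "'v::zfc_universe set \<Rightarrow> 'v" where
  "set_of X = (THE x. elts x = X)"

lemma elts_set_of: "elts x = X \<Longrightarrow> elts (set_of X) = X"
  unfolding set_of_def by (rule theI2[of _ x]) (auto intro: extensionality)

definition transitive_set :: "'v::zfc_universe \<Rightarrow> bool" where
  "transitive_set x \<longleftrightarrow> (\<forall>y \<in> elts x. elts y \<subseteq> elts x)"

text \<open>
  \<open>Vset \<alpha>\<close> is \<open>V\<^sub>\<alpha> = \<Union>\<beta><\<alpha>. \<P>(V\<^sub>\<beta>)\<close>, the \<open>\<alpha>\<close>-th level of the cumulative hierarchy.
\<close>

function Vset :: "'v::zfc_universe \<Rightarrow> 'v" where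
  "Vset \<alpha> = set_of {x. \<exists>\<beta> \<in> elts \<alpha>. elts x \<subseteq> elts (Vset \<beta>)}"
  by auto
termination
  by (relation "{(x, y). x \<in> elts y}") (auto intro: foundation)

declare Vset.simps [simp del]

lemma elts_Vset: "elts (Vset \<alpha>) = {x. \<exists>\<beta> \<in> elts \<alpha>. elts x \<subseteq> elts (Vset \<beta>)}"
proof -
  obtain p where p: "elts (p y) = {x. elts x \<subseteq> elts y}" for y :: 'a
    using power_set by metis
  obtain z where z: "elts z = (\<lambda>\<beta>. p (Vset \<beta>)) ` elts \<alpha>"
    using replacement by blast
  obtain u where "elts u = \<Union> (elts ` elts z)"
    using union by blast
  then have "elts u = {x. \<exists>\<beta> \<in> elts \<alpha>. elts x \<subseteq> elts (Vset \<beta>)}"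
    by (auto simp: z p)
  then show ?thesis
    by (subst Vset.simps) (rule elts_set_of)
qed

section \<open>Ordinals and cardinals, relativized to a class\<close>

text \<open>
  Each predicate below is the relativization to \<open>M\<close> of the usual formula of set theory: all
  quantifiers range over \<open>M\<close>. For a set \<open>m\<close>, taking \<open>M = elts m\<close> expresses that \<open>m\<close> satisfies
  the formula; taking \<open>M = UNIV\<close> expresses that the formula is true in \<open>V\<close>. Ordered pairs are
  Kuratowski pairs.
\<close>

definition is_ordinal :: "'v::zfc_universe set \<Rightarrow> 'v \<Rightarrow> bool" where
  "is_ordinal M x \<longleftrightarrow>
     (\<forall>y \<in> elts x \<inter> M. \<forall>z \<in> elts y \<inter> M. z \<in> elts x) \<and>
     (\<forall>y \<in> elts x \<inter> M. \<forall>z \<in> elts y \<inter> M. \<forall>w \<in> elts z \<inter> M. w \<in> elts y)"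

definition is_upair :: "'v::zfc_universe set \<Rightarrow> 'v \<Rightarrow> 'v \<Rightarrow> 'v \<Rightarrow> bool" where
  "is_upair M z x y \<longleftrightarrow> x \<in> elts z \<and> y \<in> elts z \<and> (\<forall>w \<in> elts z \<inter> M. w = x \<or> w = y)"

definition is_pair :: "'v::zfc_universe set \<Rightarrow> 'v \<Rightarrow> 'v \<Rightarrow> 'v \<Rightarrow> bool" where
  "is_pair M p x y \<longleftrightarrow>
     (\<exists>u \<in> M. \<exists>v \<in> M. is_upair M u x x \<and> is_upair M v x y \<and> is_upair M p u v)"

definition is_bijection :: "'v::zfc_universe set \<Rightarrow> 'v \<Rightarrow> 'v \<Rightarrow> 'v \<Rightarrow> bool" where
  "is_bijection M f x y \<longleftrightarrow>
     (\<forall>p \<in> elts f \<inter> M. \<exists>a \<in> elts x \<inter> M. \<exists>b \<in> elts y \<inter> M. is_pair M p a b) \<and>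
     (\<forall>a \<in> elts x \<inter> M. \<exists>!b. b \<in> elts y \<inter> M \<and> (\<exists>p \<in> elts f \<inter> M. is_pair M p a b)) \<and>
     (\<forall>b \<in> elts y \<inter> M. \<exists>!a. a \<in> elts x \<inter> M \<and> (\<exists>p \<in> elts f \<inter> M. is_pair M p a b))"

definition is_equinumerous :: "'v::zfc_universe set \<Rightarrow> 'v \<Rightarrow> 'v \<Rightarrow> bool" where
  "is_equinumerous M x y \<longleftrightarrow> (\<exists>f \<in> M. is_bijection M f x y)"

definition is_cardinal :: "'v::zfc_universe set \<Rightarrow> 'v \<Rightarrow> bool" where
  "is_cardinal M \<kappa> \<longleftrightarrow>
     is_ordinal M \<kappa> \<and> (\<forall>\<beta> \<in> elts \<kappa> \<inter> M. \<not> is_equinumerous M \<beta> \<kappa>)"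

text \<open>\<open>is_cardinality M \<kappa> d\<close> is the relativization of \<open>\<kappa> = |d|\<close>.\<close>

definition is_cardinality :: "'v::zfc_universe set \<Rightarrow> 'v \<Rightarrow> 'v \<Rightarrow> bool" where
  "is_cardinality M \<kappa> d \<longleftrightarrow>
     is_ordinal M \<kappa> \<and> is_equinumerous M \<kappa> d \<and>
     (\<forall>\<beta> \<in> elts \<kappa> \<inter> M. \<not> is_equinumerous M \<beta> d)"

definition cardinality_less :: "'v::zfc_universe set \<Rightarrow> 'v \<Rightarrow> 'v \<Rightarrow> bool" where
  "cardinality_less M d \<mu> \<longleftrightarrow> (\<exists>\<kappa> \<in> elts \<mu> \<inter> M. is_cardinality M \<kappa> d)"

abbreviation Ord :: "'v::zfc_universe \<Rightarrow> bool" where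
  "Ord \<equiv> is_ordinal UNIV"

abbreviation Card :: "'v::zfc_universe \<Rightarrow> bool" where
  "Card \<equiv> is_cardinal UNIV"

definition cardinal_correct :: "'v::zfc_universe \<Rightarrow> bool" where
  "cardinal_correct M \<longleftrightarrow> (\<forall>\<gamma> \<in> elts M. is_cardinal (elts M) \<gamma> \<longrightarrow> Card \<gamma>)"

text \<open>In \<open>V\<close>, equinumerosity is the equipollence of extensions.\<close>

lemma ex_upair: "\<exists>z::'v::zfc_universe. elts z = {x, y}"
proof -
  obtain i :: 'v where "infinite (elts i)" using infinity by blast
  then obtain a b where "a \<in> elts i" "b \<in> elts i" "a \<noteq> b"
    by (metis finite.emptyI finite_insert insertI1 subsetI finite_subset singletonD)
  then have "(\<lambda>w. if w = a then x else y) ` elts i = {x, y}" by auto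
  then show ?thesis using replacement by metis
qed

lemma is_upair_UNIV: "is_upair UNIV z x y \<longleftrightarrow> elts z = {x, y}"
  by (auto simp: is_upair_def)

lemma is_pair_UNIV:
  "is_pair UNIV p x y \<longleftrightarrow> (\<exists>u v. elts u = {x} \<and> elts v = {x, y} \<and> elts p = {u, v})"
  by (auto simp: is_pair_def is_upair_UNIV)

lemma ex_pair: "\<exists>p. is_pair UNIV p x y"
  unfolding is_pair_UNIV using ex_upair[of x x] ex_upair by (metis insert_absorb2)

lemma is_pair_inject:
  assumes "is_pair UNIV p x y" "is_pair UNIV p x' y'" shows "x = x' \<and> y = y'"
  using assms unfolding is_pair_UNIV by (metis doubleton_eq_iff singleton_insert_inj_eq')

lemma is_equinumerous_UNIV: "is_equinumerous UNIV x y \<longleftrightarrow> elts x \<approx> elts y"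
proof
  assume "is_equinumerous UNIV x y"
  then obtain f where f: "is_bijection UNIV f x y" by (auto simp: is_equinumerous_def)
  define R where "R a b \<longleftrightarrow> (\<exists>p \<in> elts f. is_pair UNIV p a b)" for a b
  have 1: "\<forall>a \<in> elts x. \<exists>!b. b \<in> elts y \<and> R a b" and 2: "\<forall>b \<in> elts y. \<exists>!a. a \<in> elts x \<and> R a b"
    using f by (simp_all add: is_bijection_def R_def)
  have "bij_betw (\<lambda>a. THE b. b \<in> elts y \<and> R a b) (elts x) (elts y)"
    unfolding bij_betw_def inj_on_def image_def
  proof (intro conjI ballI impI set_eqI iffI; clarsimp?)
    fix a a' assume "a \<in> elts x" "a' \<in> elts x"
      "(THE b. b \<in> elts y \<and> R a b) = (THE b. b \<in> elts y \<and> R a' b)"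
    then show "a = a'" using theI'[OF bspec[OF 1]] 2 by metis
  next
    fix a assume "a \<in> elts x"
    then show "(THE b. b \<in> elts y \<and> R a b) \<in> elts y" using theI'[OF bspec[OF 1]] by blast
  next
    fix b assume b: "b \<in> elts y"
    then obtain a where a: "a \<in> elts x" "R a b" using 2 by metis
    then have "b = (THE b. b \<in> elts y \<and> R a b)" using theI'[OF bspec[OF 1]] 1 b by metis
    then show "\<exists>a \<in> elts x. b = (THE b. b \<in> elts y \<and> R a b)" using a by blast
  qed
  then show "elts x \<approx> elts y" unfolding eqpoll_def by blast
next
  assume "elts x \<approx> elts y"
  then obtain g where g: "bij_betw g (elts x) (elts y)" unfolding eqpoll_def by blast
  obtain pr :: "'a \<Rightarrow> 'a \<Rightarrow> 'a" where pr: "is_pair UNIV (pr a b) a b" for a b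
    using ex_pair by metis
  obtain f where f: "elts f = (\<lambda>a. pr a (g a)) ` elts x" using replacement by blast
  have R: "(\<exists>p \<in> elts f. is_pair UNIV p a b) \<longleftrightarrow> a \<in> elts x \<and> b = g a" for a b
    unfolding f using pr by (auto dest!: is_pair_inject[OF pr])
  have "is_bijection UNIV f x y"
    unfolding is_bijection_def Int_UNIV_right R
  proof (intro conjI ballI)
    fix p assume "p \<in> elts f"
    then show "\<exists>a \<in> elts x. \<exists>b \<in> elts y. is_pair UNIV p a b"
      using g pr by (auto simp: f dest: bij_betwE)
  next
    fix a assume "a \<in> elts x"
    then show "\<exists>!b. b \<in> elts y \<and> a \<in> elts x \<and> b = g a" using g by (auto dest: bij_betwE)
  next
    fix b assume "b \<in> elts y"
    then show "\<exists>!a. a \<in> elts x \<and> a \<in> elts x \<and> b = g a"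
      using g unfolding bij_betw_def inj_on_def by blast
  qed
  then show "is_equinumerous UNIV x y" by (auto simp: is_equinumerous_def)
qed

lemma Card_iff_eqpoll: "Card \<kappa> \<longleftrightarrow> Ord \<kappa> \<and> (\<forall>\<beta> \<in> elts \<kappa>. \<not> elts \<beta> \<approx> elts \<kappa>)"
  by (simp add: is_cardinal_def is_equinumerous_UNIV)

section \<open>Elementary embeddings of transitive sets\<close>

datatype set_fm =
    SMem nat nat
  | SEq nat nat
  | SNeg set_fm
  | SConj set_fm set_fm
  | SEx nat set_fm

text \<open>\<open>set_sat M s \<phi>\<close>: the structure \<open>(M, \<in>)\<close> satisfies \<open>\<phi>\<close> under the assignment \<open>s\<close>.\<close>

primrec set_sat :: "'v::zfc_universe \<Rightarrow> (nat \<Rightarrow> 'v) \<Rightarrow> set_fm \<Rightarrow> bool" where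
  "set_sat M s (SMem x y) \<longleftrightarrow> s x \<in> elts (s y)"
| "set_sat M s (SEq x y) \<longleftrightarrow> s x = s y"
| "set_sat M s (SNeg \<phi>) \<longleftrightarrow> \<not> set_sat M s \<phi>"
| "set_sat M s (SConj \<phi> \<psi>) \<longleftrightarrow> set_sat M s \<phi> \<and> set_sat M s \<psi>"
| "set_sat M s (SEx x \<phi>) \<longleftrightarrow> (\<exists>a \<in> elts M. set_sat M (s(x := a)) \<phi>)"

definition elementary_embedding :: "'v::zfc_universe \<Rightarrow> 'v \<Rightarrow> ('v \<Rightarrow> 'v) \<Rightarrow> bool" where
  "elementary_embedding N M j \<longleftrightarrow>
     j ` elts N \<subseteq> elts M \<and>
     (\<forall>\<phi> s. range s \<subseteq> elts N \<longrightarrow> (set_sat N s \<phi> \<longleftrightarrow> set_sat M (j \<circ> s) \<phi>))"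

definition critical_point :: "'v::zfc_universe \<Rightarrow> ('v \<Rightarrow> 'v) \<Rightarrow> 'v \<Rightarrow> bool" where
  "critical_point N j \<kappa> \<longleftrightarrow>
     Ord \<kappa> \<and> \<kappa> \<in> elts N \<and> j \<kappa> \<noteq> \<kappa> \<and> (\<forall>\<xi> \<in> elts \<kappa>. j \<xi> = \<xi>)"

section \<open>The logic with the Haertig quantifier\<close>

text \<open>
  Non-logical symbols are arbitrary sets. A symbol applied to \<open>n\<close> arguments counts as \<open>n\<close>-ary, so
  the same set used with different numbers of arguments gives unrelated symbols. Constants are
  nullary function symbols.
\<close>

datatype 's LI_tm = Var nat | Fun 's "'s LI_tm list"

datatype 's LI_fm =
    Eq "'s LI_tm" "'s LI_tm"
  | Rel 's "'s LI_tm list"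
  | Neg "'s LI_fm"
  | Conj "'s LI_fm" "'s LI_fm"
  | Exists nat "'s LI_fm"
  | Haertig nat nat "'s LI_fm" "'s LI_fm"

primrec tm_fv :: "'s LI_tm \<Rightarrow> nat set" where
  "tm_fv (Var x) = {x}"
| "tm_fv (Fun f ts) = \<Union> (set (map tm_fv ts))"

primrec fm_fv :: "'s LI_fm \<Rightarrow> nat set" where
  "fm_fv (Eq t u) = tm_fv t \<union> tm_fv u"
| "fm_fv (Rel r ts) = \<Union> (set (map tm_fv ts))"
| "fm_fv (Neg \<phi>) = fm_fv \<phi>"
| "fm_fv (Conj \<phi> \<psi>) = fm_fv \<phi> \<union> fm_fv \<psi>"
| "fm_fv (Exists x \<phi>) = fm_fv \<phi> - {x}"
| "fm_fv (Haertig x y \<phi> \<psi>) = (fm_fv \<phi> - {x}) \<union> (fm_fv \<psi> - {y})"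

text \<open>
  A structure interprets all symbols; those not occurring in the theory under consideration are
  irrelevant, so this does not restrict the structures for a given vocabulary.
\<close>

record 'v LI_structure =
  carrier :: 'v
  fun_int :: "'v \<Rightarrow> 'v list \<Rightarrow> 'v"
  rel_int :: "'v \<Rightarrow> 'v list \<Rightarrow> bool"

definition wf_structure :: "'v::zfc_universe LI_structure \<Rightarrow> bool" where
  "wf_structure A \<longleftrightarrow>
     elts (carrier A) \<noteq> {} \<and>
     (\<forall>f as. set as \<subseteq> elts (carrier A) \<longrightarrow> fun_int A f as \<in> elts (carrier A))"

primrec LI_val :: "'v LI_structure \<Rightarrow> (nat \<Rightarrow> 'v) \<Rightarrow> 'v LI_tm \<Rightarrow> 'v" where
  "LI_val A s (Var x) = s x"
| "LI_val A s (Fun f ts) = fun_int A f (map (LI_val A s) ts)"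

primrec LI_sat :: "'v::zfc_universe LI_structure \<Rightarrow> (nat \<Rightarrow> 'v) \<Rightarrow> 'v LI_fm \<Rightarrow> bool" where
  "LI_sat A s (Eq t u) \<longleftrightarrow> LI_val A s t = LI_val A s u"
| "LI_sat A s (Rel r ts) \<longleftrightarrow> rel_int A r (map (LI_val A s) ts)"
| "LI_sat A s (Neg \<phi>) \<longleftrightarrow> \<not> LI_sat A s \<phi>"
| "LI_sat A s (Conj \<phi> \<psi>) \<longleftrightarrow> LI_sat A s \<phi> \<and> LI_sat A s \<psi>"
| "LI_sat A s (Exists x \<phi>) \<longleftrightarrow> (\<exists>a \<in> elts (carrier A). LI_sat A (s(x := a)) \<phi>)"
| "LI_sat A s (Haertig x y \<phi> \<psi>) \<longleftrightarrow>
     {a \<in> elts (carrier A). LI_sat A (s(x := a)) \<phi>} \<approx>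
     {b \<in> elts (carrier A). LI_sat A (s(y := b)) \<psi>}"

text \<open>A theory is a set, as opposed to a proper class, of sentences.\<close>

definition LI_theory :: "'v::zfc_universe LI_fm set \<Rightarrow> bool" where
  "LI_theory T \<longleftrightarrow> (\<forall>\<phi> \<in> T. fm_fv \<phi> = {}) \<and> (\<exists>x::'v. T \<lesssim> elts x)"

definition has_model :: "'v::zfc_universe LI_fm set \<Rightarrow> bool" where
  "has_model T \<longleftrightarrow>
     (\<exists>A. wf_structure A \<and>
        (\<forall>\<phi> \<in> T. \<forall>s. range s \<subseteq> elts (carrier A) \<longrightarrow> LI_sat A s \<phi>))"

definition less_satisfiable :: "'v::zfc_universe \<Rightarrow> 'v LI_fm set \<Rightarrow> bool" where
  "less_satisfiable \<delta> T \<longleftrightarrow> (\<forall>T0 \<subseteq> T. T0 \<prec> elts \<delta> \<longrightarrow> has_model T0)"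

definition LI_strong_compactness_cardinal :: "'v::zfc_universe \<Rightarrow> bool" where
  "LI_strong_compactness_cardinal \<delta> \<longleftrightarrow>
     Card \<delta> \<and> (\<forall>T. LI_theory T \<and> less_satisfiable \<delta> T \<longrightarrow> has_model T)"

end

theory Submission
  imports Defs "HOL-Library.Countable"
begin

text \<open>
  If \<open>\<delta>\<close> is a strong compactness cardinal, fix a limit level \<open>W\<close> with \<open>\<gamma> \<in> W\<close> and consider the
  elementary diagram of \<open>W\<close> together with sentences saying that a new constant names a set of fewer
  than \<open>\<delta>\<close> elements containing (the constants for) all \<open>\<xi> < \<gamma>\<close>. Fewer than \<open>\<delta>\<close> of these sentences
  are satisfied in \<open>W\<close>. Two sentences with the Haertig quantifier make a model of the whole theory
  good: one says that cardinals are not equinumerous with their members, whence cardinal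
  correctness, the other that \<open>|V\<^sub>x| < |V\<^sub>y|\<close> for \<open>x \<in> y\<close>, whence well-foundedness. The embedding is
  the interpretation of the constants, followed by the collapse. It moves some ordinal \<open>\<le> \<delta>\<close>, as
  otherwise the covering set would have fewer than \<open>\<delta> \<le> |\<gamma>|\<close> elements.

  Conversely, let \<open>T\<close> be a \<open><\<delta>\<close>-satisfiable theory indexed by an ordinal \<open>\<gamma>\<close>, choose models \<open>A d\<close> of
  the parts of \<open>T\<close> given by the sets \<open>d\<close> of fewer than \<open>\<delta>\<close> indices, and take an embedding \<open>j\<close> and
  \<open>d \<supseteq> j[\<gamma>]\<close> in \<open>M\<close> with \<open>|d| < j \<delta>\<close> in \<open>M\<close>. Then \<open>j(A) d\<close> is a model of \<open>T\<close>: the clauses of the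
  definition of satisfaction transfer to \<open>M\<close>, and that of the Haertig quantifier means the same in
  \<open>M\<close> as in \<open>V\<close> because \<open>M\<close> is cardinal correct. No coding of formulas as sets is needed, since the
  satisfaction relation of each single formula is a set to which \<open>j\<close> applies.
\<close>

section \<open>Sets and classes\<close>

text \<open>The collections to be bounded live in types other than the universe (formulas,
  assignments, pairs), so the universe enters as an explicit type argument.\<close>

definition small :: "'v::zfc_universe itself \<Rightarrow> 'b set \<Rightarrow> bool" where
  "small _ X \<longleftrightarrow> (\<exists>x::'v. X \<lesssim> elts x)"

lemma small_elts [simp]: "small TYPE('v) (elts (x::'v::zfc_universe))"
  unfolding small_def by (rule exI[of _ x]) simp

lemma small_lepoll: "small TYPE('v::zfc_universe) Y \<Longrightarrow> X \<lesssim> Y \<Longrightarrow> small TYPE('v) X"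
  unfolding small_def using lepoll_trans by blast

lemma small_subset: "small TYPE('v::zfc_universe) Y \<Longrightarrow> X \<subseteq> Y \<Longrightarrow> small TYPE('v) X"
  by (rule small_lepoll[OF _ subset_imp_lepoll])

lemma small_image: "small TYPE('v::zfc_universe) X \<Longrightarrow> small TYPE('v) (f ` X)"
  by (rule small_lepoll[OF _ image_lepoll])

lemma elts_inject: "elts x = elts y \<longleftrightarrow> x = y"
  by (auto intro: extensionality)

text \<open>Inverting an injection of \<open>X\<close> into a set on its image, and sending all
  other points to a fixed \<open>b\<close> of \<open>X\<close>, exhibits \<open>X\<close> as the
  image of a set, so replacement applies.\<close>

lemma small_imp_set:
  fixes X :: "'v::zfc_universe set"
  assumes "small TYPE('v) X"
  shows "\<exists>x. elts x = X"
proof (cases "X = {}")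
  case True
  then show ?thesis using separation by blast
next
  case False
  obtain x :: 'v where "X \<lesssim> elts x" using assms by (auto simp: small_def)
  then obtain f where f: "inj_on f X" "f ` X \<subseteq> elts x" unfolding lepoll_def by blast
  obtain b where b: "b \<in> X" using False by blast
  define g where "g w = (if w \<in> f ` X then inv_into X f w else b)" for w
  have "g ` elts x = X"
  proof
    show "g ` elts x \<subseteq> X" using b by (auto simp: g_def inv_into_into)
    show "X \<subseteq> g ` elts x"
    proof
      fix w assume w: "w \<in> X"
      then have "g (f w) = w" using f by (simp add: g_def)
      then show "w \<in> g ` elts x" using f w by (metis image_eqI image_subset_iff)
    qed
  qed
  then show ?thesis using replacement by metis
qed

lemma elts_set_of_small: "small TYPE('v::zfc_universe) X \<Longrightarrow> elts (set_of X) = (X :: 'v set)"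
  by (drule small_imp_set) (erule exE, rule elts_set_of)

lemma small_encode:
  assumes "small TYPE('v::zfc_universe) X"
  obtains e :: "'b \<Rightarrow> 'v::zfc_universe" and x where "inj_on e X" "elts x = e ` X"
proof -
  obtain y :: 'v where "X \<lesssim> elts y" using assms by (auto simp: small_def)
  then obtain e where e: "inj_on e X" "e ` X \<subseteq> elts y" unfolding lepoll_def by blast
  moreover obtain x where "elts x = e ` X" using separation[OF e(2)] by blast
  ultimately show ?thesis using that by blast
qed

definition uset :: "'v::zfc_universe \<Rightarrow> 'v" where
  "uset x = set_of (\<Union> (elts ` elts x))"

lemma elts_uset [simp]: "elts (uset x) = \<Union> (elts ` elts x)"
  unfolding uset_def by (rule exE[OF union]) (rule elts_set_of)

definition pset :: "'v::zfc_universe \<Rightarrow> 'v" where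
  "pset x = set_of {y. elts y \<subseteq> elts x}"

lemma elts_pset [simp]: "elts (pset x) = {y. elts y \<subseteq> elts x}"
  unfolding pset_def by (rule exE[OF power_set]) (rule elts_set_of)

definition up :: "'v::zfc_universe \<Rightarrow> 'v \<Rightarrow> 'v" where
  "up x y = set_of {x, y}"

lemma elts_up [simp]: "elts (up x y) = {x, y}"
  unfolding up_def by (rule exE[OF ex_upair]) (rule elts_set_of)

definition pr :: "'v::zfc_universe \<Rightarrow> 'v \<Rightarrow> 'v" where
  "pr x y = up (up x x) (up x y)"

lemma is_pair_iff: "is_pair UNIV p x y \<longleftrightarrow> p = pr x y"
proof -
  have "is_pair UNIV (pr x y) x y"
    unfolding is_pair_UNIV pr_def
    by (rule exI[of _ "up x x"], rule exI[of _ "up x y"]) simp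
  moreover have "p = q" if "is_pair UNIV p x y" "is_pair UNIV q x y" for p q
    using that unfolding is_pair_UNIV by (metis elts_inject)
  ultimately show ?thesis by blast
qed

lemma pr_inject [simp]: "pr x y = pr x' y' \<longleftrightarrow> x = x' \<and> y = y'"
  using is_pair_inject[of "pr x y" x y x' y'] by (auto simp: is_pair_iff)

lemma small_Union:
  assumes "small TYPE('v::zfc_universe) I" "\<And>i. i \<in> I \<Longrightarrow> small TYPE('v) (F i)"
  shows "small TYPE('v) (\<Union>i\<in>I. F i :: 'v set)"
proof -
  have "small TYPE('v) ((\<lambda>i. set_of (F i)) ` I)" using assms(1) by (rule small_image)
  then obtain y where y: "elts y = (\<lambda>i. set_of (F i)) ` I" using small_imp_set by blast
  have "elts (uset y) = (\<Union>i\<in>I. F i)"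
    using assms(2) by (simp add: y elts_set_of_small)
  then show ?thesis by (metis small_elts)
qed

lemma small_Times:
  assumes "small TYPE('v::zfc_universe) X" "small TYPE('v) Y"
  shows "small TYPE('v) (X \<times> Y)"
proof -
  obtain x y :: 'v where xy: "X \<lesssim> elts x" "Y \<lesssim> elts y"
    using assms by (auto simp: small_def)
  have "small TYPE('v) (\<Union>a\<in>elts x. pr a ` elts y)"
    by (intro small_Union small_image small_elts)
  moreover have "elts x \<times> elts y \<lesssim> (\<Union>a\<in>elts x. pr a ` elts y)"
    unfolding lepoll_def
    by (rule exI[of _ "\<lambda>(a, b). pr a b"]) (auto simp: inj_on_def)
  moreover have "X \<times> Y \<lesssim> elts x \<times> elts y" using xy by (rule times_lepoll_mono)
  ultimately show ?thesis by (meson small_lepoll lepoll_trans)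
qed

lemma small_Pow:
  assumes "small TYPE('v::zfc_universe) X"
  shows "small TYPE('v) (Pow X)"
proof -
  obtain e :: "'a \<Rightarrow> 'v" and x where e: "inj_on e X" "elts x = e ` X"
    using assms by (rule small_encode)
  have "Pow X \<lesssim> elts (pset x)"
    unfolding lepoll_def
  proof (rule exI[of _ "\<lambda>Y. set_of (e ` Y)"], intro conjI)
    have *: "elts (set_of (e ` Y)) = e ` Y" if "Y \<subseteq> X" for Y
      using that e by (metis elts_set_of separation image_mono)
    show "inj_on (\<lambda>Y. set_of (e ` Y)) (Pow X)"
      using e(1) by (intro inj_onI) (metis * PowD inj_on_image_eq_iff)
    show "(\<lambda>Y. set_of (e ` Y)) ` Pow X \<subseteq> elts (pset x)"
    proof (rule image_subsetI)
      fix Y assume "Y \<in> Pow X"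
      then show "set_of (e ` Y) \<in> elts (pset x)"
        using *[of Y] e(2) image_mono[of Y X e] by simp
    qed
  qed
  then show ?thesis unfolding small_def by blast
qed

lemma small_countable: "countable X \<Longrightarrow> small TYPE('v::zfc_universe) X"
proof -
  assume "countable X"
  then have 1: "X \<lesssim> (UNIV::nat set)" unfolding countable_def lepoll_def by auto
  obtain x :: 'v where "infinite (elts x)" using infinity by blast
  then have "(UNIV::nat set) \<lesssim> elts x" by (simp add: infinite_le_lepoll)
  then show ?thesis using 1 unfolding small_def by (meson lepoll_trans)
qed

text \<open>A sequence is determined by its graph, a subset of the product of the naturals with
  \<open>X\<close>.\<close>

lemma small_sequences:
  assumes "small TYPE('v::zfc_universe) X"
  shows "small TYPE('v) {s :: nat \<Rightarrow> 'b. range s \<subseteq> X}"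
proof -
  have "{s :: nat \<Rightarrow> 'b. range s \<subseteq> X} \<lesssim> Pow ((UNIV::nat set) \<times> X)"
    unfolding lepoll_def
  proof (rule exI[of _ "\<lambda>s. (\<lambda>n. (n, s n)) ` UNIV"], intro conjI)
    show "inj_on (\<lambda>s. (\<lambda>n. (n, s n)) ` UNIV) {s :: nat \<Rightarrow> 'b. range s \<subseteq> X}"
    proof (rule inj_onI, rule ext)
      fix s t :: "nat \<Rightarrow> 'b" and n
      assume "(\<lambda>n. (n, s n)) ` UNIV = (\<lambda>n. (n, t n)) ` UNIV"
      moreover have "(n, s n) \<in> (\<lambda>n. (n, s n)) ` UNIV" by (rule rangeI)
      ultimately show "s n = t n" by auto
    qed
  qed auto
  moreover have "small TYPE('v) (Pow ((UNIV::nat set) \<times> X))"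
    by (intro small_Pow small_Times small_countable countableI_type assms)
  ultimately show ?thesis by (rule small_lepoll[rotated])
qed

lemma small_Un:
  assumes "small TYPE('v::zfc_universe) X" "small TYPE('v) Y"
  shows "small TYPE('v) (X \<union> Y)"
proof -
  \<comment> \<open>The elements have an arbitrary type, so the union is written as an image of a
    product, with a Boolean picking the component; \<open>undefined\<close> keeps each factor
    inhabited when \<open>X\<close> or \<open>Y\<close> is empty.\<close>
  have *: "X \<union> Y \<subseteq> (\<lambda>(b, x, y). if b then x else y) `
      ((UNIV::bool set) \<times> (insert undefined X \<times> insert undefined Y))"
  proof
    fix z assume "z \<in> X \<union> Y"
    then consider "z \<in> X" | "z \<in> Y" by blast
    then show "z \<in> (\<lambda>(b, x, y). if b then x else y) `
      (UNIV \<times> (insert undefined X \<times> insert undefined Y))"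
    proof cases
      case 1
      then show ?thesis by (intro image_eqI[of _ _ "(True, z, undefined)"]) auto
    next
      case 2
      then show ?thesis by (intro image_eqI[of _ _ "(False, undefined, z)"]) auto
    qed
  qed
  have ins: "small TYPE('v) (insert undefined Z)" if "small TYPE('v) Z" for Z :: "'a set"
  proof (cases "finite Z")
    case True
    then show ?thesis by (simp add: small_countable countable_finite)
  next
    case False
    then show ?thesis by (rule small_lepoll[OF that infinite_insert_lepoll])
  qed
  have "small TYPE('v) ((UNIV::bool set) \<times> (insert undefined X \<times> insert undefined Y))"
    by (intro small_Times small_countable countableI_type ins assms)
  from small_subset[OF small_image[OF this] *] show ?thesis .
qed

section \<open>Membership induction and the collapse of well-founded relations\<close>

lemma elts_induct [case_names step]:
  assumes "\<And>x. (\<And>y. y \<in> elts x \<Longrightarrow> P y) \<Longrightarrow> P x"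
  shows "P (x::'v::zfc_universe)"
proof (rule wf_induct[OF foundation, of P x])
  fix x :: 'v
  assume "\<forall>y. (y, x) \<in> {(x, y). x \<in> elts y} \<longrightarrow> P y"
  then have "\<And>y. y \<in> elts x \<Longrightarrow> P y" by simp
  then show "P x" by (rule assms)
qed

lemma not_mem_self: "(x::'v::zfc_universe) \<notin> elts x"
proof (induction x rule: elts_induct)
  case (step x)
  show ?case
  proof
    assume x: "x \<in> elts x"
    show False using step[OF x] x by (rule notE)
  qed
qed

lemma ex_elts_minimal:
  assumes "\<exists>x::'v::zfc_universe. P x"
  shows "\<exists>x. P x \<and> (\<forall>y \<in> elts x. \<not> P y)"
proof -
  obtain x where "P x" using assms by blast
  then obtain z where "P z" "\<And>y. (y, z) \<in> {(x, y). x \<in> elts y} \<Longrightarrow> \<not> P y"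
    using wfE_min[OF foundation, of x "Collect P"] by (auto simp only: mem_Collect_eq)
  then show ?thesis by (intro exI[of _ z]) simp
qed

text \<open>The Mostowski collapse, by well-founded recursion. Where the predecessors of
  \<open>x\<close> form a small collection, \<open>set_of\<close> yields the set of their images;
  each use supplies this.\<close>

lemma wf_collapse:
  assumes "wf r"
  obtains c :: "'a \<Rightarrow> 'v::zfc_universe" where "\<And>x. c x = set_of (c ` {y. (y, x) \<in> r})"
proof
  define G :: "('a \<Rightarrow> 'v) \<Rightarrow> 'a \<Rightarrow> 'v" where "G f x = set_of (f ` {y. (y, x) \<in> r})" for f x
  fix x
  have *: "wfrec r G x = G (cut (wfrec r G) r x) x" using assms by (rule wfrec)
  have "cut (wfrec r G) r x ` {y. (y, x) \<in> r} = wfrec r G ` {y. (y, x) \<in> r}"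
    by (rule image_cong) (auto simp: cut_apply)
  then show "wfrec r G x = set_of (wfrec r G ` {y. (y, x) \<in> r})"
    by (subst *) (simp only: G_def)
qed

section \<open>Ordinals and cardinals\<close>

lemma Ord_iff: "Ord x \<longleftrightarrow> transitive_set x \<and> (\<forall>y \<in> elts x. transitive_set y)"
  by (simp add: is_ordinal_def transitive_set_def subset_eq)

lemma Ord_mem: "Ord x \<Longrightarrow> y \<in> elts x \<Longrightarrow> Ord y"
  unfolding Ord_iff transitive_set_def by blast

lemma Ord_subset: "Ord x \<Longrightarrow> y \<in> elts x \<Longrightarrow> elts y \<subseteq> elts x"
  unfolding Ord_iff transitive_set_def by blast

text \<open>Nested membership induction: if \<open>x\<close> and \<open>y\<close> were incomparable,
  the induction hypotheses would put every member of each into the other, and extensionality would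
  identify them.\<close>

lemma Ord_linear: "Ord x \<Longrightarrow> Ord y \<Longrightarrow> x \<in> elts y \<or> x = y \<or> y \<in> elts x"
proof (induction x arbitrary: y rule: elts_induct)
  case (step x)
  note IHx = step.IH and x = \<open>Ord x\<close>
  from \<open>Ord y\<close> show ?case
  proof (induction y rule: elts_induct)
    case (step y)
    show ?case
    proof (rule ccontr)
      assume n: "\<not> (x \<in> elts y \<or> x = y \<or> y \<in> elts x)"
      have "elts x \<subseteq> elts y"
      proof
        fix z assume z: "z \<in> elts x"
        then have "z \<in> elts y \<or> z = y \<or> y \<in> elts z"
          using IHx step.prems x Ord_mem by blast
        then show "z \<in> elts y" using n z Ord_subset[OF x z] by blast
      qed
      moreover have "elts y \<subseteq> elts x"
      proof
        fix z assume z: "z \<in> elts y"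
        then have "x \<in> elts z \<or> x = z \<or> z \<in> elts x"
          using step Ord_mem by blast
        then show "z \<in> elts x" using n z Ord_subset[OF step.prems z] by blast
      qed
      ultimately show False using n extensionality by blast
    qed
  qed
qed

text \<open>The collapse of a well-order of \<open>x\<close> is injective by linearity, and its
  range is an ordinal.\<close>

lemma ex_Ord_eqpoll: "\<exists>\<alpha>::'v::zfc_universe. Ord \<alpha> \<and> elts \<alpha> \<approx> elts (x::'v)"
proof -
  obtain r where r: "well_order_on (elts x) r" using well_order_on by blast
  let ?r = "r - Id"
  have wf: "wf ?r" and fld: "Field r = elts x" and tr: "trans r" and an: "antisym r"
    and tot: "total_on (elts x) r"
    using r well_order_on_Field[OF r]
    by (auto simp: well_order_on_def linear_order_on_def partial_order_on_def preorder_on_def)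
  obtain c :: "'v \<Rightarrow> 'v" where c: "\<And>y. c y = set_of (c ` {z. (z, y) \<in> ?r})"
    by (rule wf_collapse[OF wf]) (rule that)
  have "small TYPE('v) {z. (z, y) \<in> ?r}" for y
    by (rule small_subset[OF small_elts[of x]]) (auto simp: fld[symmetric] Field_def)
  then have ec: "elts (c y) = c ` {z. (z, y) \<in> ?r}" for y
    by (subst c) (simp add: elts_set_of_small small_image)
  define \<alpha> where "\<alpha> = set_of (c ` elts x)"
  have ea: "elts \<alpha> = c ` elts x"
    unfolding \<alpha>_def by (simp add: elts_set_of_small small_image)
  have in_x: "(z, y) \<in> ?r \<Longrightarrow> z \<in> elts x" for z y
    by (auto simp: fld[symmetric] Field_def)
  have tr': "(w, z) \<in> ?r \<Longrightarrow> (z, y) \<in> ?r \<Longrightarrow> (w, y) \<in> ?r" for w z y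
    using tr an by (auto dest: transD antisymD)
  have sub: "elts (c z) \<subseteq> elts (c y)" if "(z, y) \<in> ?r" for z y
    unfolding ec by (rule image_mono) (use tr' that in blast)
  have "transitive_set (c y)" for y
    unfolding transitive_set_def using sub[of _ y] by (auto simp: ec[of y])
  moreover have "elts (c y) \<subseteq> elts \<alpha>" for y
    unfolding ec ea by (rule image_mono) (use in_x in blast)
  ultimately have "Ord \<alpha>"
    unfolding Ord_iff transitive_set_def[of \<alpha>] by (simp add: ea)
  moreover have "inj_on c (elts x)"
  proof (rule inj_onI, rule ccontr)
    fix y z assume *: "y \<in> elts x" "z \<in> elts x" "c y = c z" "y \<noteq> z"
    then have "(y, z) \<in> ?r \<or> (z, y) \<in> ?r" using tot by (auto simp: total_on_def)
    then have "c y \<in> elts (c z) \<or> c z \<in> elts (c y)" unfolding ec by blast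
    then show False using *(3) not_mem_self[of "c y"] by simp
  qed
  then have "elts \<alpha> \<approx> elts x"
    unfolding ea by (metis inj_on_image_eqpoll_self)
  ultimately show ?thesis by blast
qed

lemma ex_Card_eqpoll: "\<exists>\<kappa>::'v::zfc_universe. Card \<kappa> \<and> elts \<kappa> \<approx> elts (x::'v)"
proof -
  obtain \<kappa> :: 'v where k: "Ord \<kappa>" "elts \<kappa> \<approx> elts x"
    and min: "\<And>y. y \<in> elts \<kappa> \<Longrightarrow> \<not> (Ord y \<and> elts y \<approx> elts x)"
    using ex_elts_minimal[of "\<lambda>y. Ord y \<and> elts y \<approx> elts x"] ex_Ord_eqpoll[of x] by blast
  then have "Card \<kappa>"
    unfolding Card_iff_eqpoll using Ord_mem eqpoll_trans by blast
  then show ?thesis using k by blast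
qed

lemma Card_mem_lesspoll: "Card \<delta> \<Longrightarrow> \<kappa> \<in> elts \<delta> \<Longrightarrow> elts \<kappa> \<prec> elts \<delta>"
  unfolding Card_iff_eqpoll lesspoll_def by (auto intro!: subset_imp_lepoll dest: Ord_subset)

lemma Ord_lesspoll_mem:
  assumes "Ord \<kappa>" "Ord \<delta>" "elts \<kappa> \<prec> elts \<delta>"
  shows "\<kappa> \<in> elts \<delta>"
proof -
  have "\<not> elts \<delta> \<subseteq> elts \<kappa>"
    using assms(3) unfolding lesspoll_def
    by (auto dest: subset_imp_lepoll lepoll_antisym)
  then show ?thesis using Ord_linear[OF assms(1,2)] Ord_subset[OF assms(1), of \<delta>] by blast
qed

section \<open>Levels of the cumulative hierarchy\<close>

lemma transitive_Vset: "transitive_set (Vset (x::'v::zfc_universe))"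
proof (induction x rule: elts_induct)
  case (step x)
  then show ?case
    unfolding transitive_set_def elts_Vset[of x] by fast
qed

lemma Vset_mono_mem: "x \<in> elts y \<Longrightarrow> elts (Vset x) \<subseteq> elts (Vset (y::'v::zfc_universe))"
  using transitive_Vset[of x] unfolding transitive_set_def by (auto simp: elts_Vset[of y])

lemma Vset_mem: "x \<in> elts y \<Longrightarrow> Vset x \<in> elts (Vset (y::'v::zfc_universe))"
  by (auto simp: elts_Vset[of y])

lemma subset_Vset: "elts x \<subseteq> elts (Vset (x::'v::zfc_universe))"
proof (induction x rule: elts_induct)
  case (step x)
  then show ?case by (auto simp: elts_Vset[of x])
qed

lemma mem_Vset: "x \<in> elts y \<Longrightarrow> x \<in> elts (Vset (y::'v::zfc_universe))"
  using subset_Vset by blast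

text \<open>By induction on \<open>x\<close>: if \<open>x\<close> is contained in
  \<open>V\<^sub>\<beta>\<close> with \<open>\<beta>\<close> in \<open>\<alpha>\<close>, then so is
  every \<open>V\<^sub>y\<close> with \<open>y\<close> in \<open>x\<close>, whose subsets therefore
  lie in \<open>V\<^sub>\<alpha>\<close>. Hence the level relation at a member of a level is
  interpreted inside that level.\<close>

lemma Vset_subset_Vset: "x \<in> elts (Vset \<alpha>) \<Longrightarrow> elts (Vset x) \<subseteq> elts (Vset (\<alpha>::'v::zfc_universe))"
proof (induction x arbitrary: \<alpha> rule: elts_induct)
  case (step x)
  then obtain \<beta> where b: "\<beta> \<in> elts \<alpha>" "elts x \<subseteq> elts (Vset \<beta>)" by (auto simp: elts_Vset[of \<alpha>])
  show ?case
  proof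
    fix z assume "z \<in> elts (Vset x)"
    then obtain y where y: "y \<in> elts x" "elts z \<subseteq> elts (Vset y)" by (auto simp: elts_Vset[of x])
    then have "elts z \<subseteq> elts (Vset \<beta>)" using step.IH b by blast
    then show "z \<in> elts (Vset \<alpha>)" using b by (auto simp: elts_Vset[of \<alpha>])
  qed
qed

text \<open>Cantor's theorem: every subset of \<open>V\<^sub>x\<close> is an element of
  \<open>V\<^sub>y\<close>, so an injection of \<open>V\<^sub>y\<close> into
  \<open>V\<^sub>x\<close> would inject a power set into its base.\<close>

lemma Vset_lesspoll: "x \<in> elts y \<Longrightarrow> elts (Vset x) \<prec> elts (Vset (y::'v::zfc_universe))"
proof -
  assume xy: "x \<in> elts y"
  have "\<not> elts (Vset y) \<lesssim> elts (Vset x)"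
  proof
    assume "elts (Vset y) \<lesssim> elts (Vset x)"
    moreover have "Pow (elts (Vset x)) \<lesssim> elts (Vset y)"
      unfolding lepoll_def
    proof (rule exI[of _ set_of], intro conjI)
      have *: "elts (set_of X) = X" if "X \<subseteq> elts (Vset x)" for X
        using that by (metis elts_set_of separation)
      show "inj_on set_of (Pow (elts (Vset x)))"
        by (rule inj_onI) (metis * PowD)
      show "set_of ` Pow (elts (Vset x)) \<subseteq> elts (Vset y)"
        using xy * by (force simp: elts_Vset[of y])
    qed
    ultimately have "Pow (elts (Vset x)) \<lesssim> elts (Vset x)" by (rule lepoll_trans[rotated])
    then show False using lesspoll_Pow_self by (auto simp: lesspoll_def dest: lepoll_antisym)
  qed
  then show ?thesis
    using subset_imp_lepoll[OF Vset_mono_mem[OF xy]] eqpoll_imp_lepoll eqpoll_sym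
    unfolding lesspoll_def by blast
qed

section \<open>Successor and limit ordinals, and limit levels\<close>

definition vsuc :: "'v::zfc_universe \<Rightarrow> 'v" where
  "vsuc x = set_of (insert x (elts x))"

lemma elts_vsuc [simp]: "elts (vsuc x) = insert x (elts x)"
proof -
  have "elts (uset (up x (up x x))) = insert x (elts x)" by auto
  then show ?thesis unfolding vsuc_def by (rule elts_set_of)
qed

lemma Ord_vsuc: "Ord x \<Longrightarrow> Ord (vsuc x)"
  unfolding Ord_iff transitive_set_def by auto

text \<open>For an ordinal \<open>x\<close> this is the ordinal \<open>x + \<omega>\<close>.\<close>

definition vlim :: "'v::zfc_universe \<Rightarrow> 'v" where
  "vlim x = set_of (\<Union>n. elts ((vsuc ^^ n) x))"

lemma elts_vlim: "elts (vlim x) = (\<Union>n. elts ((vsuc ^^ n) (x::'v::zfc_universe)))"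
proof -
  have "small TYPE('v) (\<Union>n\<in>UNIV. elts ((vsuc ^^ n) x))"
    by (intro small_Union small_elts small_countable) auto
  then show ?thesis unfolding vlim_def by (simp add: elts_set_of_small)
qed

lemma Ord_vlim: "Ord x \<Longrightarrow> Ord (vlim x)"
proof -
  assume "Ord x"
  then have "Ord ((vsuc ^^ n) x)" for n by (induction n) (auto intro: Ord_vsuc)
  then show ?thesis
    unfolding Ord_iff transitive_set_def elts_vlim by blast
qed

lemma mem_vlim: "x \<in> elts (vlim x)"
  unfolding elts_vlim by (rule UN_I[of 1]) auto

lemma ex_Ord_Vset: "\<exists>\<alpha>::'v::zfc_universe. Ord \<alpha> \<and> elts (x::'v) \<subseteq> elts (Vset \<alpha>)"
proof (induction x rule: elts_induct)
  case (step x)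
  then obtain f :: "'v \<Rightarrow> 'v" where f: "\<And>y. y \<in> elts x \<Longrightarrow> Ord (f y) \<and> elts y \<subseteq> elts (Vset (f y))"
    by metis
  have "small TYPE('v) (\<Union>y\<in>elts x. elts (vsuc (f y)))"
    by (intro small_Union small_elts)
  then obtain \<alpha> :: 'v where a: "elts \<alpha> = (\<Union>y\<in>elts x. elts (vsuc (f y)))"
    using small_imp_set by blast
  have "Ord (vsuc (f y))" if "y \<in> elts x" for y using f that Ord_vsuc by blast
  then have "Ord \<alpha>" unfolding Ord_iff transitive_set_def a by blast
  moreover have "elts x \<subseteq> elts (Vset \<alpha>)"
    using f by (force simp: elts_Vset[of \<alpha>] a)
  ultimately show ?case by blast
qed

text \<open>Closure properties of \<open>V\<^sub>\<lambda>\<close> for limit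
  \<open>\<lambda>\<close>; they yield closure under pairs and the presence of all relations between
  members.\<close>

definition limit_like :: "'v::zfc_universe \<Rightarrow> bool" where
  "limit_like W \<longleftrightarrow> transitive_set W \<and> (\<forall>x \<in> elts W. pset x \<in> elts W) \<and>
     (\<forall>x \<in> elts W. \<forall>y \<in> elts W. \<exists>z \<in> elts W. elts x \<union> elts y \<subseteq> elts z)"

lemma mem_Vset_vlim: "x \<in> elts (Vset (vlim \<alpha>)) \<longleftrightarrow> (\<exists>n. elts x \<subseteq> elts (Vset ((vsuc ^^ n) \<alpha>)))"
proof
  assume "x \<in> elts (Vset (vlim \<alpha>))"
  then obtain n \<beta> where "\<beta> \<in> elts ((vsuc ^^ n) \<alpha>)" "elts x \<subseteq> elts (Vset \<beta>)"
    by (auto simp: elts_Vset[of "vlim \<alpha>"] elts_vlim)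
  then show "\<exists>n. elts x \<subseteq> elts (Vset ((vsuc ^^ n) \<alpha>))" using Vset_mono_mem by blast
next
  assume "\<exists>n. elts x \<subseteq> elts (Vset ((vsuc ^^ n) \<alpha>))"
  then obtain n where n: "elts x \<subseteq> elts (Vset ((vsuc ^^ n) \<alpha>))" by blast
  have "(vsuc ^^ n) \<alpha> \<in> elts ((vsuc ^^ Suc n) \<alpha>)" by simp
  then have "(vsuc ^^ n) \<alpha> \<in> elts (vlim \<alpha>)" unfolding elts_vlim by blast
  then show "x \<in> elts (Vset (vlim \<alpha>))" using n by (auto simp: elts_Vset[of "vlim \<alpha>"])
qed

lemma limit_like_Vset: "limit_like (Vset (vlim (\<alpha>::'v::zfc_universe)))"
proof -
  have mono: "elts (Vset ((vsuc ^^ n) \<alpha>)) \<subseteq> elts (Vset ((vsuc ^^ m) \<alpha>))" if "n \<le> m" for n m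
    using that
  proof (induction m rule: dec_induct)
    case (step m)
    have "elts (Vset ((vsuc ^^ m) \<alpha>)) \<subseteq> elts (Vset ((vsuc ^^ Suc m) \<alpha>))"
      by (rule Vset_mono_mem) simp
    then show ?case using step by blast
  qed simp
  show ?thesis
    unfolding limit_like_def
  proof (intro conjI ballI transitive_Vset)
    fix x assume "x \<in> elts (Vset (vlim \<alpha>))"
    then obtain n where "elts x \<subseteq> elts (Vset ((vsuc ^^ n) \<alpha>))" using mem_Vset_vlim by blast
    then have "elts (pset x) \<subseteq> elts (Vset ((vsuc ^^ Suc n) \<alpha>))"
      by (auto simp: elts_Vset[of "vsuc _"])
    then show "pset x \<in> elts (Vset (vlim \<alpha>))" using mem_Vset_vlim by blast
  next
    fix x y assume "x \<in> elts (Vset (vlim \<alpha>))" "y \<in> elts (Vset (vlim \<alpha>))"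
    then obtain n m where "elts x \<subseteq> elts (Vset ((vsuc ^^ n) \<alpha>))" "elts y \<subseteq> elts (Vset ((vsuc ^^ m) \<alpha>))"
      using mem_Vset_vlim by metis
    then have "elts x \<union> elts y \<subseteq> elts (Vset ((vsuc ^^ max n m) \<alpha>))"
      using mono[of n "max n m"] mono[of m "max n m"] by auto
    moreover have "Vset ((vsuc ^^ max n m) \<alpha>) \<in> elts (Vset (vlim \<alpha>))"
      using mem_Vset_vlim by blast
    ultimately show "\<exists>z\<in>elts (Vset (vlim \<alpha>)). elts x \<union> elts y \<subseteq> elts z" by blast
  qed
qed

context
  fixes W :: "'v::zfc_universe"
  assumes W: "limit_like W"
begin

lemma limit_like_trans: "x \<in> elts W \<Longrightarrow> y \<in> elts x \<Longrightarrow> y \<in> elts W"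
  using W unfolding limit_like_def transitive_set_def by blast

lemma limit_like_pset: "x \<in> elts W \<Longrightarrow> pset x \<in> elts W"
  using W unfolding limit_like_def by blast

lemma limit_like_subset: "x \<in> elts W \<Longrightarrow> elts y \<subseteq> elts x \<Longrightarrow> y \<in> elts W"
  using limit_like_pset[of x] limit_like_trans[of "pset x" y] by simp

lemma limit_like_cover: "x \<in> elts W \<Longrightarrow> y \<in> elts W \<Longrightarrow> \<exists>z \<in> elts W. elts x \<union> elts y \<subseteq> elts z"
  using W unfolding limit_like_def by blast

lemma limit_like_up: "x \<in> elts W \<Longrightarrow> y \<in> elts W \<Longrightarrow> up x y \<in> elts W"
proof -
  assume "x \<in> elts W" "y \<in> elts W"
  then obtain z where "z \<in> elts W" "elts x \<union> elts y \<subseteq> elts z" using limit_like_cover by blast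
  then show ?thesis using limit_like_subset[of "pset z" "up x y"] limit_like_pset by auto
qed

lemma limit_like_pr: "x \<in> elts W \<Longrightarrow> y \<in> elts W \<Longrightarrow> pr x y \<in> elts W"
  unfolding pr_def by (intro limit_like_up)

text \<open>A pair with components in \<open>z\<close> is an element of the double power set of
  \<open>z\<close>, so \<open>f\<close> is a subset of a member of \<open>W\<close>.\<close>

lemma limit_like_pairs:
  assumes "x \<in> elts W" "y \<in> elts W" "elts f \<subseteq> (\<lambda>(a, b). pr a b) ` (elts x \<times> elts y)"
  shows "f \<in> elts W"
proof -
  obtain z where z: "z \<in> elts W" "elts x \<union> elts y \<subseteq> elts z"
    using assms limit_like_cover by blast
  have "elts f \<subseteq> elts (pset (pset z))"
  proof
    fix p assume "p \<in> elts f"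
    then obtain a b where "a \<in> elts x" "b \<in> elts y" "p = pr a b" using assms(3) by auto
    then show "p \<in> elts (pset (pset z))" using z(2) by (auto simp: pr_def)
  qed
  then show ?thesis using z limit_like_pset limit_like_subset by blast
qed

end

section \<open>Set-theoretic formulas\<close>

definition sAll :: "nat \<Rightarrow> set_fm \<Rightarrow> set_fm" where
  "sAll x \<phi> = SNeg (SEx x (SNeg \<phi>))"

definition sImp :: "set_fm \<Rightarrow> set_fm \<Rightarrow> set_fm" where
  "sImp \<phi> \<psi> = SNeg (SConj \<phi> (SNeg \<psi>))"

definition sOr :: "set_fm \<Rightarrow> set_fm \<Rightarrow> set_fm" where
  "sOr \<phi> \<psi> = SNeg (SConj (SNeg \<phi>) (SNeg \<psi>))"

definition sIff :: "set_fm \<Rightarrow> set_fm \<Rightarrow> set_fm" where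
  "sIff \<phi> \<psi> = SConj (sImp \<phi> \<psi>) (sImp \<psi> \<phi>)"

lemma set_sat_connectives [simp]:
  "set_sat M s (sAll x \<phi>) \<longleftrightarrow> (\<forall>a \<in> elts M. set_sat M (s(x := a)) \<phi>)"
  "set_sat M s (sImp \<phi> \<psi>) \<longleftrightarrow> (set_sat M s \<phi> \<longrightarrow> set_sat M s \<psi>)"
  "set_sat M s (sOr \<phi> \<psi>) \<longleftrightarrow> set_sat M s \<phi> \<or> set_sat M s \<psi>"
  "set_sat M s (sIff \<phi> \<psi>) \<longleftrightarrow> (set_sat M s \<phi> \<longleftrightarrow> set_sat M s \<psi>)"
  by (auto simp: sAll_def sImp_def sOr_def sIff_def)

lemma ex1_Int: "(\<exists>!b. b \<in> A \<inter> B \<and> Q b) \<longleftrightarrow>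
    (\<exists>b \<in> B. (b \<in> A \<and> Q b) \<and> (\<forall>c \<in> B. c \<in> A \<and> Q c \<longrightarrow> c = b))"
  by blast

lemma ball_Int: "(\<forall>b \<in> A \<inter> B. Q b) \<longleftrightarrow> (\<forall>b \<in> B. b \<in> A \<longrightarrow> Q b)"
  by blast

lemma bex_Int: "(\<exists>b \<in> A \<inter> B. Q b) \<longleftrightarrow> (\<exists>b \<in> B. b \<in> A \<and> Q b)"
  by blast

text \<open>
  The formulas below choose their bound variables above the free ones, so that they may be
  instantiated at arbitrary variables.
\<close>

definition fm_upair :: "nat \<Rightarrow> nat \<Rightarrow> nat \<Rightarrow> set_fm" where
  "fm_upair z x y = (let w = Suc (z + x + y) in
     SConj (SMem x z) (SConj (SMem y z) (sAll w (sImp (SMem w z) (sOr (SEq w x) (SEq w y))))))"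

lemma set_sat_upair [simp]: "set_sat M s (fm_upair z x y) \<longleftrightarrow> is_upair (elts M) (s z) (s x) (s y)"
  by (simp add: fm_upair_def is_upair_def ball_Int bex_Int Let_def)

definition fm_pair :: "nat \<Rightarrow> nat \<Rightarrow> nat \<Rightarrow> set_fm" where
  "fm_pair p x y = (let u = Suc (p + x + y); v = Suc u in
     SEx u (SEx v (SConj (fm_upair u x x) (SConj (fm_upair v x y) (fm_upair p u v)))))"

lemma set_sat_pair [simp]: "set_sat M s (fm_pair p x y) \<longleftrightarrow> is_pair (elts M) (s p) (s x) (s y)"
  by (simp add: fm_pair_def is_pair_def Let_def)

definition in_rel :: "'v::zfc_universe set \<Rightarrow> 'v \<Rightarrow> 'v \<Rightarrow> 'v \<Rightarrow> bool" where
  "in_rel M r x y \<longleftrightarrow> (\<exists>p \<in> elts r \<inter> M. is_pair M p x y)"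

definition fm_rel :: "nat \<Rightarrow> nat \<Rightarrow> nat \<Rightarrow> set_fm" where
  "fm_rel r x y = (let p = Suc (r + x + y) in SEx p (SConj (SMem p r) (fm_pair p x y)))"

lemma set_sat_rel [simp]: "set_sat M s (fm_rel r x y) \<longleftrightarrow> in_rel (elts M) (s r) (s x) (s y)"
  by (simp add: fm_rel_def in_rel_def ball_Int bex_Int Let_def)

definition fm_bij :: "nat \<Rightarrow> nat \<Rightarrow> nat \<Rightarrow> set_fm" where
  "fm_bij f x y = (let a = Suc (f + x + y); b = Suc a; c = Suc b in
     SConj (sAll c (sImp (SMem c f)
       (SEx a (SConj (SMem a x) (SEx b (SConj (SMem b y) (fm_pair c a b)))))))
    (SConj (sAll a (sImp (SMem a x)
       (SEx b (SConj (SConj (SMem b y) (fm_rel f a b))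
         (sAll c (sImp (SConj (SMem c y) (fm_rel f a c)) (SEq c b)))))))
    (sAll b (sImp (SMem b y)
       (SEx a (SConj (SConj (SMem a x) (fm_rel f a b))
         (sAll c (sImp (SConj (SMem c x) (fm_rel f c b)) (SEq c a)))))))))"

lemma set_sat_bij [simp]: "set_sat M s (fm_bij f x y) \<longleftrightarrow> is_bijection (elts M) (s f) (s x) (s y)"
  unfolding is_bijection_def in_rel_def[symmetric] ex1_Int unfolding ball_Int bex_Int
  by (simp add: fm_bij_def Let_def)

definition fm_equinum :: "nat \<Rightarrow> nat \<Rightarrow> set_fm" where
  "fm_equinum x y = (let f = Suc (x + y) in SEx f (fm_bij f x y))"

lemma set_sat_equinum [simp]:
  "set_sat M s (fm_equinum x y) \<longleftrightarrow> is_equinumerous (elts M) (s x) (s y)"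
  by (simp add: fm_equinum_def is_equinumerous_def Let_def)

definition fm_ord :: "nat \<Rightarrow> set_fm" where
  "fm_ord x = (let y = Suc x; z = Suc y; w = Suc z in
     SConj (sAll y (sImp (SMem y x) (sAll z (sImp (SMem z y) (SMem z x)))))
       (sAll y (sImp (SMem y x) (sAll z (sImp (SMem z y) (sAll w (sImp (SMem w z) (SMem w y))))))))"

lemma set_sat_ord [simp]: "set_sat M s (fm_ord x) \<longleftrightarrow> is_ordinal (elts M) (s x)"
  by (simp add: fm_ord_def is_ordinal_def ball_Int bex_Int Let_def)

definition fm_card :: "nat \<Rightarrow> set_fm" where
  "fm_card x = (let y = Suc x in
     SConj (fm_ord x) (sAll y (sImp (SMem y x) (SNeg (fm_equinum y x)))))"

lemma set_sat_card [simp]: "set_sat M s (fm_card x) \<longleftrightarrow> is_cardinal (elts M) (s x)"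
  by (simp add: fm_card_def is_cardinal_def ball_Int bex_Int Let_def)

definition fm_cardinality :: "nat \<Rightarrow> nat \<Rightarrow> set_fm" where
  "fm_cardinality x d = (let y = Suc (x + d) in SConj (fm_ord x)
     (SConj (fm_equinum x d) (sAll y (sImp (SMem y x) (SNeg (fm_equinum y d))))))"

lemma set_sat_cardinality [simp]:
  "set_sat M s (fm_cardinality x d) \<longleftrightarrow> is_cardinality (elts M) (s x) (s d)"
  by (simp add: fm_cardinality_def is_cardinality_def ball_Int bex_Int Let_def)

definition fm_cardless :: "nat \<Rightarrow> nat \<Rightarrow> set_fm" where
  "fm_cardless d m = (let x = Suc (d + m) in SEx x (SConj (SMem x m) (fm_cardinality x d)))"

lemma set_sat_cardless [simp]:
  "set_sat M s (fm_cardless d m) \<longleftrightarrow> cardinality_less (elts M) (s d) (s m)"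
  by (simp add: fm_cardless_def cardinality_less_def ball_Int bex_Int Let_def)

section \<open>Absoluteness for transitive sets\<close>

context
  fixes M :: "'v::zfc_universe"
  assumes M: "transitive_set M"
begin

lemma transitive_mem: "x \<in> elts M \<Longrightarrow> y \<in> elts x \<Longrightarrow> y \<in> elts M"
  using M unfolding transitive_set_def by blast

lemma transitive_Int: "x \<in> elts M \<Longrightarrow> elts x \<inter> elts M = elts x"
  using transitive_mem by blast

lemma is_upair_transitive: "z \<in> elts M \<Longrightarrow> is_upair (elts M) z x y \<longleftrightarrow> elts z = {x, y}"
  by (auto simp: is_upair_def transitive_Int)

lemma is_pair_transitive:
  assumes "p \<in> elts M"
  shows "is_pair (elts M) p x y \<longleftrightarrow> p = pr x y"
proof
  assume "is_pair (elts M) p x y"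
  then obtain u v where "u \<in> elts M" "v \<in> elts M" "elts u = {x}" "elts v = {x, y}" "elts p = {u, v}"
    using assms by (auto simp: is_pair_def is_upair_transitive)
  then have "is_pair UNIV p x y" unfolding is_pair_UNIV by blast
  then show "p = pr x y" by (simp add: is_pair_iff)
next
  assume p: "p = pr x y"
  then have "up x x \<in> elts p" "up x y \<in> elts p" by (simp_all add: pr_def)
  then have "up x x \<in> elts M" "up x y \<in> elts M" using assms transitive_mem by auto
  then show "is_pair (elts M) p x y"
    unfolding is_pair_def using assms p
    by (intro bexI[of _ "up x x"] bexI[of _ "up x y"]) (simp_all add: is_upair_transitive, simp add: pr_def)
qed

lemma in_rel_transitive: "r \<in> elts M \<Longrightarrow> in_rel (elts M) r x y \<longleftrightarrow> pr x y \<in> elts r"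
  unfolding in_rel_def transitive_Int by (auto simp: is_pair_transitive transitive_mem)

lemma is_bijection_transitive:
  assumes "f \<in> elts M" "x \<in> elts M" "y \<in> elts M"
  shows "is_bijection (elts M) f x y \<longleftrightarrow> is_bijection UNIV f x y"
proof -
  have *: "is_pair (elts M) p a b \<longleftrightarrow> is_pair UNIV p a b" if "p \<in> elts f" for p a b
    using that assms(1) by (simp add: is_pair_iff is_pair_transitive transitive_mem)
  show ?thesis
    unfolding is_bijection_def transitive_Int[OF assms(1)] transitive_Int[OF assms(2)]
      transitive_Int[OF assms(3)] Int_UNIV_right
    by (simp add: * cong: bex_cong_simp)
qed

text \<open>A bijection found in \<open>M\<close> is a bijection in \<open>V\<close>. The converse
  can fail, because \<open>M\<close> may lack bijections.\<close>

lemma is_equinumerous_transitive: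
  assumes "is_equinumerous (elts M) x y" "x \<in> elts M" "y \<in> elts M"
  shows "elts x \<approx> elts y"
proof -
  obtain f where "f \<in> elts M" "is_bijection (elts M) f x y"
    using assms(1) by (auto simp: is_equinumerous_def)
  then have "is_equinumerous UNIV x y"
    using assms is_bijection_transitive unfolding is_equinumerous_def by blast
  then show ?thesis by (simp add: is_equinumerous_UNIV)
qed

lemma is_ordinal_transitive: "x \<in> elts M \<Longrightarrow> is_ordinal (elts M) x \<longleftrightarrow> Ord x"
  unfolding is_ordinal_def Int_UNIV_right
  by (intro arg_cong2[of _ _ _ _ conj] ball_cong refl; metis transitive_Int transitive_mem)

lemma cardinality_less_transitive:
  assumes "cardinality_less (elts M) d m" "d \<in> elts M" "m \<in> elts M"
  shows "\<exists>\<kappa> \<in> elts m. elts \<kappa> \<approx> elts d"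
proof -
  obtain \<kappa> where "\<kappa> \<in> elts m" "\<kappa> \<in> elts M" "is_equinumerous (elts M) \<kappa> d"
    using assms(1) by (auto simp: cardinality_less_def is_cardinality_def)
  then show ?thesis using is_equinumerous_transitive assms(2) by blast
qed

end

lemma limit_like_transitive: "limit_like W \<Longrightarrow> transitive_set W"
  by (simp add: limit_like_def)

text \<open>A bijection between members of \<open>W\<close> is a set of pairs of their elements,
  hence itself a member of the limit level.\<close>

lemma is_equinumerous_limit_like:
  assumes W: "limit_like W" and "x \<in> elts W" "y \<in> elts W"
  shows "is_equinumerous (elts W) x y \<longleftrightarrow> elts x \<approx> elts y"
proof
  assume "elts x \<approx> elts y"
  then obtain f where f: "is_bijection UNIV f x y"
    by (auto simp: is_equinumerous_UNIV[symmetric] is_equinumerous_def)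
  then have "elts f \<subseteq> (\<lambda>(a, b). pr a b) ` (elts x \<times> elts y)"
    by (fastforce simp: is_bijection_def is_pair_iff)
  then have "f \<in> elts W" using limit_like_pairs[OF assms] by blast
  then show "is_equinumerous (elts W) x y"
    unfolding is_equinumerous_def
    using f assms is_bijection_transitive[OF limit_like_transitive[OF W]] by blast
qed (use is_equinumerous_transitive[OF limit_like_transitive[OF W]] assms in blast)

lemma is_cardinal_limit_like:
  assumes W: "limit_like W" and "\<kappa> \<in> elts W"
  shows "is_cardinal (elts W) \<kappa> \<longleftrightarrow> Card \<kappa>"
proof -
  have "is_equinumerous (elts W) \<beta> \<kappa> \<longleftrightarrow> elts \<beta> \<approx> elts \<kappa>" if "\<beta> \<in> elts \<kappa>" for \<beta>
    using is_equinumerous_limit_like[OF W _ assms(2)] limit_like_trans[OF assms] that by blast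
  then show ?thesis
    using is_ordinal_transitive[OF limit_like_transitive[OF W] assms(2)]
      transitive_Int[OF limit_like_transitive[OF W] assms(2)]
    by (simp only: Card_iff_eqpoll is_cardinal_def[of "elts W"]) simp
qed

text \<open>The true cardinality of \<open>d\<close> is an ordinal below \<open>\<delta>\<close> and
  so lies in \<open>W\<close>; a smaller ordinal equinumerous with \<open>d\<close> inside
  \<open>W\<close> would be so in \<open>V\<close>.\<close>

lemma cardinality_less_limit_like:
  assumes W: "limit_like W" and \<delta>: "Card \<delta>" "\<delta> \<in> elts W" and d: "d \<in> elts W" and "elts d \<prec> elts \<delta>"
  shows "cardinality_less (elts W) d \<delta>"
proof -
  obtain \<kappa> :: 'a where k: "Card \<kappa>" "elts \<kappa> \<approx> elts d" using ex_Card_eqpoll by blast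
  have o: "Ord \<kappa>" "Ord \<delta>" using k \<delta> by (simp_all add: is_cardinal_def)
  have "elts \<kappa> \<prec> elts \<delta>" using k(2) assms(5) by (rule eq_lesspoll_trans)
  then have kd: "\<kappa> \<in> elts \<delta>" using Ord_lesspoll_mem o by blast
  then have kW: "\<kappa> \<in> elts W" using limit_like_trans[OF W] \<delta> by blast
  note tr = limit_like_transitive[OF W]
  have "\<not> is_equinumerous (elts W) \<beta> d" if b: "\<beta> \<in> elts \<kappa>" for \<beta>
  proof
    assume "is_equinumerous (elts W) \<beta> d"
    then have "elts \<beta> \<approx> elts d"
      using is_equinumerous_transitive[OF tr] d transitive_mem[OF tr kW b] by blast
    then have "elts \<beta> \<approx> elts \<kappa>" using k(2) eqpoll_sym eqpoll_trans by blast
    then show False using b k(1) by (auto simp: Card_iff_eqpoll)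
  qed
  then have "is_cardinality (elts W) \<kappa> d"
    unfolding is_cardinality_def
    using o(1) is_ordinal_transitive[OF tr kW] is_equinumerous_limit_like[OF W kW d] k(2) by blast
  then show ?thesis unfolding cardinality_less_def using kd kW by blast
qed

section \<open>Elementary embeddings\<close>

text \<open>The list gives the first variables their parameters; all further variables get its head,
  which keeps the range of the assignment inside the structure.\<close>

definition env :: "'a list \<Rightarrow> nat \<Rightarrow> 'a" where
  "env xs n = (if n < length xs then xs ! n else hd xs)"

lemma elementary_env:
  assumes "elementary_embedding N M j" "set xs \<subseteq> elts N" "xs \<noteq> []"
  shows "set_sat N (env xs) \<phi> \<longleftrightarrow> set_sat M (env (map j xs)) \<phi>"
proof -
  have "env (map j xs) = j \<circ> env xs"
    using assms(3) by (auto simp: env_def fun_eq_iff hd_map)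
  moreover have "range (env xs) \<subseteq> elts N"
    using assms(2,3) by (auto simp: env_def)
  ultimately show ?thesis using assms(1) unfolding elementary_embedding_def by metis
qed

lemma elementary_mem:
  assumes "elementary_embedding N M j" "x \<in> elts N" "y \<in> elts N"
  shows "j x \<in> elts (j y) \<longleftrightarrow> x \<in> elts y"
  using elementary_env[OF assms(1), of "[x, y]" "SMem 0 1"] assms(2,3) by (simp add: env_def)

lemma elementary_inj:
  assumes "elementary_embedding N M j"
  shows "inj_on j (elts N)"
proof (rule inj_onI)
  fix x y assume "x \<in> elts N" "y \<in> elts N" "j x = j y"
  then show "x = y"
    using elementary_env[OF assms(1), of "[x, y]" "SEq 0 1"] by (simp add: env_def)
qed

lemma elementary_closed: "elementary_embedding N M j \<Longrightarrow> x \<in> elts N \<Longrightarrow> j x \<in> elts M"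
  unfolding elementary_embedding_def by blast

section \<open>Relativization and the restriction of embeddings\<close>

primrec relativize :: "nat \<Rightarrow> set_fm \<Rightarrow> set_fm" where
  "relativize w (SMem x y) = SMem x y"
| "relativize w (SEq x y) = SEq x y"
| "relativize w (SNeg \<phi>) = SNeg (relativize w \<phi>)"
| "relativize w (SConj \<phi> \<psi>) = SConj (relativize w \<phi>) (relativize w \<psi>)"
| "relativize w (SEx x \<phi>) = SEx x (SConj (SMem x w) (relativize w \<phi>))"

text \<open>A number above every variable of the formula, free or bound; from there on variables are
  free to name the relativizing set.\<close>

primrec fm_bound :: "set_fm \<Rightarrow> nat" where
  "fm_bound (SMem x y) = Suc (x + y)"
| "fm_bound (SEq x y) = Suc (x + y)"
| "fm_bound (SNeg \<phi>) = fm_bound \<phi>"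
| "fm_bound (SConj \<phi> \<psi>) = fm_bound \<phi> + fm_bound \<psi>"
| "fm_bound (SEx x \<phi>) = Suc (x + fm_bound \<phi>)"

lemma set_sat_relativize:
  assumes "elts W \<subseteq> elts N" "fm_bound \<phi> \<le> w"
  shows "set_sat N (s(w := W)) (relativize w \<phi>) \<longleftrightarrow> set_sat W s \<phi>"
  using assms(2)
proof (induction \<phi> arbitrary: s)
  case (SEx x \<phi>)
  have "set_sat N (s(w := W, x := a)) (relativize w \<phi>) \<longleftrightarrow> set_sat W (s(x := a)) \<phi>" for a
  proof -
    have "s(w := W, x := a) = s(x := a, w := W)" using SEx.prems by (auto simp: fun_upd_twist)
    moreover have "fm_bound \<phi> \<le> w" using SEx.prems by simp
    ultimately show ?thesis using SEx.IH[of "s(x := a)"] by (simp only:)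
  qed
  moreover have "(s(w := W, x := a)) w = W" "(s(w := W, x := a)) x = a" for a
    using SEx.prems by auto
  ultimately show ?case
    unfolding relativize.simps set_sat.simps using assms(1) by (simp only:) blast
qed auto

text \<open>Satisfaction in \<open>W\<close> is expressed in \<open>N\<close> by relativization,
  with \<open>W\<close> as a parameter that the embedding moves to \<open>j W\<close>.\<close>

lemma elementary_restrict:
  assumes j: "elementary_embedding N M j" and M: "transitive_set M" and N: "transitive_set N"
    and W: "W \<in> elts N"
  shows "elementary_embedding W (j W) j"
  unfolding elementary_embedding_def
proof (intro conjI allI impI)
  have WN: "elts W \<subseteq> elts N" using N W by (auto simp: transitive_set_def)
  have WM: "elts (j W) \<subseteq> elts M"
    using M elementary_closed[OF j W] by (auto simp: transitive_set_def)
  show "j ` elts W \<subseteq> elts (j W)" using elementary_mem[OF j _ W] WN by blast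
  fix \<phi> and s :: "nat \<Rightarrow> 'a" assume s: "range s \<subseteq> elts W"
  define w where "w = fm_bound \<phi>"
  have "set_sat W s \<phi> \<longleftrightarrow> set_sat N (s(w := W)) (relativize w \<phi>)"
    using set_sat_relativize[OF WN, of \<phi> w s] by (simp add: w_def)
  also have "\<dots> \<longleftrightarrow> set_sat M (j \<circ> s(w := W)) (relativize w \<phi>)"
  proof -
    have "range (s(w := W)) \<subseteq> elts N" using s WN W by auto
    then show ?thesis using j unfolding elementary_embedding_def by blast
  qed
  also have "j \<circ> s(w := W) = (j \<circ> s)(w := j W)" by auto
  also have "set_sat M ((j \<circ> s)(w := j W)) (relativize w \<phi>) \<longleftrightarrow> set_sat (j W) (j \<circ> s) \<phi>"
    using set_sat_relativize[OF WM] by (simp add: w_def)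
  finally show "set_sat W s \<phi> \<longleftrightarrow> set_sat (j W) (j \<circ> s) \<phi>" .
qed

section \<open>From compactness to embeddings\<close>

instance set_fm :: countable
  by countable_datatype

lemma wf_lesspoll: "wf {(X :: 'a set, Y :: 'a set). X \<prec> Y}"
proof (rule wf_subset)
  show "wf (inv_image ordLess (card_of :: 'a set \<Rightarrow> _))" by (intro wf_inv_image wf_ordLess)
  have "(card_of X, card_of Y) \<in> ordLess" if "X \<prec> Y" for X Y :: "'a set"
  proof -
    have "\<not> Y \<lesssim> X" using that lepoll_antisym by (auto simp: lesspoll_def)
    then show ?thesis unfolding lepoll_def by (simp only: card_of_ordLess)
  qed
  then show "{(X :: 'a set, Y). X \<prec> Y} \<subseteq> inv_image ordLess card_of"
    by (auto simp: inv_image_def)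
qed

text \<open>
  One symbol serves for two relations, told apart by the number of arguments: membership, and
  the relation \<open>z \<in> V\<^sub>x\<close>.
\<close>

definition LI_mem :: "'v::zfc_universe LI_tm \<Rightarrow> 'v LI_tm \<Rightarrow> 'v LI_fm" where
  "LI_mem t u = Rel (set_of {}) [t, u]"

definition LI_level :: "nat \<Rightarrow> nat \<Rightarrow> 'v::zfc_universe LI_fm" where
  "LI_level x z = Rel (set_of {}) [Var x, Var z, Var z]"

text \<open>Terms for the free variables are carried along in \<open>\<sigma>\<close> instead of
  being substituted; under a quantifier the bound variable is reset to itself.\<close>

primrec LI_of :: "set_fm \<Rightarrow> (nat \<Rightarrow> 'v::zfc_universe LI_tm) \<Rightarrow> 'v LI_fm" where
  "LI_of (SMem x y) \<sigma> = LI_mem (\<sigma> x) (\<sigma> y)"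
| "LI_of (SEq x y) \<sigma> = Eq (\<sigma> x) (\<sigma> y)"
| "LI_of (SNeg \<phi>) \<sigma> = Neg (LI_of \<phi> \<sigma>)"
| "LI_of (SConj \<phi> \<psi>) \<sigma> = Conj (LI_of \<phi> \<sigma>) (LI_of \<psi> \<sigma>)"
| "LI_of (SEx x \<phi>) \<sigma> = Exists x (LI_of \<phi> (\<sigma>(x := Var x)))"

lemma fm_fv_LI_of: "fm_fv (LI_of \<phi> \<sigma>) \<subseteq> (\<Union>n. tm_fv (\<sigma> n))"
proof (induction \<phi> arbitrary: \<sigma>)
  case (SEx x \<phi>)
  have "(\<Union>n. tm_fv ((\<sigma>(x := Var x)) n)) \<subseteq> insert x (\<Union>n. tm_fv (\<sigma> n))"
    by (auto split: if_splits)
  with SEx[of "\<sigma>(x := Var x)"]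
  have "fm_fv (LI_of \<phi> (\<sigma>(x := Var x))) \<subseteq> insert x (\<Union>n. tm_fv (\<sigma> n))" by (rule order_trans)
  then show ?case unfolding LI_of.simps fm_fv.simps by blast
qed (auto simp: LI_mem_def)

text \<open>The structure is isomorphic to \<open>(M, \<in>)\<close> through \<open>\<pi>\<close>.
  As \<open>\<sigma>\<close> takes each variable to itself or to a constant, no variable is
  captured.\<close>

lemma LI_sat_LI_of:
  assumes A: "wf_structure A"
    and inj: "inj_on \<pi> (elts (carrier A))" and M: "elts M = \<pi> ` elts (carrier A)"
    and mem: "\<And>x y. x \<in> elts (carrier A) \<Longrightarrow> y \<in> elts (carrier A) \<Longrightarrow>
      rel_int A (set_of {}) [x, y] \<longleftrightarrow> \<pi> x \<in> elts (\<pi> y)"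
    and \<sigma>: "\<And>n. \<sigma> n = Var n \<or> (\<exists>c. \<sigma> n = Fun c [])"
    and s: "range s \<subseteq> elts (carrier A)"
  shows "LI_sat A s (LI_of \<phi> \<sigma>) \<longleftrightarrow> set_sat M (\<lambda>n. \<pi> (LI_val A s (\<sigma> n))) \<phi>"
  using \<sigma> s
proof (induction \<phi> arbitrary: \<sigma> s)
  case (SEx x \<phi>)
  have "LI_sat A (s(x := a)) (LI_of \<phi> (\<sigma>(x := Var x))) \<longleftrightarrow>
      set_sat M ((\<lambda>n. \<pi> (LI_val A s (\<sigma> n)))(x := \<pi> a)) \<phi>" if a: "a \<in> elts (carrier A)" for a
  proof -
    have 1: "(\<lambda>n. \<pi> (LI_val A (s(x := a)) ((\<sigma>(x := Var x)) n))) = (\<lambda>n. \<pi> (LI_val A s (\<sigma> n)))(x := \<pi> a)"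
    proof
      fix n
      from SEx.prems(1)[of n]
      show "\<pi> (LI_val A (s(x := a)) ((\<sigma>(x := Var x)) n)) = ((\<lambda>n. \<pi> (LI_val A s (\<sigma> n)))(x := \<pi> a)) n"
        by auto
    qed
    have 2: "(\<sigma>(x := Var x)) n = Var n \<or> (\<exists>c. (\<sigma>(x := Var x)) n = Fun c [])" for n
      using SEx.prems(1)[of n] by simp
    have 3: "range (s(x := a)) \<subseteq> elts (carrier A)"
      using SEx.prems(2) a by auto
    show ?thesis using SEx.IH[OF 2 3] unfolding 1 .
  qed
  then show ?case by (simp add: M cong: bex_cong_simp)
next
  case (SMem x y)
  have "LI_val A s (\<sigma> n) \<in> elts (carrier A)" for n
    using SMem(1)[of n] subsetD[OF SMem(2) rangeI[of s n]] A by (auto simp: wf_structure_def)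
  then show ?case by (simp add: LI_mem_def mem)
next
  case (SEq x y)
  have "LI_val A s (\<sigma> n) \<in> elts (carrier A)" for n
    using SEq(1)[of n] subsetD[OF SEq(2) rangeI[of s n]] A by (auto simp: wf_structure_def)
  then show ?case by (simp add: inj_on_eq_iff[OF inj])
qed auto

text \<open>The members of \<open>W\<close> serve as constant symbols for themselves.\<close>

definition diagram :: "'v::zfc_universe \<Rightarrow> 'v LI_fm set" where
  "diagram W = {LI_of \<phi> (\<lambda>n. Fun (s n) []) | \<phi> s. range s \<subseteq> elts W \<and> set_sat W s \<phi>}"

text \<open>
  Along the membership relation of a model, the sets \<open>{z. z \<in> V\<^sub>x}\<close> strictly grow in cardinality.
  As there is no infinite descending sequence of cardinalities, the model is well-founded.
\<close>

definition level_sentence :: "'v::zfc_universe LI_fm" where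
  "level_sentence = Neg (Exists 0 (Exists 1 (Conj (LI_mem (Var 0) (Var 1))
     (Neg (Conj (Neg (Exists 2 (Conj (LI_level 0 2) (Neg (LI_level 1 2)))))
       (Neg (Haertig 2 2 (LI_level 0 2) (LI_level 1 2))))))))"

text \<open>The first conjunct means being a cardinal in the sense of the model, while the last
  compares sizes in \<open>V\<close>. All variables but 0 are sent to a constant, so that only
  variable 0 can be free in the translated formula.\<close>

definition card_sentence :: "'v::zfc_universe LI_fm" where
  "card_sentence = Neg (Exists 0 (Exists 1
     (Conj (LI_of (fm_card 0) (\<lambda>n. if n = 0 then Var 0 else Fun (set_of {}) []))
     (Conj (LI_mem (Var 1) (Var 0))
       (Haertig 2 2 (LI_mem (Var 2) (Var 1)) (LI_mem (Var 2) (Var 0)))))))"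

text \<open>Since \<open>W \<notin> W\<close>, the symbol \<open>W\<close> is free to serve as the constant for the covering set.\<close>

definition cover_sentence :: "'v::zfc_universe \<Rightarrow> 'v \<Rightarrow> 'v LI_fm" where
  "cover_sentence W \<xi> = LI_mem (Fun \<xi> []) (Fun W [])"

definition small_cover_sentence :: "'v::zfc_universe \<Rightarrow> 'v \<Rightarrow> 'v LI_fm" where
  "small_cover_sentence W \<delta> = LI_of (fm_cardless 0 1) (\<lambda>n. if n = 0 then Fun W [] else Fun \<delta> [])"

definition embedding_theory :: "'v::zfc_universe \<Rightarrow> 'v \<Rightarrow> 'v \<Rightarrow> 'v LI_fm set" where
  "embedding_theory W \<gamma> \<delta> = diagram W \<union> cover_sentence W ` elts \<gamma> \<union>
     {level_sentence, card_sentence, small_cover_sentence W \<delta>}"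

lemma LI_theory_embedding_theory: "LI_theory (embedding_theory W \<gamma> (\<delta>::'v::zfc_universe))"
proof -
  have "fm_fv \<phi> = {}" if "\<phi> \<in> diagram W" for \<phi>
    using that fm_fv_LI_of[where 'a = 'v] by (fastforce simp: diagram_def)
  moreover have "fm_fv (cover_sentence W \<xi>) = {}" for \<xi>
    by (simp add: cover_sentence_def LI_mem_def)
  moreover have "fm_fv (level_sentence :: 'v LI_fm) = {}"
    by (auto simp: level_sentence_def LI_mem_def LI_level_def)
  moreover have "fm_fv (card_sentence :: 'v LI_fm) = {}"
  proof -
    have "fm_fv (LI_of (fm_card 0) (\<lambda>n. if n = 0 then Var 0 else Fun (set_of {} :: 'v) [])) \<subseteq> {0}"
      by (rule order_trans[OF fm_fv_LI_of]) (auto split: if_splits)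
    then show ?thesis by (auto simp: card_sentence_def LI_mem_def)
  qed
  moreover have "fm_fv (small_cover_sentence W \<delta>) = {}"
  proof -
    have "fm_fv (small_cover_sentence W \<delta>) \<subseteq> {}"
      unfolding small_cover_sentence_def
      by (rule order_trans[OF fm_fv_LI_of]) (auto split: if_splits)
    then show ?thesis by simp
  qed
  moreover have "small TYPE('v) (embedding_theory W \<gamma> \<delta>)"
  proof -
    \<comment> \<open>A sentence of the diagram is given by one of countably many formulas and a
      sequence of parameters from \<open>W\<close>.\<close>
    have 1: "diagram W \<subseteq> (\<lambda>(\<phi>, s). LI_of \<phi> (\<lambda>n. Fun (s n) [])) ` (UNIV \<times> {s. range s \<subseteq> elts W})"
      unfolding diagram_def by auto
    have 2: "small TYPE('v) ((UNIV :: set_fm set) \<times> {s :: nat \<Rightarrow> 'v. range s \<subseteq> elts W})"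
      by (intro small_Times small_sequences small_countable small_elts) simp
    have "small TYPE('v) (diagram W)" by (rule small_subset[OF small_image[OF 2] 1])
    moreover have "small TYPE('v) (cover_sentence W ` elts \<gamma>)"
      by (rule small_image[OF small_elts])
    moreover have "small TYPE('v) {level_sentence, card_sentence, small_cover_sentence W \<delta>}"
      by (rule small_countable) simp
    ultimately show ?thesis
      unfolding embedding_theory_def by (intro small_Un)
  qed
  ultimately show ?thesis
    unfolding LI_theory_def small_def embedding_theory_def by auto
qed

text \<open>Members of \<open>W\<close> name themselves, and every other constant, in particular the
  symbol \<open>W\<close>, names the cover \<open>d\<close>, which is also the value of all
  functions with arguments. The number of arguments separates membership from the level
  relation.\<close>

definition expansion :: "'v::zfc_universe \<Rightarrow> 'v \<Rightarrow> 'v LI_structure" where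
  "expansion W d = \<lparr>carrier = W,
     fun_int = (\<lambda>c as. if as = [] \<and> c \<in> elts W then c else d),
     rel_int = (\<lambda>_ as. if length as = 2 then as ! 0 \<in> elts (as ! 1) else as ! 1 \<in> elts (Vset (as ! 0)))\<rparr>"

lemma expansion_simps [simp]:
  "carrier (expansion W d) = W"
  "fun_int (expansion W d) c [] = (if c \<in> elts W then c else d)"
  "rel_int (expansion W d) r [x, y] \<longleftrightarrow> x \<in> elts y"
  "rel_int (expansion W d) r [x, z, z'] \<longleftrightarrow> z \<in> elts (Vset x)"
  by (simp_all add: expansion_def)

lemma wf_structure_expansion: "d \<in> elts W \<Longrightarrow> wf_structure (expansion W d)"
  by (auto simp: wf_structure_def expansion_def)

lemma LI_sat_expansion:
  assumes d: "d \<in> elts W"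
    and \<sigma>: "\<And>n. \<sigma> n = Var n \<or> (\<exists>c. \<sigma> n = Fun c [])" and s: "range s \<subseteq> elts W"
  shows "LI_sat (expansion W d) s (LI_of \<phi> \<sigma>) \<longleftrightarrow>
    set_sat W (\<lambda>n. LI_val (expansion W d) s (\<sigma> n)) \<phi>"
  by (rule LI_sat_LI_of[OF wf_structure_expansion[OF d], where \<pi> = "\<lambda>x. x"])
    (use \<sigma> s in simp_all)

text \<open>A part of size below \<open>\<delta>\<close> contains fewer than \<open>\<delta>\<close>
  covering sentences, so the set of ordinals they mention can interpret the new constant over
  \<open>W\<close> itself.\<close>

lemma less_satisfiable_embedding_theory:
  fixes \<delta> :: "'v::zfc_universe"
  assumes W: "W = Vset \<alpha>" "limit_like W" and \<gamma>: "Ord \<gamma>" "\<gamma> \<in> elts W"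
    and \<delta>: "Card \<delta>" "\<delta> \<in> elts \<gamma>"
  shows "less_satisfiable \<delta> (embedding_theory W \<gamma> \<delta>)"
  unfolding less_satisfiable_def
proof (intro allI impI)
  fix T0 assume T0: "T0 \<subseteq> embedding_theory W \<gamma> \<delta>" "T0 \<prec> elts \<delta>"
  obtain d where d: "elts d = {\<xi> \<in> elts \<gamma>. cover_sentence W \<xi> \<in> T0}"
    using separation[of "{\<xi> \<in> elts \<gamma>. cover_sentence W \<xi> \<in> T0}" \<gamma>] by auto
  have dW: "d \<in> elts W" using limit_like_subset[OF W(2) \<gamma>(2)] d by blast
  have \<delta>W: "\<delta> \<in> elts W" using limit_like_trans[OF W(2) \<gamma>(2) \<delta>(2)] .
  \<comment> \<open>Distinct ordinals give distinct covering sentences, so \<open>d\<close> is no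
    larger than \<open>T0\<close>.\<close>
  have "elts d \<lesssim> T0"
    unfolding lepoll_def d
    by (rule exI[of _ "cover_sentence W"]) (auto simp: inj_on_def cover_sentence_def LI_mem_def)
  then have "elts d \<prec> elts \<delta>" using T0(2) by (rule lesspoll_trans1)
  then have d\<delta>: "cardinality_less (elts W) d \<delta>"
    using cardinality_less_limit_like[OF W(2) \<delta>(1) \<delta>W dW] by blast
  let ?A = "expansion W d"
  have "LI_sat ?A s \<phi>" if \<phi>: "\<phi> \<in> T0" and s: "range s \<subseteq> elts W" for \<phi> s
  proof -
    note sat = LI_sat_expansion[OF dW _ s]
    have sW: "s n \<in> elts W" for n using s by blast
    consider (diag) "\<phi> \<in> diagram W" | (cover) \<xi> where "\<xi> \<in> elts \<gamma>" "\<phi> = cover_sentence W \<xi>"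
      | (level) "\<phi> = level_sentence" | (card) "\<phi> = card_sentence"
      | (small) "\<phi> = small_cover_sentence W \<delta>"
      using T0(1) \<phi> unfolding embedding_theory_def by blast
    then show ?thesis
    proof cases
      case diag
      then obtain \<psi> t where *: "\<phi> = LI_of \<psi> (\<lambda>n. Fun (t n) [])" "range t \<subseteq> elts W" "set_sat W t \<psi>"
        by (auto simp: diagram_def)
      then have "(\<lambda>n. LI_val ?A s (Fun (t n) [])) = t"
        by (auto simp: fun_eq_iff)
      then show ?thesis using sat[of "\<lambda>n. Fun (t n) []" \<psi>] * by simp
    next
      case cover
      then have "\<xi> \<in> elts d" using \<phi> d by simp
      moreover have "\<xi> \<in> elts W" using cover(1) limit_like_trans[OF W(2) \<gamma>(2)] by blast
      ultimately show ?thesis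
        using not_mem_self[of W] by (simp add: cover(2) cover_sentence_def LI_mem_def)
    next
      case small
      have "LI_sat ?A s \<phi> \<longleftrightarrow> cardinality_less (elts W) d \<delta>"
        unfolding small small_cover_sentence_def
        by (subst sat) (use not_mem_self[of W] \<delta>W in auto)
      then show ?thesis using d\<delta> by simp
    next
      case card
      \<comment> \<open>A cardinal of the limit level \<open>W\<close> is a true cardinal, and
        members of \<open>W\<close> have all their elements in \<open>W\<close>, so the assumed
        equipollence contradicts \<open>Card a\<close>.\<close>
      have "\<not> LI_sat ?A (s(0 := a, 1 := b))
          (LI_of (fm_card 0) (\<lambda>n. if n = 0 then Var 0 else Fun (set_of {}) []))"
        if ab: "a \<in> elts W" "b \<in> elts W" "b \<in> elts a"
          "{z \<in> elts W. z \<in> elts b} \<approx> {z \<in> elts W. z \<in> elts a}" for a b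
      proof
        have "range (s(0 := a, 1 := b)) \<subseteq> elts W" using ab(1,2) sW by auto
        moreover assume "LI_sat ?A (s(0 := a, 1 := b))
          (LI_of (fm_card 0) (\<lambda>n. if n = 0 then Var 0 else Fun (set_of {}) []))"
        ultimately have "is_cardinal (elts W) a"
          by (subst (asm) LI_sat_expansion[OF dW]) auto
        then have "Card a" using is_cardinal_limit_like[OF W(2) ab(1)] by blast
        moreover have "{z \<in> elts W. z \<in> elts x} = elts x" if "x \<in> elts W" for x
          using limit_like_trans[OF W(2) that] by blast
        ultimately show False using ab by (auto simp: Card_iff_eqpoll)
      qed
      then show ?thesis
        unfolding card card_sentence_def by (simp add: LI_mem_def) blast
    next
      case level
      \<comment> \<open>The level relation at \<open>x\<close> holds of all of
        \<open>V\<^sub>x\<close>, so the Haertig quantifier compares two full levels.\<close>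
      have "{z \<in> elts W. z \<in> elts (Vset x)} = elts (Vset x)" if "x \<in> elts W" for x
        using Vset_subset_Vset that W(1) by blast
      moreover have "elts (Vset x) \<subseteq> elts (Vset y) \<and> \<not> elts (Vset x) \<approx> elts (Vset y)"
        if "x \<in> elts y" for x y :: 'v
        using Vset_mono_mem[OF that] Vset_lesspoll[OF that] by (auto simp: lesspoll_def)
      ultimately show ?thesis
        unfolding level level_sentence_def by (simp add: LI_mem_def LI_level_def) blast
    qed
  qed
  then show "has_model T0"
    unfolding has_model_def
    by (intro exI[of _ ?A]) (simp add: wf_structure_expansion[OF dW])
qed

text \<open>Transitivity of \<open>W\<close> puts extensionality into the diagram, and the level
  sentence gives well-foundedness, so the model collapses to a transitive set; the constant
  \<open>W\<close> becomes the cover.\<close>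

lemma embedding_of_model:
  fixes W \<gamma> \<delta> :: "'v::zfc_universe"
  assumes W: "transitive_set W" "\<delta> \<in> elts W" and model: "has_model (embedding_theory W \<gamma> \<delta>)"
  shows "\<exists>M j. transitive_set M \<and> elementary_embedding W M j \<and> cardinal_correct M \<and>
    (\<exists>d \<in> elts M. j ` elts \<gamma> \<subseteq> elts d \<and> cardinality_less (elts M) d (j \<delta>))"
proof -
  obtain A where A: "wf_structure A"
    and sat: "\<And>\<phi> s. \<phi> \<in> embedding_theory W \<gamma> \<delta> \<Longrightarrow> range s \<subseteq> elts (carrier A) \<Longrightarrow> LI_sat A s \<phi>"
    using model unfolding has_model_def by blast
  define C where "C = elts (carrier A)"
  define E where "E x y \<longleftrightarrow> rel_int A (set_of {}) [x, y]" for x y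
  define L where "L x = {z \<in> C. rel_int A (set_of {}) [x, z, z]}" for x
  define c where "c x = fun_int A x []" for x
  have cC: "c x \<in> C" for x using A by (simp add: wf_structure_def c_def C_def)
  \<comment> \<open>The theory consists of sentences, so it is always evaluated at this one
    assignment.\<close>
  define s0 :: "nat \<Rightarrow> 'v" where "s0 = (\<lambda>_. c \<delta>)"
  have s0: "range s0 \<subseteq> elts (carrier A)" using cC by (auto simp: s0_def C_def)

  \<comment> \<open>The level sentence makes \<open>L\<close> strictly increasing in size along
    \<open>E\<close>, so \<open>E\<close> inherits well-foundedness from the order of sizes.\<close>
  have L: "L x \<prec> L y" if "x \<in> C" "y \<in> C" "E x y" for x y
  proof -
    have "LI_sat A s0 level_sentence" by (rule sat[OF _ s0]) (simp add: embedding_theory_def)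
    then have "(\<forall>z \<in> C. rel_int A (set_of {}) [x, z, z] \<longrightarrow> rel_int A (set_of {}) [y, z, z]) \<and> \<not> L x \<approx> L y"
      using that unfolding level_sentence_def L_def C_def
      by (simp add: LI_mem_def LI_level_def E_def)
    then show ?thesis
      unfolding lesspoll_def by (auto intro!: subset_imp_lepoll simp: L_def)
  qed
  define r where "r = {(x, y). x \<in> C \<and> y \<in> C \<and> E x y}"
  have wf: "wf r"
    by (rule wf_subset[OF wf_inv_image[OF wf_lesspoll, of L]]) (auto simp: r_def inv_image_def L)
  obtain \<pi> :: "'v \<Rightarrow> 'v" where \<pi>: "\<And>x. \<pi> x = set_of (\<pi> ` {y. (y, x) \<in> r})"
    by (rule wf_collapse[OF wf]) (rule that)
  have elts_\<pi>: "elts (\<pi> x) = \<pi> ` {y. (y, x) \<in> r}" for x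
  proof -
    have "{y. (y, x) \<in> r} \<subseteq> elts (carrier A)" by (auto simp: r_def C_def)
    then have "small TYPE('v) (\<pi> ` {y. (y, x) \<in> r})"
      by (intro small_image small_subset[OF small_elts])
    then show ?thesis by (subst \<pi>) (rule elts_set_of_small)
  qed
  define M where "M = set_of (\<pi> ` C)"
  have M: "elts M = \<pi> ` C"
    unfolding M_def C_def by (intro elts_set_of_small small_image small_elts)

  have ext: "x = y" if "x \<in> C" "y \<in> C" "\<And>z. z \<in> C \<Longrightarrow> E z x \<longleftrightarrow> E z y" for x y
  proof -
    \<comment> \<open>Extensionality in primitive connectives, so that its translation unfolds by
      \<open>LI_of\<close>. The constant \<open>\<delta>\<close> is a filler, as the formula has no
      free variables.\<close>
    define \<phi> where "\<phi> = SNeg (SEx 0 (SEx 1 (SConj (SNeg (SEx 2 (SNeg (SConj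
      (SNeg (SConj (SMem 2 0) (SNeg (SMem 2 1)))) (SNeg (SConj (SMem 2 1) (SNeg (SMem 2 0)))))))) (SNeg (SEq 0 1)))))"
    have "u = v" if "u \<in> elts W" "v \<in> elts W" "\<forall>z \<in> elts W. z \<in> elts u \<longleftrightarrow> z \<in> elts v" for u v
      by (rule extensionality) (use that transitive_mem[OF W(1)] in blast)
    then have "set_sat W (\<lambda>_. \<delta>) \<phi>" by (auto simp: \<phi>_def)
    then have "LI_of \<phi> (\<lambda>n. Fun \<delta> []) \<in> diagram W" using W(2) by (force simp: diagram_def)
    then have "LI_sat A s0 (LI_of \<phi> (\<lambda>n. Fun \<delta> []))"
      by (intro sat[OF _ s0]) (simp add: embedding_theory_def)
    then show ?thesis using that by (simp add: \<phi>_def LI_mem_def E_def C_def) blast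
  qed
  have inj: "inj_on \<pi> C"
  proof -
    \<comment> \<open>Induction along \<open>E\<close>: equal images of \<open>x\<close> and
      \<open>y\<close> match their members up to equal images, hence exactly by the induction
      hypothesis, and \<open>ext\<close> applies.\<close>
    have "\<forall>y. x \<in> C \<longrightarrow> y \<in> C \<longrightarrow> \<pi> x = \<pi> y \<longrightarrow> x = y" for x
      using wf
    proof (induction x rule: wf_induct_rule)
      case (less x)
      show ?case
      proof (intro allI impI)
        fix y assume xy: "x \<in> C" "y \<in> C" "\<pi> x = \<pi> y"
        show "x = y"
        proof (rule ext[OF xy(1,2)])
          fix z assume z: "z \<in> C"
          have IH: "u \<in> C \<Longrightarrow> v \<in> C \<Longrightarrow> E u x \<Longrightarrow> \<pi> u = \<pi> v \<Longrightarrow> u = v" for u v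
            using less xy(1) by (simp add: r_def)
          have eq: "\<pi> ` {u. (u, x) \<in> r} = \<pi> ` {u. (u, y) \<in> r}" using xy(3) elts_\<pi> by metis
          show "E z x \<longleftrightarrow> E z y"
          proof
            assume "E z x"
            then have "\<pi> z \<in> \<pi> ` {u. (u, y) \<in> r}" using eq z xy by (auto simp: r_def)
            then obtain v where "v \<in> C" "E v y" "\<pi> z = \<pi> v" by (auto simp: r_def)
            then show "E z y" using IH[OF z _ \<open>E z x\<close>] by simp
          next
            assume "E z y"
            then have "\<pi> z \<in> \<pi> ` {u. (u, x) \<in> r}" using eq z xy by (auto simp: r_def)
            then obtain v where "v \<in> C" "E v x" "\<pi> v = \<pi> z" by (auto simp: r_def)
            then show "E z x" using IH[of v z] z by simp
          qed
        qed
      qed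
    qed
    then show ?thesis by (auto simp: inj_on_def)
  qed
  have mem: "E x y \<longleftrightarrow> \<pi> x \<in> elts (\<pi> y)" if "x \<in> C" "y \<in> C" for x y
    using that inj unfolding elts_\<pi> r_def inj_on_def by auto
  have trM: "transitive_set M"
    unfolding transitive_set_def M by (auto simp: elts_\<pi> r_def)
  have LI_sat_M: "LI_sat A s (LI_of \<phi> \<sigma>) \<longleftrightarrow> set_sat M (\<lambda>n. \<pi> (LI_val A s (\<sigma> n))) \<phi>"
    if "\<And>n. \<sigma> n = Var n \<or> (\<exists>c. \<sigma> n = Fun c [])" "range s \<subseteq> C" for s \<sigma> \<phi>
    using LI_sat_LI_of[OF A, of \<pi> M \<sigma> s \<phi>] inj M mem that unfolding C_def E_def by blast

  define j where "j x = \<pi> (c x)" for x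
  have jM: "j x \<in> elts M" for x using cC by (simp add: j_def M)
  have diagram: "set_sat M (j \<circ> s) \<phi>" if "range s \<subseteq> elts W" "set_sat W s \<phi>" for s \<phi>
  proof -
    have "LI_of \<phi> (\<lambda>n. Fun (s n) []) \<in> embedding_theory W \<gamma> \<delta>"
      using that by (auto simp: embedding_theory_def diagram_def)
    then have "LI_sat A s0 (LI_of \<phi> (\<lambda>n. Fun (s n) []))" by (rule sat[OF _ s0])
    then show ?thesis
      using LI_sat_M[of "\<lambda>n. Fun (s n) []" s0 \<phi>] s0 by (simp add: j_def c_def C_def comp_def)
  qed
  have "elementary_embedding W M j"
    unfolding elementary_embedding_def
  proof (intro conjI allI impI)
    show "j ` elts W \<subseteq> elts M" using jM by blast
    fix \<phi> and s :: "nat \<Rightarrow> 'v" assume "range s \<subseteq> elts W"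
    \<comment> \<open>Applying \<open>diagram\<close> to the negation as well gives the converse
      implication.\<close>
    then show "set_sat W s \<phi> \<longleftrightarrow> set_sat M (j \<circ> s) \<phi>"
      using diagram[of s \<phi>] diagram[of s "SNeg \<phi>"] by auto
  qed
  moreover have "cardinal_correct M"
    unfolding cardinal_correct_def
  proof (intro ballI impI)
    fix \<kappa> assume \<kappa>: "\<kappa> \<in> elts M" "is_cardinal (elts M) \<kappa>"
    then obtain k where k: "k \<in> C" "\<kappa> = \<pi> k" using M by blast
    have "\<not> elts \<beta> \<approx> elts \<kappa>" if \<beta>: "\<beta> \<in> elts \<kappa>" for \<beta>
    proof
      assume eq: "elts \<beta> \<approx> elts \<kappa>"
      obtain b where b: "b \<in> C" "\<beta> = \<pi> b" "E b k" using \<beta> k by (auto simp: elts_\<pi> r_def)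
      \<comment> \<open>The collapse identifies the extension of \<open>x\<close> under
        \<open>E\<close> with the elements of \<open>\<pi> x\<close>, so a bijection in
        \<open>V\<close> between \<open>\<beta>\<close> and \<open>\<kappa>\<close> produces what
        the cardinal sentence forbids at \<open>k\<close> and \<open>b\<close>.\<close>
      have "{z \<in> C. E z x} \<approx> elts (\<pi> x)" if "x \<in> C" for x
      proof -
        have "{y. (y, x) \<in> r} = {z \<in> C. E z x}" using that by (auto simp: r_def)
        moreover have "inj_on \<pi> {z \<in> C. E z x}" using inj by (rule inj_on_subset) blast
        ultimately show ?thesis unfolding elts_\<pi> by (simp add: inj_on_image_eqpoll_self eqpoll_sym)
      qed
      then have "{z \<in> C. E z b} \<approx> {z \<in> C. E z k}"
        using eq k b eqpoll_trans eqpoll_sym by metis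
      moreover have "LI_sat A (s0(0 := k, 1 := b))
          (LI_of (fm_card 0) (\<lambda>n. if n = 0 then Var 0 else Fun (set_of {}) []))"
      proof (subst LI_sat_M)
        show "range (s0(0 := k, 1 := b)) \<subseteq> C" using k b cC by (auto simp: s0_def)
      qed (use \<kappa>(2) k(2) in auto)
      moreover have "LI_sat A s0 card_sentence" by (rule sat[OF _ s0]) (simp add: embedding_theory_def)
      ultimately show False
        using k(1) b(1,3) unfolding card_sentence_def by (simp add: LI_mem_def C_def E_def)
    qed
    moreover have "Ord \<kappa>" using \<kappa> is_ordinal_transitive[OF trM] by (simp add: is_cardinal_def)
    ultimately show "Card \<kappa>" by (simp add: Card_iff_eqpoll)
  qed
  moreover have "j \<xi> \<in> elts (\<pi> (c W))" if "\<xi> \<in> elts \<gamma>" for \<xi>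
  proof -
    have "LI_sat A s0 (cover_sentence W \<xi>)"
      using that by (intro sat[OF _ s0]) (simp add: embedding_theory_def)
    then show ?thesis
      using mem cC by (simp add: cover_sentence_def LI_mem_def j_def E_def c_def)
  qed
  moreover have "cardinality_less (elts M) (\<pi> (c W)) (j \<delta>)"
  proof -
    have "LI_sat A s0 (small_cover_sentence W \<delta>)"
      by (rule sat[OF _ s0]) (simp add: embedding_theory_def)
    then show ?thesis
      unfolding small_cover_sentence_def
      by (subst (asm) LI_sat_M) (use s0 in \<open>auto simp: C_def j_def c_def\<close>)
  qed
  ultimately show ?thesis using trM cC M by blast
qed

text \<open>If \<open>j\<close> fixed \<open>\<delta>\<close>, then \<open>d\<close> would have
  fewer than \<open>\<delta>\<close> elements while containing an injective image of
  \<open>\<gamma>\<close>, a superset of \<open>\<delta>\<close>. The critical point is the least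
  moved element of \<open>\<delta> + 1\<close>.\<close>

lemma ex_critical_point:
  assumes N: "transitive_set N" and M: "transitive_set M" and j: "elementary_embedding N M j"
    and \<delta>: "Card \<delta>" "\<delta> \<in> elts \<gamma>" and \<gamma>: "Ord \<gamma>" "\<gamma> \<in> elts N"
    and d: "d \<in> elts M" "j ` elts \<gamma> \<subseteq> elts d" "cardinality_less (elts M) d (j \<delta>)"
  shows "\<exists>\<kappa>. critical_point N j \<kappa> \<and> (\<kappa> \<in> elts \<delta> \<or> \<kappa> = \<delta>)"
proof -
  note \<delta>N = transitive_mem[OF N \<gamma>(2) \<delta>(2)]
  have o: "Ord \<delta>" using \<delta>(1) by (simp add: is_cardinal_def)
  have "j \<delta> \<noteq> \<delta>"
  proof
    assume j\<delta>: "j \<delta> = \<delta>"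
    have "elts \<gamma> \<subseteq> elts N" using transitive_mem[OF N \<gamma>(2)] by blast
    then have "inj_on j (elts \<gamma>)" using elementary_inj[OF j] inj_on_subset by blast
    then have "elts \<gamma> \<lesssim> elts d" using d(2) unfolding lepoll_def by blast
    moreover have "elts \<delta> \<lesssim> elts \<gamma>" using Ord_subset[OF \<gamma>(1) \<delta>(2)] by (rule subset_imp_lepoll)
    moreover obtain \<kappa> where \<kappa>: "\<kappa> \<in> elts \<delta>" "elts \<kappa> \<approx> elts d"
      using cardinality_less_transitive[OF M d(3) d(1)] elementary_closed[OF j \<delta>N] j\<delta> by auto
    ultimately have "elts \<delta> \<lesssim> elts \<kappa>"
      using eqpoll_sym eqpoll_imp_lepoll lepoll_trans by metis
    then show False
      using Card_mem_lesspoll[OF \<delta>(1) \<kappa>(1)] lepoll_antisym unfolding lesspoll_def by blast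
  qed
  then obtain \<kappa> where \<kappa>: "\<kappa> \<in> elts \<delta> \<or> \<kappa> = \<delta>" "j \<kappa> \<noteq> \<kappa>"
    and min: "\<And>\<xi>. \<xi> \<in> elts \<kappa> \<Longrightarrow> \<not> ((\<xi> \<in> elts \<delta> \<or> \<xi> = \<delta>) \<and> j \<xi> \<noteq> \<xi>)"
    using ex_elts_minimal[of "\<lambda>\<kappa>. (\<kappa> \<in> elts \<delta> \<or> \<kappa> = \<delta>) \<and> j \<kappa> \<noteq> \<kappa>"] by blast
  have "elts \<kappa> \<subseteq> elts \<delta>" using \<kappa>(1) Ord_subset[OF o] by blast
  then have "\<forall>\<xi> \<in> elts \<kappa>. j \<xi> = \<xi>" using min by blast
  moreover have "Ord \<kappa>" using \<kappa>(1) o Ord_mem by blast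
  moreover have "\<kappa> \<in> elts N" using \<kappa>(1) \<delta>N transitive_mem[OF N \<delta>N] by blast
  ultimately show ?thesis using \<kappa> unfolding critical_point_def by blast
qed

lemma compactness_imp_embedding:
  fixes \<delta> :: "'v::zfc_universe"
  assumes \<delta>: "LI_strong_compactness_cardinal \<delta>" and \<gamma>: "Ord \<gamma>" "\<delta> \<in> elts \<gamma>"
  shows "\<exists>\<alpha> M j. Ord \<alpha> \<and> \<gamma> \<in> elts \<alpha> \<and> transitive_set M \<and>
    elementary_embedding (Vset \<alpha>) M j \<and> cardinal_correct M \<and>
    (\<exists>\<kappa>. critical_point (Vset \<alpha>) j \<kappa> \<and> (\<kappa> \<in> elts \<delta> \<or> \<kappa> = \<delta>)) \<and>
    (\<exists>d \<in> elts M. j ` elts \<gamma> \<subseteq> elts d \<and> cardinality_less (elts M) d (j \<delta>))"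
proof -
  \<comment> \<open>The level \<open>\<gamma> + \<omega>\<close> contains \<open>\<gamma>\<close>
    and, being a limit, computes cardinals and equinumerosity correctly.\<close>
  define \<alpha> where "\<alpha> = vlim \<gamma>"
  define W where "W = Vset \<alpha>"
  have C: "Card \<delta>" using \<delta> by (simp add: LI_strong_compactness_cardinal_def)
  have W: "limit_like W" unfolding W_def \<alpha>_def by (rule limit_like_Vset)
  have \<alpha>: "Ord \<alpha>" "\<gamma> \<in> elts \<alpha>" using \<gamma> by (simp_all add: \<alpha>_def Ord_vlim mem_vlim)
  then have \<gamma>W: "\<gamma> \<in> elts W" unfolding W_def using mem_Vset by blast
  have "has_model (embedding_theory W \<gamma> \<delta>)"
    using \<delta> LI_theory_embedding_theory
      less_satisfiable_embedding_theory[OF W_def W \<gamma>(1) \<gamma>W C \<gamma>(2)]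
    unfolding LI_strong_compactness_cardinal_def by blast
  then obtain M j d where *: "transitive_set M" "elementary_embedding W M j" "cardinal_correct M"
      "d \<in> elts M" "j ` elts \<gamma> \<subseteq> elts d" "cardinality_less (elts M) d (j \<delta>)"
    using embedding_of_model[OF limit_like_transitive[OF W] limit_like_trans[OF W \<gamma>W \<gamma>(2)]] by blast
  then show ?thesis
    using ex_critical_point[OF limit_like_transitive[OF W] *(1,2) C \<gamma>(2,1) \<gamma>W *(4-6)] \<alpha>
    unfolding W_def by blast
qed

section \<open>From embeddings to compactness\<close>

text \<open>Bijections in \<open>N\<close> are bijections in \<open>V\<close>, so being a cardinal
  passes down to transitive sets.\<close>

lemma Card_imp_is_cardinal:
  assumes "transitive_set N" "Card \<kappa>" "\<kappa> \<in> elts N"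
  shows "is_cardinal (elts N) \<kappa>"
proof -
  have "\<not> is_equinumerous (elts N) \<beta> \<kappa>" if "\<beta> \<in> elts \<kappa>" "\<beta> \<in> elts N" for \<beta>
    using is_equinumerous_transitive[OF assms(1) _ that(2) assms(3)] assms(2) that(1)
    by (auto simp: Card_iff_eqpoll)
  moreover have "is_ordinal (elts N) \<kappa>"
    using assms(2) is_ordinal_transitive[OF assms(1,3)] by (simp add: is_cardinal_def)
  ultimately show ?thesis unfolding is_cardinal_def by blast
qed

lemma Card_eqpoll_eq:
  assumes "Card \<kappa>" "Card \<mu>" "elts \<kappa> \<approx> elts \<mu>"
  shows "\<kappa> = \<mu>"
proof -
  have "Ord \<kappa>" "Ord \<mu>" using assms(1,2) by (simp_all add: is_cardinal_def)
  then consider "\<kappa> \<in> elts \<mu>" | "\<kappa> = \<mu>" | "\<mu> \<in> elts \<kappa>" using Ord_linear by blast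
  then show ?thesis
    using assms Card_mem_lesspoll eqpoll_sym by cases (auto simp: lesspoll_def)
qed

lemma ex_limit_level:
  fixes p a b :: "'v::zfc_universe"
  assumes "Ord a" "Ord b"
  shows "\<exists>\<theta>. Ord \<theta> \<and> limit_like (Vset \<theta>) \<and> p \<in> elts (Vset \<theta>) \<and> a \<in> elts \<theta> \<and> b \<in> elts \<theta>"
proof -
  obtain c :: 'v where c: "Ord c" "elts p \<subseteq> elts (Vset c)" using ex_Ord_Vset by blast
  \<comment> \<open>The union of the successors bounds all three ordinals; adding
    \<open>\<omega>\<close> then gives a limit level.\<close>
  have "elts (uset (up (vsuc c) (uset (up (vsuc a) (vsuc b))))) =
      elts (vsuc c) \<union> (elts (vsuc a) \<union> elts (vsuc b))" by simp
  then obtain \<mu> where \<mu>: "elts \<mu> = elts (vsuc c) \<union> (elts (vsuc a) \<union> elts (vsuc b))" by blast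
  have "Ord (vsuc a)" "Ord (vsuc b)" "Ord (vsuc c)" using assms c(1) Ord_vsuc by blast+
  then have "Ord \<mu>"
    unfolding Ord_iff[of \<mu>] transitive_set_def[of \<mu>] \<mu> Ord_iff transitive_set_def by fast
  have sub: "elts \<mu> \<subseteq> elts (vlim \<mu>)" using Ord_subset[OF Ord_vlim[OF \<open>Ord \<mu>\<close>] mem_vlim] .
  have "c \<in> elts (vlim \<mu>)" "a \<in> elts (vlim \<mu>)" "b \<in> elts (vlim \<mu>)"
    using subsetD[OF sub] by (simp_all add: \<mu>)
  moreover from this(1) have "p \<in> elts (Vset (vlim \<mu>))" using c(2) by (auto simp: elts_Vset[of "vlim \<mu>"])
  ultimately show ?thesis using Ord_vlim[OF \<open>Ord \<mu>\<close>] limit_like_Vset by blast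
qed

lemma set_sat_relativize':
  assumes "elts (s w) \<subseteq> elts N" "fm_bound \<phi> \<le> w"
  shows "set_sat N s (relativize w \<phi>) \<longleftrightarrow> set_sat (s w) s \<phi>"
  using set_sat_relativize[OF assms, of s] by simp

text \<open>
  The level \<open>\<alpha>\<close> of an embedding is arbitrary, so \<open>V\<^sub>\<alpha>\<close> may lack the bijections between its members.
  Restricting the embedding to a limit level below \<open>\<alpha>\<close> repairs this.
\<close>

lemma restricted_embedding:
  fixes \<delta> \<theta> :: "'v::zfc_universe"
  assumes emb: "\<And>\<gamma>. Ord \<gamma> \<Longrightarrow> \<delta> \<in> elts \<gamma> \<Longrightarrow> \<exists>\<alpha> M j. Ord \<alpha> \<and> \<gamma> \<in> elts \<alpha> \<and> transitive_set M \<and>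
      elementary_embedding (Vset \<alpha>) M j \<and> cardinal_correct M \<and>
      (\<exists>d \<in> elts M. j ` elts \<gamma> \<subseteq> elts d \<and> cardinality_less (elts M) d (j \<delta>))"
    and \<delta>: "Card \<delta>" "\<delta> \<in> elts \<theta>" and \<theta>: "Ord \<theta>" "limit_like (Vset \<theta>)" and \<gamma>: "\<gamma> \<in> elts \<theta>"
  shows "\<exists>M j d. transitive_set M \<and> elementary_embedding (Vset \<theta>) M j \<and> cardinal_correct M \<and>
    d \<in> elts M \<and> elts d \<subseteq> elts (j \<gamma>) \<and> j ` elts \<gamma> \<subseteq> elts d \<and> cardinality_less (elts M) d (j \<delta>)"
proof -
  define W where "W = Vset \<theta>"
  have W: "limit_like W" using \<theta>(2) by (simp add: W_def)
  \<comment> \<open>With the hypothesis applied to \<open>vsuc \<theta>\<close>, the level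
    \<open>Vset \<theta>\<close> is a member of the domain, and the cover contains
    \<open>j[\<gamma>]\<close>.\<close>
  have "Ord (vsuc \<theta>)" "\<delta> \<in> elts (vsuc \<theta>)" using \<theta>(1) \<delta>(2) Ord_vsuc by auto
  from emb[OF this] obtain \<alpha> M j d where \<alpha>: "Ord \<alpha>" "vsuc \<theta> \<in> elts \<alpha>"
    and M: "transitive_set M" and j: "elementary_embedding (Vset \<alpha>) M j" and cM: "cardinal_correct M"
    and d: "d \<in> elts M" "j ` elts (vsuc \<theta>) \<subseteq> elts d" "cardinality_less (elts M) d (j \<delta>)"
    by blast
  define N where "N = Vset \<alpha>"
  have trN: "transitive_set N" unfolding N_def by (rule transitive_Vset)
  have "\<theta> \<in> elts \<alpha>" using Ord_subset[OF \<alpha>] by auto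
  then have WN: "W \<in> elts N" unfolding W_def N_def by (rule Vset_mem)
  note subN = transitive_mem[OF trN WN]
  have \<gamma>W: "\<gamma> \<in> elts W" and \<delta>W: "\<delta> \<in> elts W" using \<gamma> \<delta>(2) mem_Vset unfolding W_def by blast+
  note j = j[folded N_def]
  have jW: "j W \<in> elts M" using elementary_closed[OF j WN] .
  have transfer: "set_sat N s \<phi> \<Longrightarrow> range s \<subseteq> elts N \<Longrightarrow> set_sat M (j \<circ> s) \<phi>" for s \<phi>
    using j unfolding elementary_embedding_def by blast

  have trW: "transitive_set (j W)"
  proof -
    have "set_sat N (env [W]) (sAll 1 (sImp (SMem 1 0) (sAll 2 (sImp (SMem 2 1) (SMem 2 0)))))"
      using limit_like_trans[OF W] by (auto simp: env_def)
    then have "set_sat M (env (map j [W])) (sAll 1 (sImp (SMem 1 0) (sAll 2 (sImp (SMem 2 1) (SMem 2 0)))))"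
      by (subst (asm) elementary_env[OF j]) (simp_all add: WN)
    then have *: "\<forall>x \<in> elts M. x \<in> elts (j W) \<longrightarrow> (\<forall>y \<in> elts M. y \<in> elts x \<longrightarrow> y \<in> elts (j W))"
      by (simp add: env_def)
    show ?thesis
      unfolding transitive_set_def
    proof (intro ballI subsetI)
      fix x y assume x: "x \<in> elts (j W)" and y: "y \<in> elts x"
      note xM = transitive_mem[OF M jW x]
      show "y \<in> elts (j W)" using * xM x transitive_mem[OF M xM y] y by blast
    qed
  qed
  have subM: "elts (j W) \<subseteq> elts M" using transitive_mem[OF M jW] by blast

  \<comment> \<open>Cardinals of the limit level \<open>W\<close> are true cardinals, hence
    cardinals of \<open>N\<close>. By transfer the cardinals of \<open>j W\<close> are cardinals of
    \<open>M\<close>, and so of \<open>V\<close>.\<close>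
  have "cardinal_correct (j W)"
  proof -
    define w where "w = Suc (fm_bound (fm_card 0))"
    define \<phi> where "\<phi> = sAll 0 (sImp (SConj (SMem 0 w) (relativize w (fm_card 0))) (fm_card 0))"
    have rel: "set_sat V (s(0 := a)) (relativize w (fm_card 0)) \<longleftrightarrow> is_cardinal (elts (s w)) a"
      if "elts (s w) \<subseteq> elts V" for s :: "nat \<Rightarrow> 'v" and V a
      using that by (subst set_sat_relativize') (simp_all add: w_def)
    have "is_cardinal (elts N) a" if "a \<in> elts W" "is_cardinal (elts W) a" for a
      using Card_imp_is_cardinal[OF trN _ subN] is_cardinal_limit_like[OF W that(1)] that by blast
    then have "set_sat N (\<lambda>_. W) \<phi>"
      unfolding \<phi>_def using rel[of "\<lambda>_. W" N] subN by (simp add: w_def subset_eq)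
    then have "set_sat M (\<lambda>_. j W) \<phi>"
      using transfer[of "\<lambda>_. W" \<phi>] WN by (simp add: comp_def)
    then have "is_cardinal (elts M) a" if "a \<in> elts (j W)" "is_cardinal (elts (j W)) a" for a
      unfolding \<phi>_def using rel[of "\<lambda>_. j W" M] subM that by (auto simp: w_def)
    then show ?thesis using cM subM unfolding cardinal_correct_def by blast
  qed
  \<comment> \<open>The cover \<open>d\<close> is only known to lie in \<open>M\<close>. In
    \<open>N\<close>, any \<open>x\<close> smaller than \<open>\<delta>\<close> meets
    \<open>\<gamma>\<close> in a member of \<open>W\<close> that \<open>W\<close> itself sees to be
    smaller than \<open>\<delta>\<close>; transferring this and taking \<open>d\<close> for
    \<open>x\<close> gives a cover in \<open>j W\<close>.\<close>
  moreover have "\<exists>e \<in> elts (j W). elts e = elts d \<inter> elts (j \<gamma>) \<and> cardinality_less (elts (j W)) e (j \<delta>)"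
  proof -
    \<comment> \<open>A variable beyond all those of the formula, reserved for the parameter
      \<open>W\<close>, which is the default value of \<open>s\<close>.\<close>
    define w where "w = 5 + fm_bound (fm_cardless 3 1)"
    have w: "w \<noteq> 0" "w \<noteq> 1" "w \<noteq> 2" "w \<noteq> 3" "w \<noteq> 4" by (auto simp: w_def)
    define \<phi> where "\<phi> = sAll 0 (sImp (fm_cardless 0 1) (SEx 3 (SConj (SMem 3 w) (SConj
      (sAll 4 (sIff (SMem 4 3) (SConj (SMem 4 0) (SMem 4 2)))) (relativize w (fm_cardless 3 1))))))"
    define s :: "nat \<Rightarrow> 'v" where "s = (\<lambda>_. W)(1 := \<delta>, 2 := \<gamma>)"
    have rel: "set_sat V t (relativize w (fm_cardless 3 1)) \<longleftrightarrow> cardinality_less (elts (t w)) (t 3) (t 1)"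
      if "elts (t w) \<subseteq> elts V" for t :: "nat \<Rightarrow> 'v" and V
      using that by (subst set_sat_relativize') (simp_all add: w_def)
    have "\<exists>e \<in> elts W. elts e = elts x \<inter> elts \<gamma> \<and> cardinality_less (elts W) e \<delta>"
      if x: "x \<in> elts N" "cardinality_less (elts N) x \<delta>" for x
    proof -
      obtain \<kappa> where \<kappa>: "\<kappa> \<in> elts \<delta>" "elts \<kappa> \<approx> elts x"
        using cardinality_less_transitive[OF trN x(2,1) subN[OF \<delta>W]] by blast
      obtain e where e: "elts e = elts x \<inter> elts \<gamma>" using separation[of "elts x \<inter> elts \<gamma>" x] by auto
      have "elts e \<lesssim> elts x" using e by (auto intro: subset_imp_lepoll)
      moreover have "elts x \<prec> elts \<delta>"
        using eqpoll_sym[OF \<kappa>(2)] Card_mem_lesspoll[OF \<delta>(1) \<kappa>(1)] by (rule eq_lesspoll_trans)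
      ultimately have "elts e \<prec> elts \<delta>" by (rule lesspoll_trans1)
      moreover have eW: "e \<in> elts W" using limit_like_subset[OF W \<gamma>W] e by blast
      ultimately show ?thesis using e cardinality_less_limit_like[OF W \<delta>(1) \<delta>W eW] by blast
    qed
    moreover have rN: "set_sat N (s(0 := x, 3 := e)) (relativize w (fm_cardless 3 1)) \<longleftrightarrow>
        cardinality_less (elts W) e \<delta>" for x e
      by (subst rel) (use w subN in \<open>auto simp: s_def\<close>)
    ultimately have "set_sat N s \<phi>"
      using w subN unfolding \<phi>_def by (fastforce simp: s_def)
    then have "set_sat M (j \<circ> s) \<phi>"
      using transfer[of s \<phi>] WN subN[OF \<delta>W] subN[OF \<gamma>W] by (auto simp: s_def)
    moreover have "set_sat M ((j \<circ> s)(0 := x, 3 := e)) (relativize w (fm_cardless 3 1)) \<longleftrightarrow>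
        cardinality_less (elts (j W)) e (j \<delta>)" for x e
      by (subst rel) (use w subM in \<open>auto simp: s_def\<close>)
    ultimately obtain e where e: "e \<in> elts (j W)" "cardinality_less (elts (j W)) e (j \<delta>)"
      "\<forall>z \<in> elts M. z \<in> elts e \<longleftrightarrow> z \<in> elts d \<and> z \<in> elts (j \<gamma>)"
      using d(1,3) w unfolding \<phi>_def by (auto simp: s_def)
    have "elts e \<subseteq> elts M" "elts d \<subseteq> elts M" using e(1) d(1) subM transitive_mem[OF M] by blast+
    then have "elts e = elts d \<inter> elts (j \<gamma>)" using e(3) by blast
    then show ?thesis using e by blast
  qed
  moreover have "j ` elts \<gamma> \<subseteq> elts d \<inter> elts (j \<gamma>)"
  proof -
    have "elts \<gamma> \<subseteq> elts (vsuc \<theta>)" using Ord_subset[OF \<theta>(1) \<gamma>] by auto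
    moreover have "j \<xi> \<in> elts (j \<gamma>)" if "\<xi> \<in> elts \<gamma>" for \<xi>
      using elementary_mem[OF j subN subN] limit_like_trans[OF W \<gamma>W] \<gamma>W that by blast
    ultimately show ?thesis using d(2) by blast
  qed
  moreover have "elementary_embedding W (j W) j" by (rule elementary_restrict[OF j M trN WN])
  ultimately show ?thesis using trW unfolding W_def[symmetric] by (metis Int_lower2)
qed

section \<open>Transfer along an embedding\<close>

text \<open>
  Properties and relations on \<open>P\<close> are coded as members of \<open>W\<close>, so that \<open>j\<close> maps them to properties
  and relations on \<open>j P\<close>.
\<close>

locale reflection =
  fixes W P M :: "'v::zfc_universe" and j :: "'v \<Rightarrow> 'v"
  assumes W: "limit_like W" and P: "limit_like P" and PW: "P \<in> elts W"
    and cards: "elts x \<subseteq> elts P \<Longrightarrow> \<exists>\<kappa> \<in> elts W. Card \<kappa> \<and> elts \<kappa> \<approx> elts x"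
    and M: "transitive_set M" and j: "elementary_embedding W M j" and correct: "cardinal_correct M"
begin

definition code1 :: "('v \<Rightarrow> bool) \<Rightarrow> 'v" where
  "code1 Q = set_of {x \<in> elts P. Q x}"

definition code2 :: "('v \<Rightarrow> 'v \<Rightarrow> bool) \<Rightarrow> 'v" where
  "code2 R = set_of {pr x y | x y. x \<in> elts P \<and> y \<in> elts P \<and> R x y}"

definition lift1 :: "('v \<Rightarrow> bool) \<Rightarrow> 'v \<Rightarrow> bool" where
  "lift1 Q x \<longleftrightarrow> x \<in> elts (j (code1 Q))"

definition lift2 :: "('v \<Rightarrow> 'v \<Rightarrow> bool) \<Rightarrow> 'v \<Rightarrow> 'v \<Rightarrow> bool" where
  "lift2 R x y \<longleftrightarrow> pr x y \<in> elts (j (code2 R))"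

lemma P_sub_W: "x \<in> elts P \<Longrightarrow> x \<in> elts W"
  by (rule limit_like_trans[OF W PW])

lemma mem_code1 [simp]: "x \<in> elts (code1 Q) \<longleftrightarrow> x \<in> elts P \<and> Q x"
proof -
  have "{x \<in> elts P. Q x} \<subseteq> elts P" by blast
  from separation[OF this] have "elts (code1 Q) = {x \<in> elts P. Q x}"
    unfolding code1_def by (elim exE) (rule elts_set_of)
  then show ?thesis by simp
qed

lemma elts_code2: "elts (code2 R) = {pr x y | x y. x \<in> elts P \<and> y \<in> elts P \<and> R x y}"
proof -
  have "{pr x y | x y. x \<in> elts P \<and> y \<in> elts P \<and> R x y} \<subseteq> elts P"
    using limit_like_pr[OF P] by blast
  from separation[OF this] show ?thesis
    unfolding code2_def by (elim exE) (rule elts_set_of)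
qed

lemma code1_W: "code1 Q \<in> elts W"
  by (rule limit_like_subset[OF W PW]) auto

lemma code2_W: "code2 R \<in> elts W"
  by (rule limit_like_subset[OF W PW]) (use limit_like_pr[OF P] in \<open>auto simp: elts_code2\<close>)

lemma in_rel_code2 [simp]: "in_rel (elts W) (code2 R) x y \<longleftrightarrow> x \<in> elts P \<and> y \<in> elts P \<and> R x y"
  by (subst in_rel_transitive[OF limit_like_transitive[OF W] code2_W]) (auto simp: elts_code2)

lemma mem_j_code1 [simp]: "x \<in> elts (j (code1 Q)) \<longleftrightarrow> lift1 Q x"
  by (simp add: lift1_def)

lemma in_rel_j_code2 [simp]: "in_rel (elts M) (j (code2 R)) x y \<longleftrightarrow> lift2 R x y"
  by (simp add: lift2_def in_rel_transitive[OF M elementary_closed[OF j code2_W]])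

lemma lift1_M: "lift1 Q x \<Longrightarrow> x \<in> elts M"
  unfolding lift1_def by (rule transitive_mem[OF M elementary_closed[OF j code1_W]])

lemma lift2_M:
  assumes "lift2 R x y"
  shows "x \<in> elts M" "y \<in> elts M"
proof -
  have "pr x y \<in> elts M"
    using assms transitive_mem[OF M elementary_closed[OF j code2_W]] unfolding lift2_def by blast
  then have "up x y \<in> elts M" by (rule transitive_mem[OF M]) (simp add: pr_def)
  then show "x \<in> elts M" "y \<in> elts M" by (auto intro: transitive_mem[OF M])
qed

section \<open>Transfer of first-order statements about codes\<close>

lemma transfer:
  assumes "set_sat W (env xs) \<phi>" "set xs \<subseteq> elts W" "xs \<noteq> []"
  shows "set_sat M (env (map j xs)) \<phi>"
  using assms elementary_env[OF j] by blast

lemmas code_W = code1_W code2_W PW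

text \<open>Here and in the lemmas up to \<open>lift_cover\<close>, the hypothesis is one
  first-order statement about codes that holds in \<open>W\<close>; \<open>transfer\<close> carries
  it to \<open>M\<close>, where the codes have become their lifts.\<close>

lemma lift_not:
  assumes "\<And>i. i \<in> elts P \<Longrightarrow> Q i \<Longrightarrow> A i \<longleftrightarrow> \<not> B i"
    and "lift1 Q i"
  shows "lift1 A i \<longleftrightarrow> \<not> lift1 B i"
proof -
  have "set_sat W (env [code1 Q, code1 A, code1 B])
      (sAll 3 (sImp (SMem 3 0) (sIff (SMem 3 1) (SNeg (SMem 3 2)))))"
    using assms(1) by (simp add: env_def)
  from transfer[OF this] show ?thesis
    using assms(2) lift1_M by (simp add: env_def code_W)
qed

lemma lift_and:
  assumes "\<And>i. i \<in> elts P \<Longrightarrow> Q i \<Longrightarrow> A i \<longleftrightarrow> B i \<and> C i"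
    and "lift1 Q i"
  shows "lift1 A i \<longleftrightarrow> lift1 B i \<and> lift1 C i"
proof -
  have "set_sat W (env [code1 Q, code1 A, code1 B, code1 C])
      (sAll 4 (sImp (SMem 4 0) (sIff (SMem 4 1) (SConj (SMem 4 2) (SMem 4 3)))))"
    using assms(1) by (simp add: env_def)
  from transfer[OF this] show ?thesis
    using assms(2) lift1_M by (simp add: env_def code_W)
qed

lemma lift_ex:
  assumes "\<And>i. i \<in> elts P \<Longrightarrow> Q i \<Longrightarrow> A i \<longleftrightarrow> (\<exists>k \<in> elts P. U i k \<and> B k)"
    and "lift1 Q i"
  shows "lift1 A i \<longleftrightarrow> (\<exists>k. lift2 U i k \<and> lift1 B k)"
proof -
  have "set_sat W (env [code1 Q, code1 A, code2 U, code1 B])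
      (sAll 4 (sImp (SMem 4 0) (sIff (SMem 4 1) (SEx 5 (SConj (fm_rel 2 4 5) (SMem 5 3))))))"
    using assms(1) P_sub_W by (simp add: env_def) blast
  from transfer[OF this] have "\<forall>i \<in> elts M. lift1 Q i \<longrightarrow>
      (lift1 A i \<longleftrightarrow> (\<exists>k \<in> elts M. lift2 U i k \<and> lift1 B k))"
    by (simp add: env_def code_W)
  then show ?thesis using assms(2) lift1_M by blast
qed

lemma lift_ex2:
  assumes "\<And>i. i \<in> elts P \<Longrightarrow> Q i \<Longrightarrow> A i \<longleftrightarrow> (\<exists>k \<in> elts P. U i k \<and> R i k)"
    and "lift1 Q i"
  shows "lift1 A i \<longleftrightarrow> (\<exists>k. lift2 U i k \<and> lift2 R i k)"
proof -
  have "set_sat W (env [code1 Q, code1 A, code2 U, code2 R])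
      (sAll 4 (sImp (SMem 4 0) (sIff (SMem 4 1) (SEx 5 (SConj (fm_rel 2 4 5) (fm_rel 3 4 5))))))"
    using assms(1) P_sub_W by (simp add: env_def) blast
  from transfer[OF this] have "\<forall>i \<in> elts M. lift1 Q i \<longrightarrow>
      (lift1 A i \<longleftrightarrow> (\<exists>k \<in> elts M. lift2 U i k \<and> lift2 R i k))"
    by (simp add: env_def code_W)
  then show ?thesis using assms(2) lift1_M lift2_M by blast
qed

lemma is_pair_W: "p \<in> elts W \<Longrightarrow> is_pair (elts W) p x y \<longleftrightarrow> p = pr x y"
  by (rule is_pair_transitive[OF limit_like_transitive[OF W]])

text \<open>Meant for compound terms: \<open>T\<close> gives the tuple of argument values at a
  state, \<open>F\<close> the graph of the function with the value in front, and \<open>V\<close>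
  the value of the term.\<close>

lemma lift_fun:
  assumes "\<And>i a. i \<in> elts P \<Longrightarrow> Q i \<Longrightarrow> a \<in> elts P \<Longrightarrow> V i a \<longleftrightarrow> (\<exists>c \<in> elts P. T i c \<and> F i (pr a c))"
    and "lift1 Q i"
  shows "lift2 V i a \<longleftrightarrow> (\<exists>c. lift2 T i c \<and> lift2 F i (pr a c))"
proof -
  have *: "(\<exists>p \<in> elts W. is_pair (elts W) p a c \<and> p \<in> elts P \<and> F i p) \<longleftrightarrow>
      a \<in> elts P \<and> c \<in> elts P \<and> F i (pr a c)" if "i \<in> elts P" for i a c
  proof -
    have "a \<in> elts P \<and> c \<in> elts P" if "pr a c \<in> elts P"
    proof -
      have "up a c \<in> elts P" by (rule limit_like_trans[OF P that]) (simp add: pr_def)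
      then show ?thesis by (auto intro: limit_like_trans[OF P])
    qed
    then show ?thesis using P_sub_W by (auto simp: is_pair_W intro: limit_like_pr[OF P])
  qed
  have "set_sat W (env [code1 Q, code2 V, code2 T, code2 F])
      (sAll 4 (sImp (SMem 4 0) (sAll 5 (sIff (fm_rel 1 4 5) (SEx 6 (SConj (fm_rel 2 4 6)
        (SEx 7 (SConj (fm_pair 7 5 6) (fm_rel 3 4 7)))))))))"
    using assms(1) P_sub_W by (simp add: env_def * cong: conj_cong) blast
  from transfer[OF this] have 1: "\<forall>i \<in> elts M. lift1 Q i \<longrightarrow> (\<forall>a \<in> elts M. lift2 V i a \<longleftrightarrow>
      (\<exists>c \<in> elts M. lift2 T i c \<and> (\<exists>p \<in> elts M. is_pair (elts M) p a c \<and> lift2 F i p)))"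
    by (simp add: env_def code_W)
  have 2: "(\<exists>p \<in> elts M. is_pair (elts M) p a c \<and> lift2 F i p) \<longleftrightarrow> lift2 F i (pr a c)" for a c
  proof
    assume "\<exists>p \<in> elts M. is_pair (elts M) p a c \<and> lift2 F i p"
    then obtain p where "p \<in> elts M" "is_pair (elts M) p a c" "lift2 F i p" by blast
    then show "lift2 F i (pr a c)" by (simp add: is_pair_transitive[OF M])
  next
    assume F: "lift2 F i (pr a c)"
    note lift2_M(2)[OF F]
    then show "\<exists>p \<in> elts M. is_pair (elts M) p a c \<and> lift2 F i p"
      using F is_pair_transitive[OF M] by blast
  qed
  have "a \<in> elts M" if "lift2 F i (pr a c)" for c
  proof -
    have "up a c \<in> elts M" by (rule transitive_mem[OF M lift2_M(2)[OF that]]) (simp add: pr_def)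
    then show ?thesis by (auto intro: transitive_mem[OF M])
  qed
  moreover have "lift2 V i a \<longleftrightarrow> (\<exists>c \<in> elts M. lift2 T i c \<and> lift2 F i (pr a c))" if "a \<in> elts M"
    using bspec[OF bspec[OF 1 lift1_M[OF assms(2)], THEN mp, OF assms(2)] that] unfolding 2 .
  ultimately show ?thesis using lift2_M(2) by blast
qed

text \<open>Together with \<open>lift_cons\<close> this determines lifted tuples entry by entry:
  their length is that of an actual list of terms, so induction outside \<open>M\<close> reaches
  every entry.\<close>

lemma lift_empty:
  assumes "\<And>i c. i \<in> elts P \<Longrightarrow> Q i \<Longrightarrow> c \<in> elts P \<Longrightarrow> T i c \<longleftrightarrow> elts c = {}"
    and "lift1 Q i" "lift2 T i c"
  shows "elts c = {}"
proof -
  have "set_sat W (env [code1 Q, code2 T])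
      (sAll 2 (sImp (SMem 2 0) (sAll 3 (sImp (fm_rel 1 2 3) (sAll 4 (SNeg (SMem 4 3)))))))"
    using assms(1) by (simp add: env_def) blast
  from transfer[OF this] have "\<forall>z \<in> elts M. z \<notin> elts c"
    using assms(2,3) lift1_M[OF assms(2)] lift2_M[OF assms(3)]
    by (simp (no_asm_use) add: env_def code_W) blast
  then show ?thesis using transitive_mem[OF M lift2_M(2)[OF assms(3)]] by blast
qed

lemma lift_cons:
  assumes "\<And>i c. i \<in> elts P \<Longrightarrow> Q i \<Longrightarrow> c \<in> elts P \<Longrightarrow>
      T i c \<Longrightarrow> (\<exists>a \<in> elts P. \<exists>b \<in> elts P. V i a \<and> T' i b \<and> c = pr a b)"
    and "lift1 Q i" "lift2 T i c"
  shows "\<exists>a b. lift2 V i a \<and> lift2 T' i b \<and> c = pr a b"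
proof -
  have "set_sat W (env [code1 Q, code2 T, code2 V, code2 T'])
      (sAll 4 (sImp (SMem 4 0) (sAll 5 (sImp (fm_rel 1 4 5) (SEx 6 (SConj (fm_rel 2 4 6)
        (SEx 7 (SConj (fm_rel 3 4 7) (fm_pair 5 6 7)))))))))"
    using assms(1) P_sub_W is_pair_W by (simp add: env_def) blast
  from transfer[OF this] have "\<exists>a \<in> elts M. lift2 V i a \<and> (\<exists>b \<in> elts M. lift2 T' i b \<and> is_pair (elts M) c a b)"
    using assms(2,3) lift1_M lift2_M by (simp add: env_def code_W)
  then show ?thesis using is_pair_transitive[OF M lift2_M(2)[OF assms(3)]] by blast
qed

lemma lift_total:
  assumes "\<And>i. i \<in> elts P \<Longrightarrow> Q i \<Longrightarrow> \<exists>a \<in> elts P. V i a" and "lift1 Q i"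
  shows "\<exists>a. lift2 V i a"
proof -
  have "set_sat W (env [code1 Q, code2 V]) (sAll 2 (sImp (SMem 2 0) (SEx 3 (fm_rel 1 2 3))))"
    using assms(1) P_sub_W by (simp add: env_def) blast
  from transfer[OF this] have "\<exists>a \<in> elts M. lift2 V i a"
    using assms(2) lift1_M by (simp add: env_def code_W)
  then show ?thesis by blast
qed

lemma lift_unique:
  assumes "\<And>i a b. i \<in> elts P \<Longrightarrow> Q i \<Longrightarrow> a \<in> elts P \<Longrightarrow> b \<in> elts P \<Longrightarrow> V i a \<Longrightarrow> V i b \<Longrightarrow> a = b"
    and "lift1 Q i" "lift2 V i a" "lift2 V i b"
  shows "a = b"
proof -
  have "set_sat W (env [code1 Q, code2 V]) (sAll 2 (sImp (SMem 2 0) (sAll 3 (sAll 4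
      (sImp (SConj (fm_rel 1 2 3) (fm_rel 1 2 4)) (SEq 3 4))))))"
    using assms(1) by (simp add: env_def) blast
  from transfer[OF this] show ?thesis
    using assms(2-) lift1_M[OF assms(2)] lift2_M[OF assms(3)] lift2_M[OF assms(4)]
    by (simp add: env_def code_W)
qed

lemma lift_subrel:
  assumes "\<And>i a. i \<in> elts P \<Longrightarrow> Q i \<Longrightarrow> a \<in> elts P \<Longrightarrow> V i a \<Longrightarrow> R i a"
    and "lift1 Q i" "lift2 V i a"
  shows "lift2 R i a"
proof -
  have "set_sat W (env [code1 Q, code2 V, code2 R]) (sAll 3 (sImp (SMem 3 0) (sAll 4
      (sImp (fm_rel 1 3 4) (fm_rel 2 3 4)))))"
    using assms(1) by (simp add: env_def)
  from transfer[OF this] show ?thesis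
    using assms(2-) lift1_M[OF assms(2)] lift2_M[OF assms(3)] by (simp add: env_def code_W)
qed

lemma lift_range:
  assumes "\<And>i k. i \<in> elts P \<Longrightarrow> Q i \<Longrightarrow> k \<in> elts P \<Longrightarrow> U i k \<Longrightarrow> Q k"
    and "lift1 Q i" "lift2 U i k"
  shows "lift1 Q k"
proof -
  have "set_sat W (env [code1 Q, code2 U]) (sAll 2 (sImp (SMem 2 0) (sAll 3
      (sImp (fm_rel 1 2 3) (SMem 3 0)))))"
    using assms(1) by (simp add: env_def) blast
  from transfer[OF this] show ?thesis
    using assms(2-) lift1_M[OF assms(2)] lift2_M[OF assms(3)]
    by (simp (no_asm_use) add: env_def code_W) blast
qed

lemma lift_invariant:
  assumes "\<And>i k c. i \<in> elts P \<Longrightarrow> Q i \<Longrightarrow> k \<in> elts P \<Longrightarrow> U i k \<Longrightarrow> c \<in> elts P \<Longrightarrow> R i c \<longleftrightarrow> R k c"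
    and "lift1 Q i" "lift2 U i k"
  shows "lift2 R i c \<longleftrightarrow> lift2 R k c"
proof -
  have "set_sat W (env [code1 Q, code2 U, code2 R]) (sAll 3 (sImp (SMem 3 0) (sAll 4
      (sImp (fm_rel 1 3 4) (sAll 5 (sIff (fm_rel 2 3 5) (fm_rel 2 4 5)))))))"
    using assms(1) by (simp add: env_def) blast
  from transfer[OF this] have "\<forall>c \<in> elts M. lift2 R i c \<longleftrightarrow> lift2 R k c"
    using assms(2-) lift1_M lift2_M by (simp add: env_def code_W)
  then show ?thesis using lift2_M by blast
qed

lemma lift_update:
  assumes "\<And>i a. i \<in> elts P \<Longrightarrow> Q i \<Longrightarrow> a \<in> elts P \<Longrightarrow> R i a \<Longrightarrow> \<exists>k \<in> elts P. U i k \<and> V k a"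
    and "lift1 Q i" "lift2 R i a"
  shows "\<exists>k. lift2 U i k \<and> lift2 V k a"
proof -
  have "set_sat W (env [code1 Q, code2 R, code2 U, code2 V]) (sAll 4 (sImp (SMem 4 0) (sAll 5
      (sImp (fm_rel 1 4 5) (SEx 6 (SConj (fm_rel 2 4 6) (fm_rel 3 6 5)))))))"
    using assms(1) P_sub_W by (simp add: env_def) blast
  from transfer[OF this] have "\<exists>k \<in> elts M. lift2 U i k \<and> lift2 V k a"
    using assms(2-) lift1_M lift2_M by (simp add: env_def code_W)
  then show ?thesis by blast
qed

text \<open>The point \<open>\<xi>\<close> enters as a parameter and is therefore replaced by
  \<open>j \<xi>\<close>.\<close>

lemma lift_point:
  assumes "\<And>i. i \<in> elts P \<Longrightarrow> Q i \<Longrightarrow> D \<xi> i \<Longrightarrow> A i" and "\<xi> \<in> elts P"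
    and "lift1 Q i" "lift2 D (j \<xi>) i"
  shows "lift1 A i"
proof -
  have "set_sat W (env [code1 Q, code1 A, code2 D, \<xi>]) (sAll 4 (sImp (SMem 4 0)
      (sImp (fm_rel 2 3 4) (SMem 4 1))))"
    using assms(1) by (simp add: env_def)
  from transfer[OF this] show ?thesis
    using assms(2-) lift1_M P_sub_W by (simp add: env_def code_W)
qed

text \<open>What \<open>W\<close> says of all subsets of \<open>\<gamma>\<close> smaller than
  \<open>\<delta>\<close>, \<open>M\<close> says of \<open>j \<gamma>\<close> and
  \<open>j \<delta>\<close>; the lemma is this statement at the covering set
  \<open>d\<close>.\<close>

lemma lift_cover:
  assumes "\<And>x. x \<in> elts W \<Longrightarrow> elts x \<subseteq> elts \<gamma> \<Longrightarrow> cardinality_less (elts W) x \<delta> \<Longrightarrow>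
      \<exists>i \<in> elts P. Q i \<and> (\<forall>\<xi> \<in> elts x. \<xi> \<in> elts P \<and> D \<xi> i)"
    and "\<gamma> \<in> elts W" "\<delta> \<in> elts W"
    and "d \<in> elts M" "elts d \<subseteq> elts (j \<gamma>)" "cardinality_less (elts M) d (j \<delta>)"
  shows "\<exists>i. lift1 Q i \<and> (\<forall>\<xi> \<in> elts d. lift2 D \<xi> i)"
proof -
  have *: "\<exists>i \<in> elts W. (i \<in> elts P \<and> Q i) \<and> (\<forall>\<xi> \<in> elts W. \<xi> \<in> elts x \<longrightarrow> \<xi> \<in> elts P \<and> i \<in> elts P \<and> D \<xi> i)"
    if x: "x \<in> elts W" "\<forall>z \<in> elts W. z \<in> elts x \<longrightarrow> z \<in> elts \<gamma>" "cardinality_less (elts W) x \<delta>" for x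
  proof -
    have "elts x \<subseteq> elts \<gamma>" using x(2) limit_like_trans[OF W x(1)] by blast
    then show ?thesis using assms(1)[OF x(1) _ x(3)] P_sub_W by blast
  qed
  have "set_sat W (env [code1 Q, code2 D, \<gamma>, \<delta>]) (sAll 4 (sImp (SConj (sAll 5 (sImp (SMem 5 4) (SMem 5 2)))
      (fm_cardless 4 3)) (SEx 6 (SConj (SMem 6 0) (sAll 5 (sImp (SMem 5 4) (fm_rel 1 5 6)))))))"
    by (simp add: env_def) (use * in blast)
  from transfer[OF this] have "\<exists>i \<in> elts M. lift1 Q i \<and> (\<forall>\<xi> \<in> elts M. \<xi> \<in> elts d \<longrightarrow> lift2 D \<xi> i)"
    using assms(2-) by (simp add: env_def code_W subset_eq)
  then show ?thesis using transitive_mem[OF M assms(4)] by blast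
qed

text \<open>By \<open>cards\<close>, \<open>W\<close> has a cardinal for each subset of
  \<open>P\<close>, so \<open>M\<close> has cardinals \<open>\<kappa>\<close> and
  \<open>\<mu>\<close> for \<open>u\<close> and \<open>v\<close>. They are true cardinals by
  cardinal correctness and equipollent in \<open>V\<close>, hence equal, and the bijections of
  \<open>M\<close> compose.\<close>

lemma is_equinumerous_lift:
  assumes "u \<in> elts M" "v \<in> elts M" "elts u \<subseteq> elts (j P)" "elts v \<subseteq> elts (j P)"
  shows "is_equinumerous (elts M) u v \<longleftrightarrow> elts u \<approx> elts v"
proof
  assume "elts u \<approx> elts v"
  have "\<exists>\<kappa> \<in> elts W. is_cardinal (elts W) \<kappa> \<and> is_equinumerous (elts W) \<kappa> x"
    if x: "x \<in> elts W" "elts x \<subseteq> elts P" for x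
  proof -
    obtain \<kappa> where "\<kappa> \<in> elts W" "Card \<kappa>" "elts \<kappa> \<approx> elts x" using cards[OF x(2)] by blast
    then show ?thesis
      using is_cardinal_limit_like[OF W] is_equinumerous_limit_like[OF W _ x(1)] by blast
  qed
  then have "set_sat W (env [P]) (sAll 1 (sImp (sAll 2 (sImp (SMem 2 1) (SMem 2 0)))
      (SEx 2 (SConj (fm_card 2) (fm_equinum 2 1)))))"
    using limit_like_trans[OF W] by (simp add: env_def subset_eq)
  from transfer[OF this] have "\<exists>\<kappa> \<in> elts M. is_cardinal (elts M) \<kappa> \<and> is_equinumerous (elts M) \<kappa> x"
    if "x \<in> elts M" "elts x \<subseteq> elts (j P)" for x
    using that by (simp add: env_def code_W subset_eq)
  then obtain \<kappa> \<mu> where \<kappa>: "\<kappa> \<in> elts M" "is_cardinal (elts M) \<kappa>" "is_equinumerous (elts M) \<kappa> u"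
    and \<mu>: "\<mu> \<in> elts M" "is_cardinal (elts M) \<mu>" "is_equinumerous (elts M) \<mu> v"
    using assms by meson
  have "elts \<kappa> \<approx> elts \<mu>"
    using is_equinumerous_transitive[OF M \<kappa>(3,1) assms(1)] \<open>elts u \<approx> elts v\<close>
      is_equinumerous_transitive[OF M \<mu>(3,1) assms(2)] eqpoll_trans eqpoll_sym by metis
  then have "\<kappa> = \<mu>"
    using Card_eqpoll_eq correct \<kappa>(1,2) \<mu>(1,2) unfolding cardinal_correct_def by blast
  \<comment> \<open>Composability of bijections holds in the limit level \<open>W\<close> and is
    first-order, so \<open>M\<close> inherits it.\<close>
  have eq_trans: "is_equinumerous (elts W) x y" if "x \<in> elts W" "y \<in> elts W" "z \<in> elts W"
      "is_equinumerous (elts W) z x" "is_equinumerous (elts W) z y" for x y z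
  proof -
    have "elts z \<approx> elts x" "elts z \<approx> elts y"
      using that is_equinumerous_limit_like[OF W that(3,1)] is_equinumerous_limit_like[OF W that(3,2)]
      by blast+
    then show ?thesis
      using is_equinumerous_limit_like[OF W that(1,2)] eqpoll_sym eqpoll_trans by blast
  qed
  have "set_sat W (env [P]) (sAll 1 (sAll 2 (sAll 3
      (sImp (SConj (fm_equinum 3 1) (fm_equinum 3 2)) (fm_equinum 1 2)))))"
    by (simp add: env_def) (use eq_trans in blast)
  from transfer[OF this] show "is_equinumerous (elts M) u v"
    using assms(1,2) \<kappa> \<mu> \<open>\<kappa> = \<mu>\<close>
    by (simp (no_asm_use) add: env_def code_W) blast
qed (use is_equinumerous_transitive[OF M] assms in blast)

text \<open>In \<open>W\<close> the defined set is a value of \<open>code1\<close>, so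
  \<open>W\<close> satisfies the corresponding instance of separation, which \<open>M\<close>
  inherits.\<close>

lemma lift_definable_set:
  assumes "lift1 Q i"
  shows "\<exists>u \<in> elts M. elts u = {a \<in> elts (j P). \<exists>k. lift2 U i k \<and> lift2 V k a \<and> lift1 A k}"
proof -
  have "set_sat W (env [P, code2 U, code2 V, code1 A]) (sAll 4 (SEx 5 (sAll 6 (sIff (SMem 6 5)
      (SConj (SMem 6 0) (SEx 7 (SConj (fm_rel 1 4 7) (SConj (fm_rel 2 7 6) (SMem 7 3)))))))))"
  proof -
    have "\<exists>u \<in> elts W. \<forall>a \<in> elts W. a \<in> elts u \<longleftrightarrow> a \<in> elts P \<and> B a" for B
      by (rule bexI[OF _ code1_W[of B]]) simp
    then show ?thesis by (simp add: env_def)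
  qed
  from transfer[OF this] obtain u where u: "u \<in> elts M" "\<forall>a \<in> elts M. a \<in> elts u \<longleftrightarrow>
      a \<in> elts (j P) \<and> (\<exists>k \<in> elts M. lift2 U i k \<and> lift2 V k a \<and> lift1 A k)"
    using lift1_M[OF assms] by (auto simp: env_def code_W)
  have "elts u = {a \<in> elts (j P). \<exists>k. lift2 U i k \<and> lift2 V k a \<and> lift1 A k}"
    using u transitive_mem[OF M u(1)] transitive_mem[OF M elementary_closed[OF j PW]] lift1_M by blast
  then show ?thesis using u(1) by blast
qed

lemma lift2_j_P: "lift2 R x y \<Longrightarrow> y \<in> elts (j P)"
proof -
  assume *: "lift2 R x y"
  have "set_sat W (env [P, code2 R]) (sAll 2 (sAll 3 (sImp (fm_rel 1 2 3) (SMem 3 0))))"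
    by (simp add: env_def)
  from transfer[OF this] show ?thesis
    using * lift2_M[OF *] by (simp add: env_def code_W)
qed

text \<open>Both sets are members of \<open>M\<close> by \<open>lift_definable_set\<close>, and
  \<open>M\<close> judges their equinumerosity as \<open>V\<close> does by
  \<open>is_equinumerous_lift\<close>.\<close>

lemma lift_haertig:
  assumes "\<And>i. i \<in> elts P \<Longrightarrow> Q i \<Longrightarrow> H i \<longleftrightarrow>
      {a \<in> elts P. \<exists>k \<in> elts P. U i k \<and> V k a \<and> A k} \<approx> {b \<in> elts P. \<exists>k \<in> elts P. U' i k \<and> V' k b \<and> B k}"
    and "lift1 Q i"
  shows "lift1 H i \<longleftrightarrow> {a. \<exists>k. lift2 U i k \<and> lift2 V k a \<and> lift1 A k} \<approx>
    {b. \<exists>k. lift2 U' i k \<and> lift2 V' k b \<and> lift1 B k}"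
proof -
  \<comment> \<open>Variables 0 to 8 hold the parameters listed in \<open>xs\<close>, 9 the state,
    10 and 11 the two sets, 12 an element and 13 an updated state.\<close>
  define \<phi> where "\<phi> = sAll 9 (sImp (SMem 9 0) (sAll 10 (sAll 11 (sImp
    (SConj (sAll 12 (sIff (SMem 12 10) (SConj (SMem 12 8) (SEx 13 (SConj (fm_rel 2 9 13) (SConj (fm_rel 3 13 12) (SMem 13 4)))))))
      (sAll 12 (sIff (SMem 12 11) (SConj (SMem 12 8) (SEx 13 (SConj (fm_rel 5 9 13) (SConj (fm_rel 6 13 12) (SMem 13 7))))))))
    (sIff (SMem 9 1) (fm_equinum 10 11))))))"
  define xs where "xs = [code1 Q, code1 H, code2 U, code2 V, code1 A, code2 U', code2 V', code1 B, P]"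
  have "H i \<longleftrightarrow> is_equinumerous (elts W) u v" if i: "i \<in> elts P" "Q i" and uv: "u \<in> elts W" "v \<in> elts W"
    and u: "\<forall>a \<in> elts W. a \<in> elts u \<longleftrightarrow> a \<in> elts P \<and> (\<exists>k \<in> elts W. (k \<in> elts P \<and> U i k) \<and> (k \<in> elts P \<and> V k a) \<and> k \<in> elts P \<and> A k)"
    and v: "\<forall>a \<in> elts W. a \<in> elts v \<longleftrightarrow> a \<in> elts P \<and> (\<exists>k \<in> elts W. (k \<in> elts P \<and> U' i k) \<and> (k \<in> elts P \<and> V' k a) \<and> k \<in> elts P \<and> B k)"
    for i u v
  proof -
    have "elts u = {a \<in> elts P. \<exists>k \<in> elts P. U i k \<and> V k a \<and> A k}"
      using u P_sub_W limit_like_trans[OF W uv(1)] by blast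
    moreover have "elts v = {b \<in> elts P. \<exists>k \<in> elts P. U' i k \<and> V' k b \<and> B k}"
      using v P_sub_W limit_like_trans[OF W uv(2)] by blast
    ultimately show ?thesis using assms(1)[OF i] is_equinumerous_limit_like[OF W uv] by simp
  qed
  then have "set_sat W (env xs) \<phi>"
    unfolding \<phi>_def xs_def by (simp add: env_def) (simp cong: conj_cong)
  then have M\<phi>: "set_sat M (env (map j xs)) \<phi>" by (rule transfer) (simp_all add: xs_def code_W)
  obtain u where u: "u \<in> elts M" "elts u = {a \<in> elts (j P). \<exists>k. lift2 U i k \<and> lift2 V k a \<and> lift1 A k}"
    using lift_definable_set[OF assms(2)] by blast
  obtain v where v: "v \<in> elts M" "elts v = {a \<in> elts (j P). \<exists>k. lift2 U' i k \<and> lift2 V' k a \<and> lift1 B k}"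
    using lift_definable_set[OF assms(2)] by blast
  have "lift1 H i \<longleftrightarrow> is_equinumerous (elts M) u v"
  proof -
    have "\<forall>a \<in> elts M. a \<in> elts u \<longleftrightarrow> a \<in> elts (j P) \<and> (\<exists>k \<in> elts M. lift2 U i k \<and> lift2 V k a \<and> lift1 A k)"
      using u(2) lift1_M by blast
    moreover have "\<forall>a \<in> elts M. a \<in> elts v \<longleftrightarrow> a \<in> elts (j P) \<and> (\<exists>k \<in> elts M. lift2 U' i k \<and> lift2 V' k a \<and> lift1 B k)"
      using v(2) lift1_M by blast
    ultimately show ?thesis
      using M\<phi> assms(2) lift1_M[OF assms(2)] u(1) v(1) unfolding \<phi>_def xs_def by (simp add: env_def)
  qed
  also have "\<dots> \<longleftrightarrow> elts u \<approx> elts v"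
    by (rule is_equinumerous_lift[OF u(1) v(1)]) (use u(2) v(2) in blast)+
  also have "elts u = {a. \<exists>k. lift2 U i k \<and> lift2 V k a \<and> lift1 A k}"
    unfolding u(2) using lift2_j_P by blast
  also have "elts v = {a. \<exists>k. lift2 U' i k \<and> lift2 V' k a \<and> lift1 B k}"
    unfolding v(2) using lift2_j_P by blast
  finally show ?thesis .
qed

end

section \<open>The model read off from an embedding\<close>

lemma elts_set_of_empty [simp]: "elts (set_of {} :: 'v::zfc_universe) = {}"
proof -
  obtain y :: 'v where "elts y = {}" using separation[of "{}" undefined] by auto
  then show ?thesis by (rule elts_set_of)
qed

primrec listcode :: "'v::zfc_universe list \<Rightarrow> 'v" where
  "listcode [] = set_of {}"
| "listcode (a # as) = pr a (listcode as)"

lemma pr_neq_empty [simp]: "pr a b \<noteq> set_of {}" "set_of {} \<noteq> pr a b"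
proof -
  show "pr a b \<noteq> set_of {}"
  proof
    assume "pr a b = set_of {}"
    then have "elts (pr a b) = {}" by simp
    then show False by (simp add: pr_def)
  qed
  then show "set_of {} \<noteq> pr a b" by (rule not_sym)
qed

lemma listcode_inject [simp]: "listcode as = listcode bs \<longleftrightarrow> as = bs"
proof (induction as arbitrary: bs)
  case Nil
  show ?case by (cases bs) simp_all
next
  case (Cons a as)
  show ?case by (cases bs) (simp_all add: Cons)
qed

lemma listcode_limit_like:
  assumes P: "limit_like P" "x \<in> elts P" and as: "set as \<subseteq> elts P"
  shows "listcode as \<in> elts P"
  using as
proof (induction as)
  case Nil
  show ?case by (rule limit_like_subset[OF P(1,2)]) simp
qed (simp add: limit_like_pr[OF P(1)])

lemma LI_val_carrier:
  assumes "wf_structure A" "range s \<subseteq> elts (carrier A)"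
  shows "LI_val A s t \<in> elts (carrier A)"
proof (induction t)
  case (Var n)
  show ?case using assms(2) by auto
next
  case (Fun f ts)
  then have "set (map (LI_val A s) ts) \<subseteq> elts (carrier A)" by auto
  then show ?case using assms(1) by (simp add: wf_structure_def)
qed

lemma LI_val_cong:
  assumes "\<And>n. n \<in> tm_fv t \<Longrightarrow> s n = s' n"
  shows "LI_val A s t = LI_val A s' t"
  using assms
proof (induction t)
  case (Fun f ts)
  have "map (LI_val A s) ts = map (LI_val A s') ts"
    by (rule map_cong[OF refl]) (use Fun in auto)
  then show ?case by (simp only: LI_val.simps)
qed simp

lemma LI_sat_cong:
  assumes "\<And>n. n \<in> fm_fv \<phi> \<Longrightarrow> s n = s' n"
  shows "LI_sat A s \<phi> \<longleftrightarrow> LI_sat A s' \<phi>"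
  using assms
proof (induction \<phi> arbitrary: s s')
  case (Eq t u)
  have "LI_val A s t = LI_val A s' t" "LI_val A s u = LI_val A s' u"
    by (rule LI_val_cong; use Eq in auto)+
  then show ?case by simp
next
  case (Rel r ts)
  have "map (LI_val A s) ts = map (LI_val A s') ts"
    by (rule map_cong[OF refl], rule LI_val_cong) (use Rel in auto)
  then show ?case by (simp only: LI_sat.simps)
next
  case (Neg \<phi>)
  have "LI_sat A s \<phi> \<longleftrightarrow> LI_sat A s' \<phi>" by (rule Neg.IH) (use Neg.prems in auto)
  then show ?case by simp
next
  case (Conj \<phi> \<psi>)
  have "LI_sat A s \<phi> \<longleftrightarrow> LI_sat A s' \<phi>" by (rule Conj.IH(1)) (use Conj.prems in auto)
  moreover have "LI_sat A s \<psi> \<longleftrightarrow> LI_sat A s' \<psi>" by (rule Conj.IH(2)) (use Conj.prems in auto)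
  ultimately show ?case by simp
next
  case (Exists x \<phi>)
  have "LI_sat A (s(x := a)) \<phi> \<longleftrightarrow> LI_sat A (s'(x := a)) \<phi>" for a
    by (rule Exists.IH) (use Exists.prems in auto)
  then show ?case by simp
next
  case (Haertig x y \<phi> \<psi>)
  have "LI_sat A (s(x := a)) \<phi> \<longleftrightarrow> LI_sat A (s'(x := a)) \<phi>" for a
    by (rule Haertig.IH(1)) (use Haertig.prems in auto)
  moreover have "LI_sat A (s(y := a)) \<psi> \<longleftrightarrow> LI_sat A (s'(y := a)) \<psi>" for a
    by (rule Haertig.IH(2)) (use Haertig.prems in auto)
  ultimately show ?case by simp
qed

text \<open>
  A state codes an index \<open>d\<close> together with an assignment into the structure \<open>A d\<close>. The images
  under \<open>j\<close> of the relations below on states behave, near a fixed state \<open>i\<^sub>0\<close> of \<open>M\<close>, like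
  satisfaction in a single structure.
\<close>

locale model_family = reflection W P M j
  for W P M :: "'v::zfc_universe" and j +
  fixes A :: "'v \<Rightarrow> 'v LI_structure" and St :: "'v \<Rightarrow> bool"
    and idx :: "'v \<Rightarrow> 'v" and asg :: "'v \<Rightarrow> nat \<Rightarrow> 'v"
  assumes wf: "St i \<Longrightarrow> wf_structure (A (idx i))"
    and carrier_P: "St i \<Longrightarrow> elts (carrier (A (idx i))) \<subseteq> elts P"
    and asg: "St i \<Longrightarrow> range (asg i) \<subseteq> elts (carrier (A (idx i)))"
    and St_P: "St i \<Longrightarrow> i \<in> elts P"
    and St_update: "St i \<Longrightarrow> a \<in> elts (carrier (A (idx i))) \<Longrightarrow>
      \<exists>k. St k \<and> idx k = idx i \<and> asg k = (asg i)(n := a)"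
begin

definition Car :: "'v \<Rightarrow> 'v \<Rightarrow> bool" where
  "Car i a \<longleftrightarrow> a \<in> elts (carrier (A (idx i)))"

definition Rl :: "'v \<Rightarrow> 'v \<Rightarrow> 'v \<Rightarrow> bool" where
  "Rl r i c \<longleftrightarrow> (\<exists>as. set as \<subseteq> elts (carrier (A (idx i))) \<and> c = listcode as \<and> rel_int (A (idx i)) r as)"

text \<open>The value precedes the arguments, so that \<open>pr a c\<close> prefixes a value
  \<open>a\<close> to a coded tuple \<open>c\<close>.\<close>

definition Fn :: "'v \<Rightarrow> 'v \<Rightarrow> 'v \<Rightarrow> bool" where
  "Fn f i c \<longleftrightarrow> (\<exists>as. set as \<subseteq> elts (carrier (A (idx i))) \<and>
     c = listcode (fun_int (A (idx i)) f as # as))"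

definition Val :: "'v LI_tm \<Rightarrow> 'v \<Rightarrow> 'v \<Rightarrow> bool" where
  "Val t i a \<longleftrightarrow> a = LI_val (A (idx i)) (asg i) t"

definition Tup :: "'v LI_tm list \<Rightarrow> 'v \<Rightarrow> 'v \<Rightarrow> bool" where
  "Tup ts i c \<longleftrightarrow> c = listcode (map (LI_val (A (idx i)) (asg i)) ts)"

text \<open>The new value is read off from \<open>k\<close> itself, so that each variable yields a
  binary relation on states.\<close>

definition Upd :: "nat \<Rightarrow> 'v \<Rightarrow> 'v \<Rightarrow> bool" where
  "Upd n i k \<longleftrightarrow> St k \<and> idx k = idx i \<and> asg k = (asg i)(n := asg k n)"

definition Sat :: "'v LI_fm \<Rightarrow> 'v \<Rightarrow> bool" where
  "Sat \<phi> i \<longleftrightarrow> LI_sat (A (idx i)) (asg i) \<phi>"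

lemma LI_val_St: "St i \<Longrightarrow> LI_val (A (idx i)) (asg i) t \<in> elts (carrier (A (idx i)))"
  by (rule LI_val_carrier[OF wf asg])

lemma LI_val_P: "St i \<Longrightarrow> LI_val (A (idx i)) (asg i) t \<in> elts P"
  using LI_val_St carrier_P by blast

lemma LI_vals_P: "St i \<Longrightarrow> listcode (map (LI_val (A (idx i)) (asg i)) ts) \<in> elts P"
  by (rule listcode_limit_like[OF P St_P]) (auto intro: LI_val_P)

text \<open>Elements of the structure correspond to updated states, by \<open>St_update\<close>.
  Keeping \<open>Q\<close> arbitrary lets both kinds of quantifier use this.\<close>

lemma Upd_ex: "St i \<Longrightarrow> (\<exists>k \<in> elts P. Upd n i k \<and> asg k n = a \<and> Q (asg k) (idx k)) \<longleftrightarrow>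
    a \<in> elts (carrier (A (idx i))) \<and> Q ((asg i)(n := a)) (idx i)"
proof
  assume i: "St i" and "\<exists>k \<in> elts P. Upd n i k \<and> asg k n = a \<and> Q (asg k) (idx k)"
  then obtain k where k: "St k" "idx k = idx i" "asg k = (asg i)(n := a)" "asg k n = a" "Q (asg k) (idx k)"
    by (auto simp: Upd_def)
  have "a \<in> elts (carrier (A (idx k)))" using asg[OF k(1)] k(4) by blast
  then show "a \<in> elts (carrier (A (idx i))) \<and> Q ((asg i)(n := a)) (idx i)"
    using k(2,3,5) by simp
next
  assume i: "St i" and a: "a \<in> elts (carrier (A (idx i))) \<and> Q ((asg i)(n := a)) (idx i)"
  then obtain k where k: "St k" "idx k = idx i" "asg k = (asg i)(n := a)"
    using St_update by blast
  then show "\<exists>k \<in> elts P. Upd n i k \<and> asg k n = a \<and> Q (asg k) (idx k)"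
    using a by (intro bexI[OF _ St_P[OF k(1)]]) (simp add: Upd_def)
qed

section \<open>Lifted clauses for terms, formulas and updates\<close>

lemma lift_Val_ex: "lift1 St i \<Longrightarrow> \<exists>a. lift2 (Val t) i a"
  by (rule lift_total) (use LI_val_P in \<open>auto simp: Val_def\<close>)

lemma lift_Val_unique: "lift1 St i \<Longrightarrow> lift2 (Val t) i a \<Longrightarrow> lift2 (Val t) i b \<Longrightarrow> a = b"
  by (rule lift_unique[of St "Val t"]) (auto simp: Val_def)

lemma lift_Val_Car: "lift1 St i \<Longrightarrow> lift2 (Val t) i a \<Longrightarrow> lift2 Car i a"
  by (rule lift_subrel[of St "Val t"]) (auto simp: Val_def Car_def intro: LI_val_St)

lemma lift_Tup_ex: "lift1 St i \<Longrightarrow> \<exists>c. lift2 (Tup ts) i c"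
  by (rule lift_total) (use LI_vals_P in \<open>auto simp: Tup_def\<close>)

lemma lift_Tup_unique: "lift1 St i \<Longrightarrow> lift2 (Tup ts) i a \<Longrightarrow> lift2 (Tup ts) i b \<Longrightarrow> a = b"
  by (rule lift_unique[of St "Tup ts"]) (auto simp: Tup_def)

lemma lift_Tup_Nil: "lift1 St i \<Longrightarrow> lift2 (Tup []) i c \<Longrightarrow> c = listcode []"
proof -
  assume "lift1 St i" "lift2 (Tup []) i c"
  then have "elts c = {}"
    by (rule lift_empty[rotated]) (auto simp: Tup_def intro: extensionality)
  then show "c = listcode []" by (intro extensionality) simp
qed

lemma lift_Tup_Cons: "lift1 St i \<Longrightarrow> lift2 (Tup (t # ts)) i c \<Longrightarrow>
    \<exists>a b. lift2 (Val t) i a \<and> lift2 (Tup ts) i b \<and> c = pr a b"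
  by (rule lift_cons[where Q = St and T = "Tup (t # ts)"])
    (use LI_val_P LI_vals_P in \<open>auto simp: Tup_def Val_def\<close>)

lemma lift_Fun: "lift1 St i \<Longrightarrow>
    lift2 (Val (Fun f ts)) i a \<longleftrightarrow> (\<exists>c. lift2 (Tup ts) i c \<and> lift2 (Fn f) i (pr a c))"
proof (rule lift_fun[where Q = St])
  fix i a
  assume i: "St i"
  have "set (map (LI_val (A (idx i)) (asg i)) ts) \<subseteq> elts (carrier (A (idx i)))"
    using LI_val_St[OF i] by auto
  then show "Val (Fun f ts) i a \<longleftrightarrow> (\<exists>c \<in> elts P. Tup ts i c \<and> Fn f i (pr a c))"
    using LI_vals_P[OF i] by (auto simp: Val_def Tup_def Fn_def)
qed

lemma lift_Sat_Eq: "lift1 St i \<Longrightarrow>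
    lift1 (Sat (Eq t u)) i \<longleftrightarrow> (\<exists>a. lift2 (Val t) i a \<and> lift2 (Val u) i a)"
  by (rule lift_ex2[where Q = St]) (use LI_val_P in \<open>auto simp: Sat_def Val_def\<close>)

lemma lift_Sat_Rel: "lift1 St i \<Longrightarrow>
    lift1 (Sat (Rel r ts)) i \<longleftrightarrow> (\<exists>c. lift2 (Tup ts) i c \<and> lift2 (Rl r) i c)"
proof (rule lift_ex2[where Q = St])
  fix i
  assume i: "St i"
  have "set (map (LI_val (A (idx i)) (asg i)) ts) \<subseteq> elts (carrier (A (idx i)))"
    using LI_val_St[OF i] by auto
  then show "Sat (Rel r ts) i \<longleftrightarrow> (\<exists>c \<in> elts P. Tup ts i c \<and> Rl r i c)"
    using LI_vals_P[OF i] by (auto simp: Sat_def Tup_def Rl_def)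
qed

lemma lift_Sat_Neg: "lift1 St i \<Longrightarrow> lift1 (Sat (Neg \<phi>)) i \<longleftrightarrow> \<not> lift1 (Sat \<phi>) i"
  by (rule lift_not[where Q = St]) (simp_all add: Sat_def)

lemma lift_Sat_Conj:
  "lift1 St i \<Longrightarrow> lift1 (Sat (Conj \<phi> \<psi>)) i \<longleftrightarrow> lift1 (Sat \<phi>) i \<and> lift1 (Sat \<psi>) i"
  by (rule lift_and[where Q = St]) (simp_all add: Sat_def)

lemma lift_Sat_Exists: "lift1 St i \<Longrightarrow>
    lift1 (Sat (Exists n \<phi>)) i \<longleftrightarrow> (\<exists>k. lift2 (Upd n) i k \<and> lift1 (Sat \<phi>) k)"
proof (rule lift_ex[where Q = St])
  fix i
  assume i: "St i"
  have "(\<exists>k \<in> elts P. Upd n i k \<and> asg k n = a \<and> Sat \<phi> k) \<longleftrightarrow>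
      a \<in> elts (carrier (A (idx i))) \<and> LI_sat (A (idx i)) ((asg i)(n := a)) \<phi>" for a
    using Upd_ex[OF i, of n a "\<lambda>s d. LI_sat (A d) s \<phi>"] by (simp add: Sat_def)
  then show "Sat (Exists n \<phi>) i \<longleftrightarrow> (\<exists>k \<in> elts P. Upd n i k \<and> Sat \<phi> k)"
    unfolding Sat_def[of "Exists n \<phi>"] LI_sat.simps by blast
qed

lemma lift_Sat_Haertig: "lift1 St i \<Longrightarrow> lift1 (Sat (Haertig x y \<phi> \<psi>)) i \<longleftrightarrow>
    {a. \<exists>k. lift2 (Upd x) i k \<and> lift2 (Val (Var x)) k a \<and> lift1 (Sat \<phi>) k} \<approx>
    {b. \<exists>k. lift2 (Upd y) i k \<and> lift2 (Val (Var y)) k b \<and> lift1 (Sat \<psi>) k}"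
proof (rule lift_haertig[where Q = St])
  fix i
  assume i: "St i"
  have "{a \<in> elts P. \<exists>k \<in> elts P. Upd n i k \<and> Val (Var n) k a \<and> Sat \<chi> k} =
      {a \<in> elts (carrier (A (idx i))). LI_sat (A (idx i)) ((asg i)(n := a)) \<chi>}" for n \<chi>
  proof -
    have "(\<exists>k \<in> elts P. Upd n i k \<and> Val (Var n) k a \<and> Sat \<chi> k) \<longleftrightarrow>
        a \<in> elts (carrier (A (idx i))) \<and> LI_sat (A (idx i)) ((asg i)(n := a)) \<chi>" for a
      using Upd_ex[OF i, of n a "\<lambda>s d. LI_sat (A d) s \<chi>"] by (simp add: Sat_def Val_def eq_commute)
    then show ?thesis using carrier_P[OF i] by blast
  qed
  then show "Sat (Haertig x y \<phi> \<psi>) i \<longleftrightarrow>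
      {a \<in> elts P. \<exists>k \<in> elts P. Upd x i k \<and> Val (Var x) k a \<and> Sat \<phi> k} \<approx>
      {b \<in> elts P. \<exists>k \<in> elts P. Upd y i k \<and> Val (Var y) k b \<and> Sat \<psi> k}"
    by (simp add: Sat_def)
qed

lemma lift_Upd_St: "lift1 St i \<Longrightarrow> lift2 (Upd n) i k \<Longrightarrow> lift1 St k"
  by (rule lift_range[where Q = St and U = "Upd n"]) (simp_all add: Upd_def)

lemma lift_Upd_Car: "lift1 St i \<Longrightarrow> lift2 (Upd n) i k \<Longrightarrow> lift2 Car i c \<longleftrightarrow> lift2 Car k c"
  by (rule lift_invariant[where Q = St and U = "Upd n"]) (simp_all add: Upd_def Car_def)

lemma lift_Upd_Rl: "lift1 St i \<Longrightarrow> lift2 (Upd n) i k \<Longrightarrow> lift2 (Rl r) i c \<longleftrightarrow> lift2 (Rl r) k c"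
  by (rule lift_invariant[where Q = St and U = "Upd n"]) (simp_all add: Upd_def Rl_def)

lemma lift_Upd_Fn: "lift1 St i \<Longrightarrow> lift2 (Upd n) i k \<Longrightarrow> lift2 (Fn f) i c \<longleftrightarrow> lift2 (Fn f) k c"
  by (rule lift_invariant[where Q = St and U = "Upd n"]) (simp_all add: Upd_def Fn_def)

lemma lift_Upd_Var: "lift1 St i \<Longrightarrow> lift2 (Upd n) i k \<Longrightarrow> m \<noteq> n \<Longrightarrow>
    lift2 (Val (Var m)) i c \<longleftrightarrow> lift2 (Val (Var m)) k c"
proof (rule lift_invariant[where Q = St and U = "Upd n"])
  fix i k c assume "Upd n i k" "m \<noteq> n"
  then have "asg k m = asg i m" unfolding Upd_def by (metis fun_upd_other)
  then show "Val (Var m) i c \<longleftrightarrow> Val (Var m) k c" by (simp add: Val_def)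
qed

lemma lift_Upd_ex: "lift1 St i \<Longrightarrow> lift2 Car i a \<Longrightarrow> \<exists>k. lift2 (Upd n) i k \<and> lift2 (Val (Var n)) k a"
proof (rule lift_update[where Q = St and R = Car])
  fix i a assume "St i" "Car i a"
  then show "\<exists>k \<in> elts P. Upd n i k \<and> Val (Var n) k a"
    using Upd_ex[of i n a "\<lambda>_ _. True"] by (auto simp: Car_def Val_def)
qed

text \<open>States of \<open>M\<close> have no decoding of their own, so the assignment of such a
  state is recovered from the lifted values of the variables.\<close>

definition val :: "'v \<Rightarrow> nat \<Rightarrow> 'v" where
  "val i n = (THE a. lift2 (Val (Var n)) i a)"

lemma lift_Val_Var:
  assumes "lift1 St i"
  shows "lift2 (Val (Var n)) i a \<longleftrightarrow> a = val i n"
proof -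
  obtain b where b: "lift2 (Val (Var n)) i b" using lift_Val_ex[OF assms] by blast
  then have "val i n = b" unfolding val_def using lift_Val_unique[OF assms] by blast
  then show ?thesis using b lift_Val_unique[OF assms] by blast
qed

lemma val_Upd:
  assumes "lift1 St i" "lift2 (Upd n) i k"
  shows "val k = (val i)(n := val k n)"
proof
  fix m
  have "val k m = val i m" if "m \<noteq> n"
    using lift_Upd_Var[OF assms that, of "val i m"] lift_Val_Var[OF assms(1)]
      lift_Val_Var[OF lift_Upd_St[OF assms]] by simp
  then show "val k m = ((val i)(n := val k n)) m" by simp
qed

section \<open>The structure determined by a state of \<open>M\<close>\<close>

context
  fixes i0 :: 'v
  assumes i0: "lift1 St i0"
begin

text \<open>A substitute for equality of indices among states of \<open>M\<close>; it is preserved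
  by updates.\<close>

definition same :: "'v \<Rightarrow> bool" where
  "same i \<longleftrightarrow> lift1 St i \<and> (\<forall>c. lift2 Car i c \<longleftrightarrow> lift2 Car i0 c) \<and>
     (\<forall>r c. lift2 (Rl r) i c \<longleftrightarrow> lift2 (Rl r) i0 c) \<and> (\<forall>f c. lift2 (Fn f) i c \<longleftrightarrow> lift2 (Fn f) i0 c)"

text \<open>Function values are chosen from the lifted graph; where it offers none, an arbitrary
  element of the carrier keeps the operation total.\<close>

definition limit_model :: "'v LI_structure" where
  "limit_model = \<lparr>carrier = set_of {a. lift2 Car i0 a},
     fun_int = (\<lambda>f as. if \<exists>a. lift2 Car i0 a \<and> lift2 (Fn f) i0 (listcode (a # as))
       then SOME a. lift2 Car i0 a \<and> lift2 (Fn f) i0 (listcode (a # as)) else SOME a. lift2 Car i0 a),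
     rel_int = (\<lambda>r as. lift2 (Rl r) i0 (listcode as))\<rparr>"

lemma same_i0: "same i0"
  using i0 by (simp add: same_def)

lemma same_Upd: "same i \<Longrightarrow> lift2 (Upd n) i k \<Longrightarrow> same k"
  using lift_Upd_St lift_Upd_Car lift_Upd_Rl lift_Upd_Fn unfolding same_def by metis

lemma Car_ex: "\<exists>a. lift2 Car i0 a"
  using lift_Val_ex[OF i0] lift_Val_Car[OF i0] by blast

lemma carrier_limit_model: "elts (carrier limit_model) = {a. lift2 Car i0 a}"
proof -
  have "{a. lift2 Car i0 a} \<subseteq> elts M" using lift2_M by blast
  from separation[OF this] show ?thesis
    unfolding limit_model_def LI_structure.simps by (elim exE) (rule elts_set_of)
qed

lemma wf_limit_model: "wf_structure limit_model"
  unfolding wf_structure_def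
proof (intro conjI allI impI)
  show "elts (carrier limit_model) \<noteq> {}" using Car_ex carrier_limit_model by blast
  fix f as
  show "fun_int limit_model f as \<in> elts (carrier limit_model)"
  proof (cases "\<exists>a. lift2 Car i0 a \<and> lift2 (Fn f) i0 (listcode (a # as))")
    case True
    from someI_ex[OF this] show ?thesis using True by (simp add: carrier_limit_model) (simp add: limit_model_def)
  next
    case False
    from someI_ex[OF Car_ex] show ?thesis
      using False by (simp add: carrier_limit_model) (auto simp: limit_model_def)
  qed
qed

lemma val_carrier: "same i \<Longrightarrow> val i n \<in> elts (carrier limit_model)"
  using lift_Val_Var[of i n "val i n"] lift_Val_Car[of i "Var n" "val i n"]
  by (simp add: carrier_limit_model same_def)

lemma lift_Tup_limit_model:
  assumes "same i" "\<And>t. t \<in> set ts \<Longrightarrow> lift2 (Val t) i (LI_val limit_model (val i) t)"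
  shows "lift2 (Tup ts) i (listcode (map (LI_val limit_model (val i)) ts))"
  using assms(2)
proof (induction ts)
  case Nil
  have i: "lift1 St i" using assms(1) by (simp add: same_def)
  then show ?case using lift_Tup_ex[OF i, of "[]"] lift_Tup_Nil[OF i] by auto
next
  case (Cons t ts)
  have i: "lift1 St i" using assms(1) by (simp add: same_def)
  obtain c where c: "lift2 (Tup (t # ts)) i c" using lift_Tup_ex[OF i] by blast
  obtain a b where ab: "lift2 (Val t) i a" "lift2 (Tup ts) i b" "c = pr a b"
    using lift_Tup_Cons[OF i c] by blast
  have "a = LI_val limit_model (val i) t"
    using lift_Val_unique[OF i ab(1)] Cons.prems by simp
  moreover have "b = listcode (map (LI_val limit_model (val i)) ts)"
    using lift_Tup_unique[OF i ab(2)] Cons by simp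
  ultimately show ?case using c ab(3) by simp
qed

lemma lift_Val_limit_model:
  assumes "same i"
  shows "lift2 (Val t) i (LI_val limit_model (val i) t)"
proof (induction t)
  case (Var n)
  then show ?case using assms lift_Val_Var by (simp add: same_def)
next
  case (Fun f ts)
  have i: "lift1 St i" using assms by (simp add: same_def)
  have Fn: "lift2 (Fn f) i c \<longleftrightarrow> lift2 (Fn f) i0 c" for c using assms by (simp add: same_def)
  let ?as = "map (LI_val limit_model (val i)) ts"
  have tup: "lift2 (Tup ts) i (listcode ?as)"
    by (rule lift_Tup_limit_model[OF assms Fun])
  have iff: "lift2 (Val (Fun f ts)) i a \<longleftrightarrow> lift2 (Fn f) i0 (listcode (a # ?as))" for a
  proof -
    have "lift2 (Tup ts) i c \<longleftrightarrow> c = listcode ?as" for c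
      using tup lift_Tup_unique[OF i tup] by blast
    then show ?thesis by (simp add: lift_Fun[OF i] Fn)
  qed
  obtain a where a: "lift2 (Val (Fun f ts)) i a" using lift_Val_ex[OF i] by blast
  then have "lift2 Car i0 a" using lift_Val_Car[OF i] assms by (simp add: same_def)
  then have ex: "\<exists>a. lift2 Car i0 a \<and> lift2 (Fn f) i0 (listcode (a # ?as))" using a iff by blast
  \<comment> \<open>The chosen value satisfies the lifted graph, and by \<open>iff\<close> any such
    value is a value of the term.\<close>
  then have "lift2 (Fn f) i0 (listcode (fun_int limit_model f ?as # ?as))"
    using someI_ex[OF ex] by (simp add: limit_model_def)
  then show ?case using iff by simp
qed

text \<open>Induction on the formula, each clause having been lifted. The state stays arbitrary
  because quantifiers move to updated states.\<close>

lemma lift_Sat_limit_model: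
  "same i \<Longrightarrow> lift1 (Sat \<phi>) i \<longleftrightarrow> LI_sat limit_model (val i) \<phi>"
proof (induction \<phi> arbitrary: i)
  case (Eq t u)
  then have i: "lift1 St i" by (simp add: same_def)
  note v = lift_Val_limit_model[OF Eq]
  have "lift2 (Val t) i a \<longleftrightarrow> a = LI_val limit_model (val i) t" for a t
    using lift_Val_unique[OF i v] v by blast
  then show ?case by (simp add: lift_Sat_Eq[OF i])
next
  case (Rel r ts)
  then have i: "lift1 St i" by (simp add: same_def)
  have t: "lift2 (Tup ts) i (listcode (map (LI_val limit_model (val i)) ts))"
    by (rule lift_Tup_limit_model[OF Rel lift_Val_limit_model[OF Rel]])
  have "lift2 (Tup ts) i c \<longleftrightarrow> c = listcode (map (LI_val limit_model (val i)) ts)" for c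
    using lift_Tup_unique[OF i t] t by blast
  then have "lift1 (Sat (Rel r ts)) i \<longleftrightarrow> lift2 (Rl r) i (listcode (map (LI_val limit_model (val i)) ts))"
    by (simp add: lift_Sat_Rel[OF i])
  also have "\<dots> \<longleftrightarrow> LI_sat limit_model (val i) (Rel r ts)"
    using Rel by (simp add: same_def limit_model_def)
  finally show ?case .
next
  case (Neg \<phi>)
  then have "lift1 St i" by (simp add: same_def)
  then show ?case using Neg by (simp add: lift_Sat_Neg)
next
  case (Conj \<phi> \<psi>)
  then have "lift1 St i" by (simp add: same_def)
  then show ?case using Conj by (simp add: lift_Sat_Conj)
next
  case (Exists n \<phi>)
  then have i: "lift1 St i" by (simp add: same_def)
  show ?case
    unfolding lift_Sat_Exists[OF i] LI_sat.simps
  proof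
    assume "\<exists>k. lift2 (Upd n) i k \<and> lift1 (Sat \<phi>) k"
    then obtain k where k: "lift2 (Upd n) i k" "lift1 (Sat \<phi>) k" by blast
    note sk = same_Upd[OF Exists.prems k(1)]
    have "LI_sat limit_model ((val i)(n := val k n)) \<phi>"
      using Exists.IH[OF sk] k(2) val_Upd[OF i k(1)] by simp
    then show "\<exists>a \<in> elts (carrier limit_model). LI_sat limit_model ((val i)(n := a)) \<phi>"
      using val_carrier[OF sk] by blast
  next
    assume "\<exists>a \<in> elts (carrier limit_model). LI_sat limit_model ((val i)(n := a)) \<phi>"
    then obtain a where a: "lift2 Car i a" "LI_sat limit_model ((val i)(n := a)) \<phi>"
      using Exists.prems by (auto simp: carrier_limit_model same_def)
    obtain k where k: "lift2 (Upd n) i k" "lift2 (Val (Var n)) k a"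
      using lift_Upd_ex[OF i a(1)] by blast
    have "val k n = a" using lift_Val_Var[OF lift_Upd_St[OF i k(1)]] k(2) by simp
    then have "val k = (val i)(n := a)" using val_Upd[OF i k(1)] by simp
    then have "lift1 (Sat \<phi>) k"
      using Exists.IH[OF same_Upd[OF Exists.prems k(1)]] a(2) by (simp only:)
    then show "\<exists>k. lift2 (Upd n) i k \<and> lift1 (Sat \<phi>) k" using k(1) by blast
  qed
next
  case (Haertig x y \<phi> \<psi>)
  then have i: "lift1 St i" by (simp add: same_def)
  \<comment> \<open>An element \<open>a\<close> of the carrier corresponds to an updated state
    \<open>k\<close> with \<open>val k = (val i)(n := a)\<close>, so the lifted Haertig clause
    compares the very sets defined in the limit model.\<close>
  have "{a. \<exists>k. lift2 (Upd n) i k \<and> lift2 (Val (Var n)) k a \<and> lift1 (Sat \<chi>) k} =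
      {a \<in> elts (carrier limit_model). LI_sat limit_model ((val i)(n := a)) \<chi>}"
    if IH: "\<And>i. same i \<Longrightarrow> lift1 (Sat \<chi>) i \<longleftrightarrow> LI_sat limit_model (val i) \<chi>" for n \<chi>
  proof (intro set_eqI iffI)
    fix a assume "a \<in> {a. \<exists>k. lift2 (Upd n) i k \<and> lift2 (Val (Var n)) k a \<and> lift1 (Sat \<chi>) k}"
    then obtain k where k: "lift2 (Upd n) i k" "lift2 (Val (Var n)) k a" "lift1 (Sat \<chi>) k" by blast
    note sk = same_Upd[OF Haertig.prems k(1)]
    have a: "val k n = a" using lift_Val_Var[OF lift_Upd_St[OF i k(1)]] k(2) by simp
    then have "val k = (val i)(n := a)" using val_Upd[OF i k(1)] by simp
    then have "LI_sat limit_model ((val i)(n := a)) \<chi>" using IH[OF sk] k(3) by (simp only:)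
    then show "a \<in> {a \<in> elts (carrier limit_model). LI_sat limit_model ((val i)(n := a)) \<chi>}"
      using val_carrier[OF sk, of n] a by blast
  next
    fix a assume "a \<in> {a \<in> elts (carrier limit_model). LI_sat limit_model ((val i)(n := a)) \<chi>}"
    then have a: "lift2 Car i a" "LI_sat limit_model ((val i)(n := a)) \<chi>"
      using Haertig.prems by (auto simp: carrier_limit_model same_def)
    obtain k where k: "lift2 (Upd n) i k" "lift2 (Val (Var n)) k a"
      using lift_Upd_ex[OF i a(1)] by blast
    have "val k n = a" using lift_Val_Var[OF lift_Upd_St[OF i k(1)]] k(2) by simp
    then have "val k = (val i)(n := a)" using val_Upd[OF i k(1)] by simp
    then have "lift1 (Sat \<chi>) k" using IH[OF same_Upd[OF Haertig.prems k(1)]] a(2) by (simp only:)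
    then show "a \<in> {a. \<exists>k. lift2 (Upd n) i k \<and> lift2 (Val (Var n)) k a \<and> lift1 (Sat \<chi>) k}"
      using k by blast
  qed
  then show ?case using Haertig.IH by (simp add: lift_Sat_Haertig[OF i])
qed

lemma has_model_limit:
  assumes "\<And>\<phi>. \<phi> \<in> T \<Longrightarrow> fm_fv \<phi> = {} \<and> lift1 (Sat \<phi>) i0"
  shows "has_model T"
  unfolding has_model_def
proof (intro exI[of _ limit_model] conjI ballI allI impI wf_limit_model)
  fix \<phi> and s :: "nat \<Rightarrow> 'v" assume "\<phi> \<in> T"
  then have "fm_fv \<phi> = {}" "lift1 (Sat \<phi>) i0" using assms by simp_all
  then show "LI_sat limit_model s \<phi>"
    using lift_Sat_limit_model[OF same_i0] LI_sat_cong[of \<phi> s "val i0" limit_model] by simp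
qed

end

end

lemma embedding_imp_compactness:
  fixes \<delta> :: "'v::zfc_universe"
  assumes emb: "\<And>\<gamma>. Ord \<gamma> \<Longrightarrow> \<delta> \<in> elts \<gamma> \<Longrightarrow> \<exists>\<alpha> M j. Ord \<alpha> \<and> \<gamma> \<in> elts \<alpha> \<and> transitive_set M \<and>
      elementary_embedding (Vset \<alpha>) M j \<and> cardinal_correct M \<and>
      (\<exists>d \<in> elts M. j ` elts \<gamma> \<subseteq> elts d \<and> cardinality_less (elts M) d (j \<delta>))"
    and \<delta>: "Card \<delta>"
  shows "LI_strong_compactness_cardinal \<delta>"
  unfolding LI_strong_compactness_cardinal_def
proof (intro conjI allI impI \<delta>)
  fix T :: "'v LI_fm set" assume T: "LI_theory T \<and> less_satisfiable \<delta> T"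
  obtain x0 :: 'v where "T \<lesssim> elts x0" using T by (auto simp: LI_theory_def)
  moreover obtain \<gamma> :: 'v where \<gamma>: "Ord \<gamma>" "elts \<gamma> \<approx> elts x0" using ex_Ord_eqpoll by blast
  ultimately have "T \<lesssim> elts \<gamma>" by (meson eqpoll_sym lepoll_trans2)
  then obtain e where e: "inj_on e T" "e ` T \<subseteq> elts \<gamma>" unfolding lepoll_def by blast

  \<comment> \<open>Indices of the small parts of \<open>T\<close>, seen through the injection
    \<open>e\<close> into \<open>\<gamma>\<close>.\<close>
  define D where "D = {d::'v. elts d \<subseteq> elts \<gamma> \<and> elts d \<prec> elts \<delta>}"
  have "\<exists>A. wf_structure A \<and> (\<forall>\<phi> \<in> T. e \<phi> \<in> elts d \<longrightarrow>
      (\<forall>s. range s \<subseteq> elts (carrier A) \<longrightarrow> LI_sat A s \<phi>))" if "d \<in> D" for d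
  proof -
    let ?T0 = "{\<phi> \<in> T. e \<phi> \<in> elts d}"
    have "inj_on e ?T0" using e(1) by (rule inj_on_subset) blast
    then have "?T0 \<lesssim> elts d" unfolding lepoll_def by (intro exI[of _ e]) auto
    then have "?T0 \<prec> elts \<delta>" using that lesspoll_trans1 unfolding D_def by blast
    moreover have "?T0 \<subseteq> T" by blast
    ultimately have "has_model ?T0" using T by (simp add: less_satisfiable_def)
    then show ?thesis unfolding has_model_def by blast
  qed
  then obtain A :: "'v \<Rightarrow> 'v LI_structure" where A: "\<And>d. d \<in> D \<Longrightarrow> wf_structure (A d)"
    and A_sat: "\<And>d \<phi> s. d \<in> D \<Longrightarrow> \<phi> \<in> T \<Longrightarrow> e \<phi> \<in> elts d \<Longrightarrow> range s \<subseteq> elts (carrier (A d)) \<Longrightarrow>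
      LI_sat (A d) s \<phi>"
    by metis

  define C where "C = (\<Union>d \<in> D. elts (carrier (A d)))"
  have small_D: "small TYPE('v) D"
    by (rule small_subset[OF small_elts[of "pset \<gamma>"]]) (auto simp: D_def)
  have small_C: "small TYPE('v) C"
    unfolding C_def by (rule small_Union[OF small_D small_elts])
  obtain c where c: "elts c = C" using small_imp_set[OF small_C] by blast
  \<comment> \<open>A state will code a pair of an index and an assignment into the model chosen for
    that index.\<close>
  define S where "S = (SIGMA d:D. {s :: nat \<Rightarrow> 'v. range s \<subseteq> elts (carrier (A d))})"
  have "small TYPE('v) (D \<times> {s :: nat \<Rightarrow> 'v. range s \<subseteq> C})"
    by (intro small_Times small_D small_sequences small_C)
  moreover have "S \<subseteq> D \<times> {s. range s \<subseteq> C}" unfolding S_def C_def by blast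
  ultimately have "small TYPE('v) S" by (rule small_subset)
  then obtain en :: "'v \<times> (nat \<Rightarrow> 'v) \<Rightarrow> 'v" and x where en: "inj_on en S" "elts x = en ` S"
    by (rule small_encode)
  define dec where "dec = inv_into S en"

  have o: "Ord \<delta>" using \<delta> by (simp add: is_cardinal_def)
  obtain \<theta>' where "limit_like (Vset \<theta>')" "up x (up c \<gamma>) \<in> elts (Vset \<theta>')"
    using ex_limit_level[OF o \<gamma>(1), of "up x (up c \<gamma>)"] by blast
  \<comment> \<open>\<open>P\<close> is to contain the codes of states, the elements of all carriers
    and the ordinals below \<open>\<gamma>\<close>.\<close>
  then obtain P where P: "limit_like P" "up x (up c \<gamma>) \<in> elts P" by blast
  have xP: "x \<in> elts P" and cP: "c \<in> elts P" and \<gamma>P: "\<gamma> \<in> elts P"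
    using limit_like_trans[OF P] limit_like_trans[OF P(1), of "up c \<gamma>"] by simp_all
  obtain crd :: "'v \<Rightarrow> 'v" where crd: "\<And>u. Card (crd u) \<and> elts (crd u) \<approx> elts u"
    using ex_Card_eqpoll by metis
  \<comment> \<open>\<open>K\<close> collects the cardinalities of all subsets of \<open>P\<close>;
    a level \<open>W\<close> containing \<open>K\<close> meets the assumption on cardinals in
    \<open>reflection\<close>.\<close>
  obtain K where K: "elts K = crd ` elts (pset P)" using replacement by blast
  obtain \<theta> where \<theta>: "Ord \<theta>" "limit_like (Vset \<theta>)" "up P K \<in> elts (Vset \<theta>)" "\<delta> \<in> elts \<theta>" "\<gamma> \<in> elts \<theta>"
    using ex_limit_level[OF o \<gamma>(1), of "up P K"] by blast
  define W where "W = Vset \<theta>"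
  have W: "limit_like W" using \<theta>(2) by (simp add: W_def)
  have PW: "P \<in> elts W" and KW: "K \<in> elts W"
    using limit_like_trans[OF W] \<theta>(3) unfolding W_def by auto
  have \<delta>W: "\<delta> \<in> elts W" and \<gamma>W: "\<gamma> \<in> elts W" using \<theta>(4,5) mem_Vset unfolding W_def by blast+
  obtain M j d where M: "transitive_set M" "elementary_embedding W M j" "cardinal_correct M"
    and d: "d \<in> elts M" "elts d \<subseteq> elts (j \<gamma>)" "j ` elts \<gamma> \<subseteq> elts d" "cardinality_less (elts M) d (j \<delta>)"
    using restricted_embedding[OF emb \<delta> \<theta>(4,1,2,5)] unfolding W_def[symmetric] by blast

  interpret reflection W P M j
  proof
    fix u :: 'v assume "elts u \<subseteq> elts P"
    then have "crd u \<in> elts K" by (simp add: K)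
    then show "\<exists>\<kappa> \<in> elts W. Card \<kappa> \<and> elts \<kappa> \<approx> elts u"
      using crd limit_like_trans[OF W KW] by blast
  qed (fact W P(1) PW M)+

  define St where "St i \<longleftrightarrow> i \<in> elts x" for i
  have dec: "dec i \<in> S" if "St i" for i
    using that unfolding St_def dec_def en(2) by (rule inv_into_into)
  have idx: "fst (dec i) \<in> D" and asg: "range (snd (dec i)) \<subseteq> elts (carrier (A (fst (dec i))))"
    if "St i" for i
    using dec[OF that] by (auto simp: S_def)
  have state: "\<exists>i. St i \<and> fst (dec i) = d \<and> snd (dec i) = s"
    if "d \<in> D" "range s \<subseteq> elts (carrier (A d))" for d s
  proof -
    have "(d, s) \<in> S" using that by (simp add: S_def)
    then have "dec (en (d, s)) = (d, s)" "St (en (d, s))"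
      unfolding dec_def St_def en(2) using inv_into_f_f[OF en(1)] by blast+
    then show ?thesis by (intro exI[of _ "en (d, s)"]) simp
  qed
  interpret model_family W P M j A St "\<lambda>i. fst (dec i)" "\<lambda>i. snd (dec i)"
  proof
    fix i assume i: "St i"
    show "wf_structure (A (fst (dec i)))" by (rule A[OF idx[OF i]])
    have "elts (carrier (A (fst (dec i)))) \<subseteq> elts c" unfolding c C_def using idx[OF i] by blast
    then show "elts (carrier (A (fst (dec i)))) \<subseteq> elts P" using limit_like_trans[OF P(1) cP] by blast
    show "range (snd (dec i)) \<subseteq> elts (carrier (A (fst (dec i))))" by (rule asg[OF i])
    show "i \<in> elts P" using i limit_like_trans[OF P(1) xP] by (simp add: St_def)
    fix n a assume "a \<in> elts (carrier (A (fst (dec i))))"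
    then have "range ((snd (dec i))(n := a)) \<subseteq> elts (carrier (A (fst (dec i))))"
      using asg[OF i] by auto
    then show "\<exists>k. St k \<and> fst (dec k) = fst (dec i) \<and> snd (dec k) = (snd (dec i))(n := a)"
      using state[OF idx[OF i]] by blast
  qed

  \<comment> \<open>In \<open>W\<close>, a subset \<open>u\<close> of \<open>\<gamma>\<close>
    smaller than \<open>\<delta>\<close> is itself an index, and a constant assignment turns it into
    a state; the lift provides a state of \<open>M\<close> for \<open>d\<close>.\<close>
  have "\<exists>i. lift1 St i \<and> (\<forall>\<xi> \<in> elts d. lift2 (\<lambda>\<xi> i. \<xi> \<in> elts (fst (dec i))) \<xi> i)"
  proof (rule lift_cover[OF _ \<gamma>W \<delta>W d(1,2,4)])
    fix u assume u: "u \<in> elts W" "elts u \<subseteq> elts \<gamma>" "cardinality_less (elts W) u \<delta>"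
    obtain \<kappa> where \<kappa>: "\<kappa> \<in> elts \<delta>" "elts \<kappa> \<approx> elts u"
      using cardinality_less_transitive[OF limit_like_transitive[OF W] u(3,1) \<delta>W] by blast
    have "elts u \<prec> elts \<delta>"
      using eqpoll_sym[OF \<kappa>(2)] Card_mem_lesspoll[OF \<delta> \<kappa>(1)] by (rule eq_lesspoll_trans)
    then have uD: "u \<in> D" using u(2) by (simp add: D_def)
    then obtain a where "a \<in> elts (carrier (A u))" using A unfolding wf_structure_def by blast
    then have "range (\<lambda>_::nat. a) \<subseteq> elts (carrier (A u))" by auto
    from state[OF uD this] obtain i where "St i" "fst (dec i) = u" by blast
    then show "\<exists>i \<in> elts P. St i \<and> (\<forall>\<xi> \<in> elts u. \<xi> \<in> elts P \<and> \<xi> \<in> elts (fst (dec i)))"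
      using St_P u(2) limit_like_trans[OF P(1) \<gamma>P] by blast
  qed
  then obtain i0 where i0: "lift1 St i0"
    and cover: "\<And>\<xi>. \<xi> \<in> elts d \<Longrightarrow> lift2 (\<lambda>\<xi> i. \<xi> \<in> elts (fst (dec i))) \<xi> i0" by blast
  show "has_model T"
  proof (rule has_model_limit[OF i0], rule conjI)
    fix \<phi> assume \<phi>: "\<phi> \<in> T"
    then show "fm_fv \<phi> = {}" using T by (simp add: LI_theory_def)
    have e\<phi>: "e \<phi> \<in> elts \<gamma>" using e(2) \<phi> by blast
    \<comment> \<open>Every state whose index contains \<open>e \<phi>\<close> satisfies
      \<open>\<phi>\<close>; as \<open>j (e \<phi>)\<close> belongs to \<open>d\<close>, the lifted
      implication applies at \<open>i0\<close>.\<close>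
    show "lift1 (Sat \<phi>) i0"
    proof (rule lift_point[where D = "\<lambda>\<xi> i. \<xi> \<in> elts (fst (dec i))" and \<xi> = "e \<phi>" and Q = St])
      show "Sat \<phi> i" if "St i" "e \<phi> \<in> elts (fst (dec i))" for i
        unfolding Sat_def by (rule A_sat[OF idx[OF that(1)] \<phi> that(2) asg[OF that(1)]])
      show "e \<phi> \<in> elts P" by (rule limit_like_trans[OF P(1) \<gamma>P e\<phi>])
      show "lift2 (\<lambda>\<xi> i. \<xi> \<in> elts (fst (dec i))) (j (e \<phi>)) i0"
        by (rule cover) (use d(3) e\<phi> in blast)
    qed (rule i0)
  qed
qed

theorem theorem10p2:
  fixes \<delta> :: "'v::zfc_universe"
  assumes "Card \<delta>"
  shows "LI_strong_compactness_cardinal \<delta> \<longleftrightarrow>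
    (\<forall>\<gamma>. Ord \<gamma> \<and> \<delta> \<in> elts \<gamma> \<longrightarrow>
      (\<exists>\<alpha> M j. Ord \<alpha> \<and> \<gamma> \<in> elts \<alpha> \<and> transitive_set M \<and>
         elementary_embedding (Vset \<alpha>) M j \<and>
         cardinal_correct M \<and>
         (\<exists>\<kappa>. critical_point (Vset \<alpha>) j \<kappa> \<and> (\<kappa> \<in> elts \<delta> \<or> \<kappa> = \<delta>)) \<and>
         (\<exists>d \<in> elts M. j ` elts \<gamma> \<subseteq> elts d \<and> cardinality_less (elts M) d (j \<delta>))))"
proof
  assume "LI_strong_compactness_cardinal \<delta>"
  then show "\<forall>\<gamma>. Ord \<gamma> \<and> \<delta> \<in> elts \<gamma> \<longrightarrow>
      (\<exists>\<alpha> M j. Ord \<alpha> \<and> \<gamma> \<in> elts \<alpha> \<and> transitive_set M \<and>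
         elementary_embedding (Vset \<alpha>) M j \<and>
         cardinal_correct M \<and>
         (\<exists>\<kappa>. critical_point (Vset \<alpha>) j \<kappa> \<and> (\<kappa> \<in> elts \<delta> \<or> \<kappa> = \<delta>)) \<and>
         (\<exists>d \<in> elts M. j ` elts \<gamma> \<subseteq> elts d \<and> cardinality_less (elts M) d (j \<delta>)))"
    by (intro allI impI, elim conjE) (rule compactness_imp_embedding)
next
  assume emb: "\<forall>\<gamma>. Ord \<gamma> \<and> \<delta> \<in> elts \<gamma> \<longrightarrow>
      (\<exists>\<alpha> M j. Ord \<alpha> \<and> \<gamma> \<in> elts \<alpha> \<and> transitive_set M \<and>
         elementary_embedding (Vset \<alpha>) M j \<and>
         cardinal_correct M \<and>
         (\<exists>\<kappa>. critical_point (Vset \<alpha>) j \<kappa> \<and> (\<kappa> \<in> elts \<delta> \<or> \<kappa> = \<delta>)) \<and>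
         (\<exists>d \<in> elts M. j ` elts \<gamma> \<subseteq> elts d \<and> cardinality_less (elts M) d (j \<delta>)))"
  show "LI_strong_compactness_cardinal \<delta>"
    by (rule embedding_imp_compactness[OF _ assms]) (use emb in blast)
qed

end
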